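(* Satisfiability of E-flat formulae is decidable.
   Context: Logic: Presburger arithmetic over $\mathbb Z$ extended with free unary function symbols (array-ids) and cardinality terms. Terms: numerals $n\in\mathbb Z$, parameters (free constants, including a distinguished parameter $N$), individual variables, $t+t$, $-t$, $a(t)$ for an array-id $a$, and $\sharp\{x\mid\phi\}$. Atoms: $t<t$, $t=t$, $t\equiv_n t$. Formulae are built from atoms by $\wedge,\neg,\exists x$. Semantics: over the integers; each array-id $a$ is interpreted as a function $\mathbb Z\to\mathbb Z$ with $a(x)=0$ for $x\notin[0,N)$; $\sharp\{x\mid\phi\}$ denotes the cardinality of the set of $x\in[0,N)$ such that $\phi(x)$ holds (it binds $x$). Satisfiability means some assignment to parameters, free variables and array-ids (respecting these conventions) makes the formula true. An arithmetic formula is one containing neither array-ids nor $\sharp$. A basic formula is one obtained from an arithmetic formula by simultaneously replacing some free variables by terms $a(y)$ with $y$ a variable and $a$ an array-id. An E-flat formula is a formula of the form $\exists\underline z.\,\alpha\wedge\sharp\{x\mid\beta_1\}=z_1\wedge\cdots\wedge\sharp\{x\mid\beta_K\}=z_K$ with $\underline z=z_1,\dots,z_K$, where $\alpha,\beta_1,\dots,\beta_K$ are basic formulae and $x$ does not occur in $\alpha$. *)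

theory Defs
  imports Main "HOL-Library.Nat_Bijection" "HOL-Number_Theory.Cong"
begin

text \<open>Parameters, individual variables and array-ids are three disjoint countable supplies of
  symbols, each indexed by natural numbers. Variables are named, not de Bruijn indices.\<close>

datatype trm =
    Num int
  | Par nat
  | Var nat
  | Add trm trm
  | Minus trm
  | App nat trm
  | Card nat fm
and fm =
    Less trm trm
  | Equal trm trm
  | Congr nat trm trm
  | Conj fm fm
  | Neg fm
  | Exi nat fm

text \<open>The index of the distinguished parameter \<open>N\<close>.\<close>

definition parN :: nat where
  "parN = 0"

text \<open>\<open>p\<close>, \<open>A\<close>, \<open>v\<close> interpret parameters, array-ids and variables. In \<open>Congr n s t\<close>, modulus
  \<open>n = 0\<close> is the usual degenerate case, i.e. equality.\<close>

primrec tval :: "(nat \<Rightarrow> int) \<Rightarrow> (nat \<Rightarrow> int \<Rightarrow> int) \<Rightarrow> (nat \<Rightarrow> int) \<Rightarrow> trm \<Rightarrow> int"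
  and holds :: "(nat \<Rightarrow> int) \<Rightarrow> (nat \<Rightarrow> int \<Rightarrow> int) \<Rightarrow> (nat \<Rightarrow> int) \<Rightarrow> fm \<Rightarrow> bool" where
  "tval p A v (Num n) = n"
| "tval p A v (Par c) = p c"
| "tval p A v (Var x) = v x"
| "tval p A v (Add s t) = tval p A v s + tval p A v t"
| "tval p A v (Minus t) = - tval p A v t"
| "tval p A v (App a t) = A a (tval p A v t)"
| "tval p A v (Card x \<phi>) = int (card {k \<in> {0..<p parN}. holds p A (v(x := k)) \<phi>})"
| "holds p A v (Less s t) \<longleftrightarrow> tval p A v s < tval p A v t"
| "holds p A v (Equal s t) \<longleftrightarrow> tval p A v s = tval p A v t"
| "holds p A v (Congr n s t) \<longleftrightarrow> [tval p A v s = tval p A v t] (mod int n)"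
| "holds p A v (Conj \<phi> \<psi>) \<longleftrightarrow> holds p A v \<phi> \<and> holds p A v \<psi>"
| "holds p A v (Neg \<phi>) \<longleftrightarrow> \<not> holds p A v \<phi>"
| "holds p A v (Exi x \<phi>) \<longleftrightarrow> (\<exists>k. holds p A (v(x := k)) \<phi>)"

definition satisfiable :: "fm \<Rightarrow> bool" where
  "satisfiable \<phi> \<longleftrightarrow>
     (\<exists>p A v. (\<forall>a k. k \<notin> {0..<p parN} \<longrightarrow> A a k = 0) \<and> holds p A v \<phi>)"

primrec tfv :: "trm \<Rightarrow> nat set" and fv :: "fm \<Rightarrow> nat set" where
  "tfv (Num n) = {}"
| "tfv (Par c) = {}"
| "tfv (Var x) = {x}"
| "tfv (Add s t) = tfv s \<union> tfv t"
| "tfv (Minus t) = tfv t"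
| "tfv (App a t) = tfv t"
| "tfv (Card x \<phi>) = fv \<phi> - {x}"
| "fv (Less s t) = tfv s \<union> tfv t"
| "fv (Equal s t) = tfv s \<union> tfv t"
| "fv (Congr n s t) = tfv s \<union> tfv t"
| "fv (Conj \<phi> \<psi>) = fv \<phi> \<union> fv \<psi>"
| "fv (Neg \<phi>) = fv \<phi>"
| "fv (Exi x \<phi>) = fv \<phi> - {x}"

text \<open>All variables that occur, free or bound, including those named only by a binder.\<close>

primrec tvars :: "trm \<Rightarrow> nat set" and vars :: "fm \<Rightarrow> nat set" where
  "tvars (Num n) = {}"
| "tvars (Par c) = {}"
| "tvars (Var x) = {x}"
| "tvars (Add s t) = tvars s \<union> tvars t"
| "tvars (Minus t) = tvars t"
| "tvars (App a t) = tvars t"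
| "tvars (Card x \<phi>) = insert x (vars \<phi>)"
| "vars (Less s t) = tvars s \<union> tvars t"
| "vars (Equal s t) = tvars s \<union> tvars t"
| "vars (Congr n s t) = tvars s \<union> tvars t"
| "vars (Conj \<phi> \<psi>) = vars \<phi> \<union> vars \<psi>"
| "vars (Neg \<phi>) = vars \<phi>"
| "vars (Exi x \<phi>) = insert x (vars \<phi>)"

text \<open>Simultaneous substitution for free variables. Bound variables are not renamed; capture is
  excluded separately by \<open>free_for\<close>.\<close>

primrec tsubst :: "(nat \<Rightarrow> trm) \<Rightarrow> trm \<Rightarrow> trm" and subst :: "(nat \<Rightarrow> trm) \<Rightarrow> fm \<Rightarrow> fm" where
  "tsubst \<sigma> (Num n) = Num n"
| "tsubst \<sigma> (Par c) = Par c"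
| "tsubst \<sigma> (Var x) = \<sigma> x"
| "tsubst \<sigma> (Add s t) = Add (tsubst \<sigma> s) (tsubst \<sigma> t)"
| "tsubst \<sigma> (Minus t) = Minus (tsubst \<sigma> t)"
| "tsubst \<sigma> (App a t) = App a (tsubst \<sigma> t)"
| "tsubst \<sigma> (Card x \<phi>) = Card x (subst (\<sigma>(x := Var x)) \<phi>)"
| "subst \<sigma> (Less s t) = Less (tsubst \<sigma> s) (tsubst \<sigma> t)"
| "subst \<sigma> (Equal s t) = Equal (tsubst \<sigma> s) (tsubst \<sigma> t)"
| "subst \<sigma> (Congr n s t) = Congr n (tsubst \<sigma> s) (tsubst \<sigma> t)"
| "subst \<sigma> (Conj \<phi> \<psi>) = Conj (subst \<sigma> \<phi>) (subst \<sigma> \<psi>)"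
| "subst \<sigma> (Neg \<phi>) = Neg (subst \<sigma> \<phi>)"
| "subst \<sigma> (Exi x \<phi>) = Exi x (subst (\<sigma>(x := Var x)) \<phi>)"

text \<open>\<open>free_for \<sigma> \<phi>\<close>: no variable of a substituted term is captured by a binder of \<open>\<phi>\<close>.\<close>

primrec tfree_for :: "(nat \<Rightarrow> trm) \<Rightarrow> trm \<Rightarrow> bool"
  and free_for :: "(nat \<Rightarrow> trm) \<Rightarrow> fm \<Rightarrow> bool" where
  "tfree_for \<sigma> (Num n) \<longleftrightarrow> True"
| "tfree_for \<sigma> (Par c) \<longleftrightarrow> True"
| "tfree_for \<sigma> (Var x) \<longleftrightarrow> True"
| "tfree_for \<sigma> (Add s t) \<longleftrightarrow> tfree_for \<sigma> s \<and> tfree_for \<sigma> t"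
| "tfree_for \<sigma> (Minus t) \<longleftrightarrow> tfree_for \<sigma> t"
| "tfree_for \<sigma> (App a t) \<longleftrightarrow> tfree_for \<sigma> t"
| "tfree_for \<sigma> (Card x \<phi>) \<longleftrightarrow>
     (\<forall>u \<in> fv \<phi> - {x}. x \<notin> tfv (\<sigma> u)) \<and> free_for (\<sigma>(x := Var x)) \<phi>"
| "free_for \<sigma> (Less s t) \<longleftrightarrow> tfree_for \<sigma> s \<and> tfree_for \<sigma> t"
| "free_for \<sigma> (Equal s t) \<longleftrightarrow> tfree_for \<sigma> s \<and> tfree_for \<sigma> t"
| "free_for \<sigma> (Congr n s t) \<longleftrightarrow> tfree_for \<sigma> s \<and> tfree_for \<sigma> t"
| "free_for \<sigma> (Conj \<phi> \<psi>) \<longleftrightarrow> free_for \<sigma> \<phi> \<and> free_for \<sigma> \<psi>"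
| "free_for \<sigma> (Neg \<phi>) \<longleftrightarrow> free_for \<sigma> \<phi>"
| "free_for \<sigma> (Exi x \<phi>) \<longleftrightarrow>
     (\<forall>u \<in> fv \<phi> - {x}. x \<notin> tfv (\<sigma> u)) \<and> free_for (\<sigma>(x := Var x)) \<phi>"

primrec tarith :: "trm \<Rightarrow> bool" and arith :: "fm \<Rightarrow> bool" where
  "tarith (Num n) \<longleftrightarrow> True"
| "tarith (Par c) \<longleftrightarrow> True"
| "tarith (Var x) \<longleftrightarrow> True"
| "tarith (Add s t) \<longleftrightarrow> tarith s \<and> tarith t"
| "tarith (Minus t) \<longleftrightarrow> tarith t"
| "tarith (App a t) \<longleftrightarrow> False"
| "tarith (Card x \<phi>) \<longleftrightarrow> False"
| "arith (Less s t) \<longleftrightarrow> tarith s \<and> tarith t"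
| "arith (Equal s t) \<longleftrightarrow> tarith s \<and> tarith t"
| "arith (Congr n s t) \<longleftrightarrow> tarith s \<and> tarith t"
| "arith (Conj \<phi> \<psi>) \<longleftrightarrow> arith \<phi> \<and> arith \<psi>"
| "arith (Neg \<phi>) \<longleftrightarrow> arith \<phi>"
| "arith (Exi x \<phi>) \<longleftrightarrow> arith \<phi>"

definition basic :: "fm \<Rightarrow> bool" where
  "basic \<phi> \<longleftrightarrow>
     (\<exists>\<psi> \<sigma>. arith \<psi> \<and> (\<forall>u. \<sigma> u = Var u \<or> (\<exists>a y. \<sigma> u = App a (Var y))) \<and>
            free_for \<sigma> \<psi> \<and> \<phi> = subst \<sigma> \<psi>)"

text \<open>The iterated conjunction is bracketed to the left.\<close>

definition eflat :: "fm \<Rightarrow> bool" where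
  "eflat \<phi> \<longleftrightarrow>
     (\<exists>x zs \<alpha> \<beta>s. length \<beta>s = length zs \<and> basic \<alpha> \<and> (\<forall>\<beta> \<in> set \<beta>s. basic \<beta>) \<and> x \<notin> vars \<alpha> \<and>
        \<phi> = foldr Exi zs (foldl Conj \<alpha> (map2 (\<lambda>\<beta> z. Equal (Card x \<beta>) (Var z)) \<beta>s zs)))"

text \<open>The (total) general recursive functions of arity \<open>n\<close>, with unbounded minimisation applied
  only to regular functions. A function of arity \<open>n\<close> is represented on argument lists; its values
  on lists of length other than \<open>n\<close> are irrelevant.\<close>

inductive recursive :: "nat \<Rightarrow> (nat list \<Rightarrow> nat) \<Rightarrow> bool" where
  rec_zero: "recursive n (\<lambda>_. 0)"
| rec_succ: "recursive 1 (\<lambda>xs. Suc (hd xs))"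
| rec_proj: "i < n \<Longrightarrow> recursive n (\<lambda>xs. xs ! i)"
| rec_comp: "recursive (length gs) f \<Longrightarrow> (\<forall>g \<in> set gs. recursive n g) \<Longrightarrow>
    recursive n (\<lambda>xs. f (map (\<lambda>g. g xs) gs))"
| rec_prim: "recursive n f \<Longrightarrow> recursive (Suc (Suc n)) g \<Longrightarrow>
    recursive (Suc n) (\<lambda>xs. rec_nat (f (tl xs)) (\<lambda>k r. g (k # r # tl xs)) (hd xs))"
| rec_min: "recursive (Suc n) f \<Longrightarrow> (\<forall>xs. length xs = n \<longrightarrow> (\<exists>y. f (y # xs) = 0)) \<Longrightarrow>
    recursive n (\<lambda>xs. LEAST y. f (y # xs) = 0)"

definition decidable :: "nat set \<Rightarrow> bool" where
  "decidable S \<longleftrightarrow> (\<exists>f. recursive 1 f \<and> (\<forall>n. f [n] = (if n \<in> S then 1 else 0)))"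

text \<open>An explicit Goedel numbering. Tags of terms and formulae are disjoint, and the code of a
  compound expression exceeds those of its parts.\<close>

primrec tcode :: "trm \<Rightarrow> nat" and code :: "fm \<Rightarrow> nat" where
  "tcode (Num n) = prod_encode (0, int_encode n)"
| "tcode (Par c) = prod_encode (1, c)"
| "tcode (Var x) = prod_encode (2, x)"
| "tcode (Add s t) = prod_encode (3, prod_encode (tcode s, tcode t))"
| "tcode (Minus t) = prod_encode (4, tcode t)"
| "tcode (App a t) = prod_encode (5, prod_encode (a, tcode t))"
| "tcode (Card x \<phi>) = prod_encode (6, prod_encode (x, code \<phi>))"
| "code (Less s t) = prod_encode (7, prod_encode (tcode s, tcode t))"
| "code (Equal s t) = prod_encode (8, prod_encode (tcode s, tcode t))"
| "code (Congr n s t) = prod_encode (9, prod_encode (n, prod_encode (tcode s, tcode t)))"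
| "code (Conj \<phi> \<psi>) = prod_encode (10, prod_encode (code \<phi>, code \<psi>))"
| "code (Neg \<phi>) = prod_encode (11, code \<phi>)"
| "code (Exi x \<phi>) = prod_encode (12, prod_encode (x, code \<phi>))"

lemma tcode_inject: "tcode s = tcode t \<Longrightarrow> s = t"
  and code_inject: "code \<phi> = code \<psi> \<Longrightarrow> \<phi> = \<psi>"
proof (induction s and \<phi> arbitrary: t and \<psi>)
qed (case_tac t; simp add: prod_encode_eq int_encode_eq; fail |
     case_tac \<psi>; simp add: prod_encode_eq; fail)+

end

theory Submission imports Defs "HOL-Library.FuncSet" begin

text \<open>Instead of eliminating quantifiers, formulae are evaluated with bounded quantifiers. Call two
  integer valuations \<open>M\<close>-equivalent if they agree on the sign of every linear form with coefficients
  at most \<open>M\<close> and on all residues modulo \<open>M!\<close>. Equivalence at a computably larger level has the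
  back-and-forth property, with a computable bound on the answering value. Hence the truth of a basic
  formula depends only on the equivalence class of the values of its parameters, variables and terms
  \<open>a(y)\<close>, and its quantifiers may be bounded.

  For an E-flat formula, colour each \<open>k \<in> [0,N)\<close> by the set of those \<open>\<beta>\<^sub>j\<close> that hold at \<open>k\<close>. Up to
  equivalence the interval splits into finitely many cells, each cut out by two linear thresholds and
  a congruence, so the size of a cell is linear in the valuation once residues are fixed. Adjoin, for
  each cell and colour, the number of points of that colour in that cell as new coordinates, replace the
  extended valuation by a small equivalent one, and recolour its cells with the new multiplicities;
  back-and-forth then yields array values realising the colours. So a satisfiable E-flat formula has a
  model of computably bounded size, and only a finite search is left.\<close>

section \<open>Computable functions\<close>

text \<open>A basic formula depends on finitely many integers because capture is excluded: no
  quantifier binds the \<open>y\<close> of a term \<open>a(y)\<close>, so \<open>a(y)\<close> can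
  serve as a coordinate beside \<open>y\<close>. The price is that a small valuation of these
  coordinates need not come from functions. Consistency survives because \<open>y = y'\<close> is
  itself a linear condition with small coefficients: positions that coincide after the replacement
  coincided before, and so did the array values there.

  The size of a cell is not quite linear: the cell collects the \<open>k\<close> of a fixed residue
  modulo \<open>M!\<close> with \<open>M! * k\<close> between two thresholds, so its size is the
  distance of the thresholds, rounded and divided by \<open>(M!)^2\<close>. This is why residues
  modulo \<open>(M!)^2\<close> must be controlled and why the levels grow as they do.

  Decidability refers to an explicit class of functions, so all bounds are closed terms and
  iterates. Bounded evaluation only reads codes, whereas quantifier elimination would have to
  produce them.\<close>

definition computable :: "nat \<Rightarrow> (nat list \<Rightarrow> nat) \<Rightarrow> bool" where
  "computable n f \<longleftrightarrow> (\<exists>g. recursive n g \<and> (\<forall>xs. length xs = n \<longrightarrow> g xs = f xs))"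

text \<open>This closure is the purpose of \<open>computable\<close>: the schemes for
  \<open>recursive\<close> leave arbitrary values on lists of the wrong length, so
  \<open>recursive\<close> is not directly closed under agreement on lists of length
  \<open>n\<close>.\<close>

lemma computable_cong:
  "computable n f \<Longrightarrow> (\<And>xs. length xs = n \<Longrightarrow> f xs = g xs) \<Longrightarrow> computable n g"
  unfolding computable_def by metis

lemma computable_recursive: "recursive n f \<Longrightarrow> computable n f"
  unfolding computable_def by blast

lemma computable_proj: "i < n \<Longrightarrow> computable n (\<lambda>xs. xs ! i)"
  by (rule computable_recursive, rule rec_proj)

lemma computable_comp:
  assumes f: "computable (length gs) f" and gs: "\<forall>g \<in> set gs. computable n g"
  shows "computable n (\<lambda>xs. f (map (\<lambda>g. g xs) gs))"
proof -
  obtain f' where f': "recursive (length gs) f'" "\<And>xs. length xs = length gs \<Longrightarrow> f' xs = f xs"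
    using f unfolding computable_def by blast
  obtain G where G: "\<And>g. g \<in> set gs \<Longrightarrow> recursive n (G g)"
    "\<And>g xs. g \<in> set gs \<Longrightarrow> length xs = n \<Longrightarrow> G g xs = g xs"
    using gs unfolding computable_def by metis
  have "recursive n (\<lambda>xs. f' (map (\<lambda>g. g xs) (map G gs)))"
    using f'(1) G(1) by (intro rec_comp) auto
  moreover have "f' (map (\<lambda>g. g xs) (map G gs)) = f (map (\<lambda>g. g xs) gs)" if "length xs = n" for xs
    using f'(2) G(2) that by (auto simp: comp_def cong: map_cong)
  ultimately show ?thesis unfolding computable_def by blast
qed

lemma computable_comp1:
  assumes "computable 1 (\<lambda>xs. f (xs ! 0))" "computable n g"
  shows "computable n (\<lambda>xs. f (g xs))"
  using computable_comp[of "[g]" "\<lambda>xs. f (xs ! 0)" n] assms by simp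

lemma computable_comp2:
  assumes "computable 2 (\<lambda>xs. f (xs ! 0) (xs ! 1))" "computable n g" "computable n h"
  shows "computable n (\<lambda>xs. f (g xs) (h xs))"
  using computable_comp[of "[g, h]" "\<lambda>xs. f (xs ! 0) (xs ! 1)" n] assms by (simp add: numeral_2_eq_2)

lemma computable_Suc: "computable n f \<Longrightarrow> computable n (\<lambda>xs. Suc (f xs))"
proof (rule computable_comp1[of Suc])
  show "computable 1 (\<lambda>xs. Suc (xs ! 0))"
    by (rule computable_cong[OF computable_recursive[OF rec_succ]]) (auto simp: length_Suc_conv)
qed

lemma computable_const: "computable n (\<lambda>_. k)"
  by (induction k) (auto intro: computable_Suc computable_recursive rec_zero)

lemma computable_rec_nat2:
  assumes "computable 1 (\<lambda>xs. f (xs ! 0))" "computable 3 (\<lambda>xs. g (xs ! 2) (xs ! 0) (xs ! 1))"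
  shows "computable 2 (\<lambda>xs. rec_nat (f (xs ! 1)) (g (xs ! 1)) (xs ! 0))"
proof -
  obtain f' g' where f': "recursive 1 f'" "\<And>xs. length xs = 1 \<Longrightarrow> f' xs = f (xs ! 0)"
    and g': "recursive 3 g'" "\<And>xs. length xs = 3 \<Longrightarrow> g' xs = g (xs ! 2) (xs ! 0) (xs ! 1)"
    using assms unfolding computable_def by blast
  have 1: "recursive 2 (\<lambda>xs. rec_nat (f' (tl xs)) (\<lambda>k r. g' (k # r # tl xs)) (hd xs))"
    using rec_prim[of 1 f' g'] f'(1) g'(1) by (simp add: numeral_2_eq_2 numeral_3_eq_3)
  have "rec_nat (f' (tl xs)) (\<lambda>k r. g' (k # r # tl xs)) (hd xs) =
    rec_nat (f (xs ! 1)) (g (xs ! 1)) (xs ! 0)" if l: "length xs = 2" for xs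
  proof -
    obtain a b where xs: "xs = [a, b]"
      using l by (auto simp: numeral_2_eq_2 length_Suc_conv)
    have "rec_nat (f' [b]) (\<lambda>k r. g' [k, r, b]) j = rec_nat (f b) (g b) j" for j
      by (induction j) (auto simp: f'(2) g'(2))
    then show ?thesis by (simp add: xs)
  qed
  with 1 show ?thesis unfolding computable_def by blast
qed

lemma computable_rec_nat:
  assumes "computable 1 (\<lambda>xs. f (xs ! 0))" "computable 3 (\<lambda>xs. g (xs ! 2) (xs ! 0) (xs ! 1))"
    "computable n p" "computable n h"
  shows "computable n (\<lambda>xs. rec_nat (f (p xs)) (g (p xs)) (h xs))"
  using computable_comp2[OF computable_rec_nat2[OF assms(1,2)] assms(4,3)] .

lemma computable_add:
  assumes "computable n f" "computable n g" shows "computable n (\<lambda>xs. f xs + g xs)"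
proof -
  have "rec_nat a (\<lambda>k r. Suc r) b = a + b" for a b by (induction b) auto
  moreover have "computable n (\<lambda>xs. rec_nat (f xs) (\<lambda>k r. Suc r) (g xs))"
    using computable_rec_nat[of "\<lambda>x. x" "\<lambda>z k r. Suc r"] assms
    by (simp add: computable_proj computable_Suc)
  ultimately show ?thesis by simp
qed

lemma computable_mult:
  assumes "computable n f" "computable n g" shows "computable n (\<lambda>xs. f xs * g xs)"
proof -
  have "rec_nat 0 (\<lambda>k r. r + a) b = a * b" for a b :: nat by (induction b) auto
  moreover have "computable n (\<lambda>xs. rec_nat 0 (\<lambda>k r. r + f xs) (g xs))"
    using computable_rec_nat[of "\<lambda>x. 0" "\<lambda>z k r. r + z"] assms
    by (simp add: computable_proj computable_add computable_const)
  ultimately show ?thesis by simp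
qed

lemma computable_diff:
  assumes "computable n f" "computable n g" shows "computable n (\<lambda>xs. f xs - g xs)"
proof -
  have p: "rec_nat 0 (\<lambda>k r. k) b = b - 1" for b :: nat by (cases b) auto
  have "computable 1 (\<lambda>xs. rec_nat 0 (\<lambda>k r. k) (xs ! 0))"
    using computable_rec_nat[of "\<lambda>x. 0" "\<lambda>z k r. k" 1 "\<lambda>xs. xs ! 0" "\<lambda>xs. xs ! 0"]
    by (simp add: computable_proj computable_const)
  then have pred: "computable 1 (\<lambda>xs. xs ! 0 - 1)" by (simp add: p)
  have d: "rec_nat a (\<lambda>k r. r - 1) b = a - b" for a b :: nat by (induction b) auto
  have "computable n (\<lambda>xs. rec_nat (f xs) (\<lambda>k r. r - 1) (g xs))"
    using computable_rec_nat[of "\<lambda>x. x" "\<lambda>z k r. r - 1"] assms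
      computable_comp1[of "\<lambda>r. r - 1" 3 "\<lambda>xs. xs ! 1", OF pred]
    by (simp add: computable_proj)
  then show ?thesis by (simp only: d)
qed

lemma computable_triangle:
  assumes "computable n f" shows "computable n (\<lambda>xs. triangle (f xs))"
proof -
  have "rec_nat 0 (\<lambda>k r. r + Suc k) b = triangle b" for b by (induction b) auto
  moreover have "computable n (\<lambda>xs. rec_nat 0 (\<lambda>k r. r + Suc k) (f xs))"
    using computable_rec_nat[of "\<lambda>x. 0" "\<lambda>z k r. r + Suc k" n f f] assms
    by (simp del: add_Suc_right add: computable_proj computable_add computable_const computable_Suc)
  ultimately show ?thesis by simp
qed

lemma computable_Least:
  assumes "computable 2 (\<lambda>xs. f (xs ! 1) (xs ! 0))" "\<And>z. \<exists>k. f z k = 0" "computable n g"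
  shows "computable n (\<lambda>xs. LEAST k. f (g xs) k = (0::nat))"
proof -
  obtain f' where f': "recursive 2 f'" "\<And>xs. length xs = 2 \<Longrightarrow> f' xs = f (xs ! 1) (xs ! 0)"
    using assms(1) unfolding computable_def by blast
  have "recursive 1 (\<lambda>xs. LEAST y. f' (y # xs) = 0)"
    using rec_min[of 1 f'] f' assms(2) by (auto simp: numeral_2_eq_2)
  then have "computable 1 (\<lambda>xs. LEAST y. f (xs ! 0) y = 0)"
    by (rule computable_cong[OF computable_recursive]) (simp add: f'(2))
  then show ?thesis using assms(3) by (rule computable_comp1[of "\<lambda>z. LEAST y. f z y = 0"])
qed

section \<open>The pairing function and its projections\<close>

abbreviation pr :: "nat \<Rightarrow> nat \<Rightarrow> nat" where "pr a b \<equiv> prod_encode (a, b)"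
definition p1 :: "nat \<Rightarrow> nat" where "p1 z = fst (prod_decode z)"
definition p2 :: "nat \<Rightarrow> nat" where "p2 z = snd (prod_decode z)"

lemma p1_pr [simp]: "p1 (pr a b) = a" and p2_pr [simp]: "p2 (pr a b) = b"
  and pr_p1_p2 [simp]: "pr (p1 z) (p2 z) = z"
  by (auto simp: p1_def p2_def)

lemma triangle_mono: "a \<le> b \<Longrightarrow> triangle a \<le> triangle b"
  by (induction rule: dec_induct) auto

text \<open>\<open>pr a b\<close> has offset \<open>a\<close> on diagonal \<open>a + b\<close>, and
  diagonal \<open>s\<close> consists of the numbers from \<open>triangle s\<close> up to, but
  excluding, \<open>triangle (Suc s)\<close>. The condition \<open>z < triangle (Suc s)\<close> is
  written as a vanishing truncated difference because minimisation searches for zeros.\<close>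

lemma diagonal_pr: "(LEAST s. Suc (pr a b) - triangle (Suc s) = 0) = a + b"
proof (rule Least_equality)
  show "Suc (pr a b) - triangle (Suc (a + b)) = 0" by (simp add: prod_encode_def)
next
  fix s assume s: "Suc (pr a b) - triangle (Suc s) = 0"
  show "a + b \<le> s"
  proof (rule ccontr)
    assume "\<not> a + b \<le> s"
    then have "triangle (Suc s) \<le> triangle (a + b)" by (intro triangle_mono) simp
    with s show False by (simp add: prod_encode_def)
  qed
qed

lemma p1_Least: "p1 z = z - triangle (LEAST s. Suc z - triangle (Suc s) = 0)"
  and p2_Least: "p2 z = (LEAST s. Suc z - triangle (Suc s) = 0) - p1 z"
proof -
  obtain a b where "z = pr a b" using pr_p1_p2 by metis
  then have *: "(LEAST s. Suc z - triangle (Suc s) = 0) = a + b" "p1 z = a" "p2 z = b"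
    "z = triangle (a + b) + a"
    using diagonal_pr[of a b] by (simp_all only: p1_pr p2_pr) (simp add: prod_encode_def)
  show "p1 z = z - triangle (LEAST s. Suc z - triangle (Suc s) = 0)"
    "p2 z = (LEAST s. Suc z - triangle (Suc s) = 0) - p1 z"
    unfolding *(1-3) using *(4) by auto
qed

lemma computable_diagonal:
  assumes "computable n f"
  shows "computable n (\<lambda>xs. LEAST s. Suc (f xs) - triangle (Suc s) = 0)"
proof (rule computable_Least[OF _ _ assms])
  show "computable 2 (\<lambda>xs. Suc (xs ! 1) - triangle (Suc (xs ! 0)))"
    by (intro computable_diff computable_Suc computable_triangle computable_proj) auto
next
  show "\<exists>k. Suc z - triangle (Suc k) = 0" for z by (rule exI[of _ z]) simp
qed

lemma computable_p1: "computable n f \<Longrightarrow> computable n (\<lambda>xs. p1 (f xs))"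
  unfolding p1_Least by (intro computable_diff computable_triangle computable_diagonal)

lemma computable_p2: "computable n f \<Longrightarrow> computable n (\<lambda>xs. p2 (f xs))"
  unfolding p2_Least by (intro computable_diff computable_p1 computable_diagonal)

lemma computable_pr: "computable n f \<Longrightarrow> computable n g \<Longrightarrow> computable n (\<lambda>xs. pr (f xs) (g xs))"
  unfolding prod_encode_def prod.case by (intro computable_add computable_triangle)

section \<open>Unary functions, several arguments being packed by pairing\<close>

definition recfun :: "(nat \<Rightarrow> nat) \<Rightarrow> bool" where
  "recfun f \<longleftrightarrow> computable 1 (\<lambda>xs. f (xs ! 0))"

named_theorems rec_intros

lemma recfun_comp: "recfun f \<Longrightarrow> recfun g \<Longrightarrow> recfun (\<lambda>z. f (g z))"
  unfolding recfun_def by (rule computable_comp1)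

lemma recfun_id [rec_intros]: "recfun (\<lambda>z. z)"
  and recfun_const [rec_intros]: "recfun (\<lambda>z. k)"
  unfolding recfun_def by (auto intro: computable_const computable_proj)

lemma recfun_Suc [rec_intros]: "recfun f \<Longrightarrow> recfun (\<lambda>z. Suc (f z))"
  and recfun_p1 [rec_intros]: "recfun f \<Longrightarrow> recfun (\<lambda>z. p1 (f z))"
  and recfun_p2 [rec_intros]: "recfun f \<Longrightarrow> recfun (\<lambda>z. p2 (f z))"
  unfolding recfun_def by (auto intro: computable_Suc computable_p1 computable_p2)

lemma recfun_add [rec_intros]: "recfun f \<Longrightarrow> recfun g \<Longrightarrow> recfun (\<lambda>z. f z + g z)"
  and recfun_diff [rec_intros]: "recfun f \<Longrightarrow> recfun g \<Longrightarrow> recfun (\<lambda>z. f z - g z)"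
  and recfun_mult [rec_intros]: "recfun f \<Longrightarrow> recfun g \<Longrightarrow> recfun (\<lambda>z. f z * g z)"
  and recfun_pr [rec_intros]: "recfun f \<Longrightarrow> recfun g \<Longrightarrow> recfun (\<lambda>z. pr (f z) (g z))"
  unfolding recfun_def by (auto intro: computable_add computable_diff computable_mult computable_pr)

text \<open>Parameter, index and previous value reach the unary step function as
  \<open>pr z (pr k r)\<close>; premises on \<open>w\<close> in the later rules follow the same
  packing.\<close>

lemma recfun_rec_nat [rec_intros]:
  assumes "recfun f" "recfun (\<lambda>w. g (p1 w) (p1 (p2 w)) (p2 (p2 w)))" "recfun h"
  shows "recfun (\<lambda>z. rec_nat (f z) (\<lambda>k r. g z k r) (h z))"
proof -
  have "computable 3 (\<lambda>xs. g (p1 (pr (xs ! 2) (pr (xs ! 0) (xs ! 1))))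
    (p1 (p2 (pr (xs ! 2) (pr (xs ! 0) (xs ! 1))))) (p2 (p2 (pr (xs ! 2) (pr (xs ! 0) (xs ! 1))))))"
    by (rule computable_comp1[OF assms(2)[unfolded recfun_def]])
       (auto intro!: computable_pr computable_proj)
  then have 3: "computable 3 (\<lambda>xs. g (xs ! 2) (xs ! 0) (xs ! 1))" by simp
  show ?thesis
    using computable_rec_nat[OF assms(1)[unfolded recfun_def] 3, of 1 "\<lambda>xs. xs ! 0"] assms(3)
    unfolding recfun_def by (simp add: computable_proj)
qed

lemma recfun_Least0:
  assumes "recfun (\<lambda>w. f (p1 w) (p2 w))" "\<And>z. \<exists>k. f z k = 0"
  shows "recfun (\<lambda>z. LEAST k. f z k = (0::nat))"
proof -
  have "computable 2 (\<lambda>xs. f (p1 (pr (xs ! 1) (xs ! 0))) (p2 (pr (xs ! 1) (xs ! 0))))"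
    by (rule computable_comp1[OF assms(1)[unfolded recfun_def]])
       (auto intro!: computable_pr computable_proj)
  then show ?thesis unfolding recfun_def
    by (intro computable_Least[where g = "\<lambda>xs. xs ! 0"]) (auto simp: assms(2) computable_proj)
qed

abbreviation recpred :: "(nat \<Rightarrow> bool) \<Rightarrow> bool" where
  "recpred P \<equiv> recfun (\<lambda>z. of_bool (P z))"

lemma recpred_not [rec_intros]: "recpred P \<Longrightarrow> recpred (\<lambda>z. \<not> P z)"
proof -
  assume "recpred P"
  then have "recfun (\<lambda>z. 1 - of_bool (P z))" by (intro rec_intros)
  moreover have "(\<lambda>z. 1 - of_bool (P z)) = (\<lambda>z. of_bool (\<not> P z) :: nat)" by auto
  ultimately show ?thesis by simp
qed

lemma recpred_conj [rec_intros]: "recpred P \<Longrightarrow> recpred Q \<Longrightarrow> recpred (\<lambda>z. P z \<and> Q z)"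
  using recfun_mult[of "\<lambda>z. of_bool (P z)" "\<lambda>z. of_bool (Q z)"] by (simp add: of_bool_conj)

lemma recpred_disj [rec_intros]: "recpred P \<Longrightarrow> recpred Q \<Longrightarrow> recpred (\<lambda>z. P z \<or> Q z)"
  using recpred_not[OF recpred_conj[OF recpred_not recpred_not, of P Q]] by simp

lemma recfun_if [rec_intros]:
  assumes "recpred P" "recfun f" "recfun g" shows "recfun (\<lambda>z. if P z then f z else g z)"
proof -
  have "recfun (\<lambda>z. of_bool (P z) * f z + of_bool (\<not> P z) * g z)" using assms by (intro rec_intros)
  moreover have "(\<lambda>z. of_bool (P z) * f z + of_bool (\<not> P z) * g z) = (\<lambda>z. if P z then f z else g z)"
    by auto
  ultimately show ?thesis by simp
qed

lemma recpred_eq_0: "recfun f \<Longrightarrow> recpred (\<lambda>z. f z = 0)"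
proof -
  assume "recfun f"
  then have "recfun (\<lambda>z. 1 - f z)" by (intro rec_intros)
  moreover have "(\<lambda>z. 1 - f z) = (\<lambda>z. of_bool (f z = 0))" by auto
  ultimately show ?thesis by simp
qed

lemma recpred_le [rec_intros]: "recfun f \<Longrightarrow> recfun g \<Longrightarrow> recpred (\<lambda>z. f z \<le> g z)"
  using recpred_eq_0[OF recfun_diff, of f g] by simp

lemma recpred_less [rec_intros]: "recfun f \<Longrightarrow> recfun g \<Longrightarrow> recpred (\<lambda>z. f z < g z)"
  using recpred_not[OF recpred_le, of g f] by (simp add: not_le)

lemma recpred_eq [rec_intros]: "recfun f \<Longrightarrow> recfun g \<Longrightarrow> recpred (\<lambda>z. f z = g z)"
  using recpred_conj[OF recpred_le recpred_le, of f g g f] by (simp add: order_eq_iff)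

lemma recfun_Least:
  assumes "recpred (\<lambda>w. P (p1 w) (p2 w))" "\<And>z. \<exists>k. P z k"
  shows "recfun (\<lambda>z. LEAST k. P z k)"
proof -
  have "recfun (\<lambda>z. LEAST k. of_bool (\<not> P z k) = (0::nat))"
    using assms by (intro recfun_Least0 rec_intros) auto
  then show ?thesis by simp
qed

lemma recfun_sum [rec_intros]:
  assumes "recfun (\<lambda>w. f (p1 w) (p2 w))" "recfun b" shows "recfun (\<lambda>z. \<Sum>k<b z. f z k)"
proof -
  have "(\<Sum>k<n. f z k) = rec_nat 0 (\<lambda>k r. r + f z k) n" for z n by (induction n) auto
  moreover have "recfun (\<lambda>z. rec_nat 0 (\<lambda>k r. r + f z k) (b z))"
    using assms(2) recfun_comp[OF assms(1), of "\<lambda>w. pr (p1 w) (p1 (p2 w))"]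
    by (intro rec_intros) (simp_all add: recfun_pr recfun_p1 recfun_p2 recfun_id)
  ultimately show ?thesis by simp
qed

lemma recfun_card [rec_intros]:
  assumes "recpred (\<lambda>w. P (p1 w) (p2 w))" "recfun b" shows "recfun (\<lambda>z. card {k. k < b z \<and> P z k})"
proof -
  have "card {k. k < b z \<and> P z k} = (\<Sum>k<b z. of_bool (P z k))" for z
  proof -
    have "{k. k < b z \<and> P z k} = {..<b z} \<inter> {k. P z k}" by auto
    then show ?thesis by (simp add: sum_of_bool_eq)
  qed
  then show ?thesis using recfun_sum[OF assms] by simp
qed

lemma recpred_bex [rec_intros]:
  assumes "recpred (\<lambda>w. P (p1 w) (p2 w))" "recfun b" shows "recpred (\<lambda>z. \<exists>k<b z. P z k)"
proof -
  have "recpred (\<lambda>z. 0 < card {k. k < b z \<and> P z k})" using assms by (intro rec_intros)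
  then show ?thesis by (simp add: card_gt_0_iff Bex_def)
qed

lemma recpred_bex_le [rec_intros]:
  assumes "recpred (\<lambda>w. P (p1 w) (p2 w))" "recfun b" shows "recpred (\<lambda>z. \<exists>k\<le>b z. P z k)"
  using recpred_bex[OF assms(1) recfun_Suc[OF assms(2)]] by (simp add: less_Suc_eq_le)

lemma recpred_ball [rec_intros]:
  assumes "recpred (\<lambda>w. P (p1 w) (p2 w))" "recfun b" shows "recpred (\<lambda>z. \<forall>k<b z. P z k)"
  using recpred_not[OF recpred_bex[of "\<lambda>z k. \<not> P z k", OF recpred_not[OF assms(1)] assms(2)]] by simp

lemma recpred_ball_le [rec_intros]:
  assumes "recpred (\<lambda>w. P (p1 w) (p2 w))" "recfun b" shows "recpred (\<lambda>z. \<forall>k\<le>b z. P z k)"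
  using recpred_ball[OF assms(1) recfun_Suc[OF assms(2)]] by (simp add: less_Suc_eq_le)

lemma recfun_power [rec_intros]:
  assumes "recfun f" "recfun g" shows "recfun (\<lambda>z. f z ^ g z)"
proof -
  have "a ^ n = rec_nat 1 (\<lambda>k r. r * a) n" for a n :: nat by (induction n) auto
  moreover have "recfun (\<lambda>z. rec_nat 1 (\<lambda>k r. r * f z) (g z))"
    using assms recfun_comp[OF assms(1) recfun_p1[OF recfun_id]] by (intro rec_intros)
  ultimately show ?thesis by simp
qed

lemma recfun_fact [rec_intros]: assumes "recfun f" shows "recfun (\<lambda>z. fact (f z))"
proof -
  have "fact n = rec_nat 1 (\<lambda>k r. r * Suc k) n" for n by (induction n) (auto simp: algebra_simps)
  moreover have "recfun (\<lambda>z. rec_nat 1 (\<lambda>k r. r * Suc k) (f z))" using assms by (intro rec_intros)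
  ultimately show ?thesis by simp
qed

lemma recfun_div [rec_intros]:
  assumes "recfun f" "recfun g" shows "recfun (\<lambda>z. f z div g z)"
proof -
  \<comment> \<open>The quotient counts the positive multiples of \<open>b\<close> up to
    \<open>a\<close>; as it is at most \<open>a\<close>, the bound \<open>k < a\<close> loses none
    of them. The convention for \<open>b = 0\<close> has to be imposed, since then every
    \<open>k\<close> would be counted.\<close>
  have *: "a div b = (if b = 0 then 0 else card {k. k < a \<and> Suc k * b \<le> a})" for a b :: nat
  proof (cases "b = 0")
    case False
    then have "{k. k < a \<and> Suc k * b \<le> a} = {..<a div b}"
      using div_le_dividend[of a b]
      by (auto simp: less_eq_div_iff_mult_less_eq Suc_le_eq[symmetric] simp del: mult_Suc
         elim!: order_trans[rotated])
    then show ?thesis using False by simp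
  qed simp
  have "recfun (\<lambda>z. if g z = 0 then 0 else card {k. k < f z \<and> Suc k * g z \<le> f z})"
    using assms recfun_comp[OF assms(1) recfun_p1[OF recfun_id]] recfun_comp[OF assms(2) recfun_p1[OF recfun_id]] by (intro rec_intros)
  then show ?thesis by (simp only: *[symmetric])
qed

lemma recfun_mod [rec_intros]: assumes "recfun f" "recfun g" shows "recfun (\<lambda>z. f z mod g z)"
proof -
  have "recfun (\<lambda>z. f z - f z div g z * g z)" using assms by (intro rec_intros)
  then show ?thesis by (simp add: minus_div_mult_eq_mod)
qed

lemma recpred_dvd [rec_intros]: assumes "recfun f" "recfun g" shows "recpred (\<lambda>z. f z dvd g z)"
  unfolding dvd_eq_mod_eq_0 using assms by (intro rec_intros)

section \<open>Finite tables and course-of-values recursion\<close>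

definition table :: "nat \<Rightarrow> (nat \<Rightarrow> nat) \<Rightarrow> nat" where
  "table m f = (\<Sum>k<m. 2 ^ pr k (f k))"

text \<open>A table is the set of its argument-value pairs, coded as a bit set. The disjunct \<open>t \<le> i\<close> only
  ensures that the minimum exists.\<close>

definition table_app :: "nat \<Rightarrow> nat \<Rightarrow> nat" where
  "table_app t k = (LEAST i. t \<le> i \<or> odd (t div 2 ^ pr k i))"

lemma set_decode_table: "set_decode (table m f) = (\<lambda>k. pr k (f k)) ` {..<m}"
proof -
  have "table m f = set_encode ((\<lambda>k. pr k (f k)) ` {..<m})"
    unfolding table_def set_encode_def by (subst sum.reindex) (auto simp: inj_on_def)
  then show ?thesis by simp
qed

text \<open>The escape disjunct cannot stop the search early: the table contains the summand
  \<open>2 ^ pr k (f k)\<close>, which already exceeds \<open>f k\<close>.\<close>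

lemma table_app_table: assumes "k < m" shows "table_app (table m f) k = f k"
  unfolding table_app_def
proof (rule Least_equality)
  have mem: "odd (table m f div 2 ^ pr k i) \<longleftrightarrow> i = f k" for i
    using set_decode_table[of m f] assms by (auto simp: set_decode_def set_eq_iff prod_encode_eq image_iff)
  then show "table m f \<le> f k \<or> odd (table m f div 2 ^ pr k (f k))" by simp
  fix i assume i: "table m f \<le> i \<or> odd (table m f div 2 ^ pr k i)"
  have "f k < 2 ^ pr k (f k)" using le_prod_encode_2[of "f k" k] less_exp[of "pr k (f k)"] by linarith
  also have "\<dots> \<le> table m f" unfolding table_def using assms by (intro member_le_sum) auto
  finally show "f k \<le> i" using i mem by auto
qed

lemma recfun_table_app [rec_intros]: assumes "recfun f" "recfun g" shows "recfun (\<lambda>z. table_app (f z) (g z))"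
  unfolding table_app_def
  using assms recfun_comp[OF assms(1) recfun_p1[OF recfun_id]] recfun_comp[OF assms(2) recfun_p1[OF recfun_id]]
  by (intro recfun_Least rec_intros) auto

lemma recfun_table [rec_intros]:
  assumes "recfun (\<lambda>w. f (p1 w) (p2 w))" "recfun m" shows "recfun (\<lambda>z. table (m z) (\<lambda>k. f z k))"
  unfolding table_def using assms by (intro rec_intros)

text \<open>\<open>G z q t\<close> computes the value at \<open>q\<close> from the table \<open>t\<close> of the values below \<open>q\<close>.\<close>

definition course_of_values :: "(nat \<Rightarrow> nat \<Rightarrow> nat \<Rightarrow> nat) \<Rightarrow> nat \<Rightarrow> nat \<Rightarrow> nat" where
  "course_of_values G z q = G z q (rec_nat 0 (\<lambda>k t. t + 2 ^ pr k (G z k t)) q)"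

lemma course_of_values: "course_of_values G z q = G z q (table q (course_of_values G z))"
proof -
  have "rec_nat 0 (\<lambda>k t. t + 2 ^ pr k (G z k t)) q = table q (course_of_values G z)"
    by (induction q) (auto simp: table_def course_of_values_def)
  then show ?thesis unfolding course_of_values_def[of G z q] by simp
qed

lemma recfun_course_of_values:
  assumes G: "recfun (\<lambda>w. G (p1 w) (p1 (p2 w)) (p2 (p2 w)))" and "recfun f" "recfun q"
  shows "recfun (\<lambda>z. course_of_values G (f z) (q z))"
proof -
  have *: "recfun (\<lambda>z. G (a z) (b z) (c z))" if "recfun a" "recfun b" "recfun c" for a b c
    using recfun_comp[OF G recfun_pr[OF that(1) recfun_pr[OF that(2,3)]]] by simp
  show ?thesis unfolding course_of_values_def
    using assms(2,3) recfun_comp[OF assms(2) recfun_p1[OF recfun_id]] by (intro * rec_intros)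
qed

section \<open>Equivalence of valuations\<close>

definition lin :: "'i set \<Rightarrow> ('i \<Rightarrow> int) \<Rightarrow> int \<Rightarrow> ('i \<Rightarrow> int) \<Rightarrow> int" where
  "lin I c c0 e = (\<Sum>i\<in>I. c i * e i) + c0"

definition form :: "'i set \<Rightarrow> nat \<Rightarrow> ('i \<Rightarrow> int) \<Rightarrow> int \<Rightarrow> bool" where
  "form I M c c0 \<longleftrightarrow> (\<forall>i\<in>I. \<bar>c i\<bar> \<le> int M) \<and> \<bar>c0\<bar> \<le> int M"

text \<open>The factorial makes all moduli up to \<open>M\<close> divide one common modulus, and likewise all
  coefficients of a variable that is to be isolated.\<close>

definition eqv :: "'i set \<Rightarrow> nat \<Rightarrow> ('i \<Rightarrow> int) \<Rightarrow> ('i \<Rightarrow> int) \<Rightarrow> bool" where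
  "eqv I M e e' \<longleftrightarrow> (\<forall>c c0. form I M c c0 \<longrightarrow> (0 \<le> lin I c c0 e \<longleftrightarrow> 0 \<le> lin I c c0 e')) \<and>
     (\<forall>i\<in>I. [e i = e' i] (mod fact M))"

lemma eqv_refl: "eqv I M e e"
  by (simp add: eqv_def)

lemma eqvD: "eqv I M e e' \<Longrightarrow> form I M c c0 \<Longrightarrow> 0 \<le> lin I c c0 e \<longleftrightarrow> 0 \<le> lin I c c0 e'"
  by (simp add: eqv_def)

lemma form_mono: "form I M c c0 \<Longrightarrow> M \<le> M' \<Longrightarrow> form I M' c c0"
  unfolding form_def by force

lemma form_uminus: "form I M (\<lambda>i. - c i) (- c0) \<longleftrightarrow> form I M c c0"
  by (simp add: form_def)

lemma eqv_mono: "eqv I M' e e' \<Longrightarrow> M \<le> M' \<Longrightarrow> eqv I M e e'"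
  unfolding eqv_def by (meson form_mono cong_dvd_modulus fact_dvd)

lemma lin_cong: "(\<And>i. i \<in> I \<Longrightarrow> c i = c' i) \<Longrightarrow> (\<And>i. i \<in> I \<Longrightarrow> e i = e' i) \<Longrightarrow> lin I c c0 e = lin I c' c0 e'"
  by (simp add: lin_def)

lemma eqv_cong:
  "(\<And>i. i \<in> I \<Longrightarrow> e i = d i) \<Longrightarrow> (\<And>i. i \<in> I \<Longrightarrow> e' i = d' i) \<Longrightarrow> eqv I M e e' = eqv I M d d'"
  unfolding eqv_def using lin_cong[of I _ _ e d] lin_cong[of I _ _ e' d'] by simp

lemma lin_diff: "lin I (\<lambda>i. c i - d i) (c0 - d0) e = lin I c c0 e - lin I d d0 e"
  by (simp add: lin_def sum_subtractf left_diff_distrib)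

lemma lin_scale: "lin I (\<lambda>i. m * c i) (m * c0) e = m * lin I c c0 e"
  by (simp add: lin_def sum_distrib_left distrib_left mult.assoc)

lemma lin_uminus: "lin I (\<lambda>i. - c i) (- c0) e = - lin I c c0 e"
  using lin_scale[of I "-1"] by simp

lemma lin_const: "lin I c (c0 + a) e = lin I c c0 e + a"
  by (simp add: lin_def)

lemma lin_fun_upd:
  assumes "finite I" "i \<in> I"
  shows "lin I c c0 (e(i := k)) = c i * k + lin (I - {i}) c c0 e"
proof -
  have "(\<Sum>j\<in>I. c j * (e(i := k)) j) = c i * k + (\<Sum>j\<in>I - {i}. c j * (e(i := k)) j)"
    using assms by (subst sum.remove[of I i]) auto
  also have "(\<Sum>j\<in>I - {i}. c j * (e(i := k)) j) = (\<Sum>j\<in>I - {i}. c j * e j)"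
    by (rule sum.cong) auto
  finally show ?thesis by (simp add: lin_def)
qed

lemma lin_superset:
  assumes "finite I" "J \<subseteq> I"
  shows "lin I (\<lambda>i. if i \<in> J then c i else 0) c0 e = lin J c c0 e"
proof -
  have "(\<Sum>i\<in>I. (if i \<in> J then c i else 0) * e i) = (\<Sum>i\<in>J. c i * e i)"
    using assms by (intro sum.mono_neutral_cong_right) auto
  then show ?thesis by (simp add: lin_def)
qed

lemma eqv_subset:
  assumes "eqv I M e e'" "J \<subseteq> I" "finite I" shows "eqv J M e e'"
  unfolding eqv_def
proof (intro conjI allI impI ballI)
  fix c c0 assume "form J M c c0"
  then have "form I M (\<lambda>i. if i \<in> J then c i else 0) c0" by (auto simp: form_def)
  from eqvD[OF assms(1) this] show "0 \<le> lin J c c0 e \<longleftrightarrow> 0 \<le> lin J c c0 e'"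
    using assms by (simp add: lin_superset)
qed (use assms in \<open>auto simp: eqv_def\<close>)

lemma lin_cong_mod:
  "(\<And>i. i \<in> I \<Longrightarrow> [e i = e' i] (mod m)) \<Longrightarrow> [lin I c c0 e = lin I c c0 e'] (mod m)"
  unfolding lin_def by (intro cong_add cong_sum cong_mult) auto

lemma eqv_lin_mod:
  assumes "eqv I M e e'" "m dvd fact M" shows "[lin I c c0 e = lin I c c0 e'] (mod m)"
  using assms by (intro lin_cong_mod) (auto simp: eqv_def intro: cong_dvd_modulus)

lemma eqv_lin_eq_0:
  assumes "eqv I M e e'" "form I M c c0" "lin I c c0 e = 0" shows "lin I c c0 e' = 0"
  using eqvD[OF assms(1,2)] eqvD[OF assms(1), of "\<lambda>i. - c i" "- c0"] assms(2,3)
  by (simp add: form_uminus lin_uminus)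

lemma eqv_sym: "eqv I M e e' \<Longrightarrow> eqv I M e' e"
  by (auto simp: eqv_def cong_sym_eq)

lemma abs_lin_le:
  assumes "form I M c c0" "\<And>i. i \<in> I \<Longrightarrow> \<bar>e i\<bar> \<le> int R"
  shows "\<bar>lin I c c0 e\<bar> \<le> int (M * (card I * R + 1))"
proof -
  have "\<bar>\<Sum>i\<in>I. c i * e i\<bar> \<le> (\<Sum>i\<in>I. \<bar>c i * e i\<bar>)" by (rule sum_abs)
  also have "\<dots> \<le> (\<Sum>i\<in>I. int M * int R)"
    using assms unfolding abs_mult form_def by (intro sum_mono mult_mono) auto
  also have "\<dots> = int M * (int (card I) * int R)" by simp
  finally have "\<bar>\<Sum>i\<in>I. c i * e i\<bar> \<le> int M * (int (card I) * int R)" .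
  moreover have "\<bar>c0\<bar> \<le> int M" using assms by (simp add: form_def)
  ultimately have "\<bar>lin I c c0 e\<bar> \<le> int M * (int (card I) * int R) + int M"
    unfolding lin_def by linarith
  then show ?thesis by (simp add: distrib_left)
qed

section \<open>Thresholds and the back-and-forth property\<close>

definition thr_bound :: "nat \<Rightarrow> nat" where "thr_bound M = fact M * M + 1"

text \<open>Chosen generously to dominate the coefficients of a difference of two thresholds shifted
  by at most \<open>(M!)^2\<close>. Being at least \<open>(M!)^2\<close>, it also makes equivalence
  at this level preserve residues modulo \<open>(M!)^2\<close>.\<close>

definition next_lvl :: "nat \<Rightarrow> nat" where "next_lvl M = 8 * (M + 1) * (fact M)\<^sup>2"

text \<open>Bounds a solution \<open>k'\<close> of \<open>M! * k' = t + d\<close>, where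
  \<open>t\<close> is the value of a threshold in \<open>n\<close> coordinates of size at most
  \<open>R\<close> and the offset \<open>d\<close> is at most \<open>(M!)^2\<close> in absolute
  value.\<close>

definition wit_bound :: "nat \<Rightarrow> nat \<Rightarrow> nat \<Rightarrow> nat" where "wit_bound M n R = thr_bound M * (n * R + 1) + (fact M)\<^sup>2"

lemma next_lvl_bounds: "2 * thr_bound M + (fact M)\<^sup>2 \<le> next_lvl M" "(fact M)\<^sup>2 \<le> next_lvl M" "M < next_lvl M"
proof -
  have f: "1 \<le> (fact M :: nat)" "fact M \<le> (fact M :: nat)\<^sup>2"
    by (auto simp: power2_eq_square)
  then have "fact M * M + 1 \<le> (fact M)\<^sup>2 * M + (fact M)\<^sup>2"
    by (intro add_mono mult_right_mono) linarith+
  then have L: "thr_bound M \<le> (M + 1) * (fact M)\<^sup>2" by (simp add: thr_bound_def algebra_simps)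
  have q: "(fact M)\<^sup>2 \<le> (M + 1) * (fact M :: nat)\<^sup>2" by simp
  have p: "(M + 1) * 1 \<le> (M + 1) * (fact M)\<^sup>2" using f by (intro mult_left_mono) linarith+
  define X where "X = (M + 1) * (fact M)\<^sup>2"
  have "next_lvl M = 8 * X" by (simp only: next_lvl_def X_def mult.assoc)
  moreover have "M < X" using p unfolding X_def by simp
  ultimately show "2 * thr_bound M + (fact M)\<^sup>2 \<le> next_lvl M" "(fact M)\<^sup>2 \<le> next_lvl M" "M < next_lvl M"
    using L q unfolding X_def[symmetric] by linarith+
qed

lemma wit_bound_mono: "M \<le> M' \<Longrightarrow> R \<le> R' \<Longrightarrow> wit_bound M n R \<le> wit_bound M' n R'"
  unfolding wit_bound_def thr_bound_def
  by (intro add_mono mult_mono power_mono fact_mono) auto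

text \<open>Multiplying by \<open>M!/\<bar>c\<bar>\<close> turns each condition \<open>0 \<le> c * k + t\<close> on \<open>k\<close> into a comparison of
  \<open>M! * k\<close> with a threshold. By integrality the conditions with \<open>c < 0\<close> become negated comparisons
  with \<open>1\<close> added to the threshold, hence the \<open>+ 1\<close> in \<open>thr_bound\<close>.\<close>

definition thr :: "'i set \<Rightarrow> nat \<Rightarrow> (('i \<Rightarrow> int) \<times> int) set" where
  "thr J M = (J \<rightarrow>\<^sub>E {- int (thr_bound M)..int (thr_bound M)}) \<times> {- int (thr_bound M)..int (thr_bound M)}"

definition ev :: "'i set \<Rightarrow> ('i \<Rightarrow> int) \<times> int \<Rightarrow> ('i \<Rightarrow> int) \<Rightarrow> int" where
  "ev J t e = lin J (fst t) (snd t) e"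

text \<open>The cut that \<open>M! * k\<close> makes among the thresholds. Together with
  \<open>k mod M!\<close> it is all that matters about \<open>k\<close> relative to \<open>e\<close>
  at level \<open>M\<close>.\<close>

definition below :: "'i set \<Rightarrow> nat \<Rightarrow> ('i \<Rightarrow> int) \<Rightarrow> int \<Rightarrow> (('i \<Rightarrow> int) \<times> int) set" where
  "below J M e k = {t \<in> thr J M. ev J t e \<le> fact M * k}"

lemma finite_thr: "finite J \<Longrightarrow> finite (thr J M)"
  by (simp add: thr_def finite_PiE)

lemma card_thr: "finite J \<Longrightarrow> card (thr J M) = (2 * thr_bound M + 1) ^ card J * (2 * thr_bound M + 1)"
proof -
  assume "finite J"
  moreover have "card {- int (thr_bound M)..int (thr_bound M)} = 2 * thr_bound M + 1"
    unfolding card_atLeastAtMost_int by linarith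
  ultimately show ?thesis by (simp only: thr_def card_cartesian_product card_PiE prod_constant)
qed

lemma form_thr: "t \<in> thr J M \<Longrightarrow> form J (thr_bound M) (fst t) (snd t)"
  by (force simp: thr_def form_def PiE_iff)

lemma thr_ex:
  assumes "form J (thr_bound M) c c0"
  obtains t where "t \<in> thr J M" "\<And>e. ev J t e = lin J c c0 e"
proof
  show "(restrict c J, c0) \<in> thr J M" using assms by (auto simp: thr_def form_def PiE_iff abs_le_iff)
  show "ev J (restrict c J, c0) e = lin J c c0 e" for e
    unfolding ev_def fst_conv snd_conv by (intro lin_cong) auto
qed

lemma eqv_thr_le:
  assumes "eqv J (next_lvl M) e e'" "s \<in> thr J M" "t \<in> thr J M" "\<bar>a\<bar> \<le> (fact M)\<^sup>2"
  shows "ev J s e \<le> ev J t e + a \<longleftrightarrow> ev J s e' \<le> ev J t e' + a"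
proof -
  have "form J (2 * thr_bound M + (fact M)\<^sup>2) (\<lambda>i. fst t i - fst s i) (snd t - snd s + a)"
    using form_thr[OF assms(2)] form_thr[OF assms(3)] assms(4) unfolding form_def
    by (force simp: abs_le_iff)
  then have "form J (next_lvl M) (\<lambda>i. fst t i - fst s i) (snd t - snd s + a)"
    by (rule form_mono) (rule next_lvl_bounds)
  from eqvD[OF assms(1) this] show ?thesis
    unfolding lin_const lin_diff ev_def by linarith
qed

lemma fact_sq_dvd: "(fact M :: int)\<^sup>2 dvd fact (next_lvl M)"
proof -
  have "(fact M :: nat)\<^sup>2 dvd fact (next_lvl M)" by (rule dvd_fact) (simp_all add: next_lvl_bounds)
  then have "int ((fact M)\<^sup>2) dvd int (fact (next_lvl M))" by (rule of_nat_dvd_iff[THEN iffD2])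
  then show ?thesis by simp
qed

text \<open>The modulus is a square because \<open>k'\<close> will be found through
  \<open>M! * k'\<close>: a congruence for \<open>M! * k'\<close> modulo \<open>(M!)^2\<close>
  amounts to one for \<open>k'\<close> modulo \<open>M!\<close>.\<close>

lemma eqv_thr_dvd:
  assumes "eqv J (next_lvl M) e e'" shows "(fact M)\<^sup>2 dvd ev J t e - ev J t e'"
  using eqv_lin_mod[OF assms fact_sq_dvd] unfolding ev_def by (simp add: cong_iff_dvd_diff)

text \<open>Forms with coefficient 0 at \<open>i\<close> are covered by the equivalence of
  \<open>e\<close> and \<open>e'\<close>, the others by the cut after scaling with
  \<open>m = M! / \<bar>c i\<bar>\<close>, and the residue of the new coordinate by the
  congruence.\<close>

lemma below_eqv:
  assumes I: "finite I" "i \<in> I" and e: "eqv (I - {i}) M e e'"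
    and b: "below (I - {i}) M e k = below (I - {i}) M e' k'" and k: "[k = k'] (mod fact M)"
  shows "eqv I M (e(i := k)) (e'(i := k'))"
  unfolding eqv_def
proof (intro conjI allI impI ballI)
  let ?J = "I - {i}" and ?D = "fact M :: int"
  fix c c0 assume f: "form I M c c0"
  then have fJ: "form ?J M c c0" by (auto simp: form_def)
  have th: "ev ?J t e \<le> ?D * k \<longleftrightarrow> ev ?J t e' \<le> ?D * k'" if "t \<in> thr ?J M" for t
    using b that unfolding below_def by blast
  have scaled: "form ?J (thr_bound M) (\<lambda>j. m * c j) (m * c0 + a)" if "\<bar>m\<bar> \<le> ?D" "\<bar>a\<bar> \<le> 1" for m a
  proof -
    have "\<bar>m * x\<bar> \<le> ?D * int M" if "\<bar>x\<bar> \<le> int M" for x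
      unfolding abs_mult using that \<open>\<bar>m\<bar> \<le> ?D\<close> by (intro mult_mono) auto
    note * = this
    have "int (thr_bound M) = ?D * int M + 1" by (simp add: thr_bound_def)
    moreover have "\<bar>m * c j\<bar> \<le> ?D * int M" if "j \<in> ?J" for j
      using * that fJ by (auto simp: form_def)
    moreover have "\<bar>m * c0\<bar> \<le> ?D * int M" using * fJ by (auto simp: form_def)
    ultimately show ?thesis using that(2) unfolding form_def by fastforce
  qed
  consider "c i = 0" | "0 < c i" | "c i < 0" by linarith
  then show "0 \<le> lin I c c0 (e(i := k)) \<longleftrightarrow> 0 \<le> lin I c c0 (e'(i := k'))"
  proof cases
    case 1
    then show ?thesis using eqvD[OF e fJ] by (simp add: lin_fun_upd I)
  next
    case 2
    then have "nat (c i) dvd fact M" using f I(2) by (intro dvd_fact) (auto simp: form_def)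
    then have "int (nat (c i)) dvd int (fact M)" by (rule of_nat_dvd_iff[THEN iffD2])
    then obtain m where m: "?D = c i * m" using 2 by auto
    then have "0 < c i * m" by (metis fact_gt_zero)
    then have mpos: "0 < m" using 2 by (simp add: zero_less_mult_iff)
    then have "1 * m \<le> c i * m" using 2 by (intro mult_right_mono) auto
    then obtain t where t: "t \<in> thr ?J M" "\<And>e. ev ?J t e = - m * lin ?J c c0 e"
      using thr_ex[OF scaled[of "-m" 0]] m mpos by (auto simp: lin_scale[of _ "-m", simplified])
    have "0 \<le> c i * k + lin ?J c c0 e \<longleftrightarrow> 0 \<le> m * (c i * k + lin ?J c c0 e)" for k e
      using mpos by (simp add: zero_le_mult_iff)
    also have "0 \<le> m * (c i * k + lin ?J c c0 e) \<longleftrightarrow> ev ?J t e \<le> ?D * k" for k e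
      unfolding t m by (auto simp: algebra_simps)
    finally show ?thesis using th[OF t(1)] by (simp add: lin_fun_upd I)
  next
    case 3
    then have "nat (- c i) dvd fact M" using f I(2) by (intro dvd_fact) (auto simp: form_def)
    then have "int (nat (- c i)) dvd int (fact M)" by (rule of_nat_dvd_iff[THEN iffD2])
    then have "- c i dvd ?D" using 3 by simp
    then obtain m where m: "?D = - c i * m" by (rule dvdE)
    then have "0 < - c i * m" by (metis fact_gt_zero)
    then have mpos: "0 < m" using 3 by (simp add: zero_less_mult_iff mult_less_0_iff)
    then have "1 * m \<le> - c i * m" using 3 by (intro mult_right_mono) auto
    then obtain t where t: "t \<in> thr ?J M" "\<And>e. ev ?J t e = m * lin ?J c c0 e + 1"
      using thr_ex[OF scaled[of m 1]] m mpos by (auto simp: lin_scale lin_const)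
    have "0 \<le> c i * k + lin ?J c c0 e \<longleftrightarrow> 0 \<le> m * (c i * k + lin ?J c c0 e)" for k e
      using mpos by (simp add: zero_le_mult_iff)
    also have "0 \<le> m * (c i * k + lin ?J c c0 e) \<longleftrightarrow> \<not> ev ?J t e \<le> ?D * k" for k e
      unfolding t m by (auto simp: algebra_simps)
    finally show ?thesis using th[OF t(1)] by (simp add: lin_fun_upd I)
  qed
qed (use e k in \<open>auto simp: eqv_def\<close>)

lemma ex_max: "finite A \<Longrightarrow> A \<noteq> {} \<Longrightarrow> \<exists>x\<in>A. \<forall>y\<in>A. f y \<le> (f x :: int)"
  using Max_in[of "f ` A"] Max_ge[of "f ` A"] by fastforce

lemma ex_min: "finite A \<Longrightarrow> A \<noteq> {} \<Longrightarrow> \<exists>x\<in>A. \<forall>y\<in>A. f x \<le> (f y :: int)"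
  using ex_max[of A "\<lambda>x. - f x"] by simp

text \<open>\<open>k\<close> may be far from all thresholds, and then its distance to them cannot be
  transferred. Moving \<open>M! * k\<close> down by multiples of \<open>(M!)^2\<close> towards the
  greatest threshold below it crosses no threshold and leaves a bounded offset \<open>d\<close>. If
  no threshold lies below, the least one is taken with an offset in
  \<open>[- (M!)^2, 0)\<close>.\<close>

lemma near_threshold:
  assumes "finite J"
  obtains t d where "t \<in> thr J M" "\<bar>d\<bar> \<le> (fact M)\<^sup>2" "(fact M)\<^sup>2 dvd fact M * k - ev J t e - d"
    "\<And>s. s \<in> thr J M \<Longrightarrow> ev J s e \<le> fact M * k \<longleftrightarrow> ev J s e \<le> ev J t e + d"
proof (cases "below J M e k = {}")
  case False
  let ?Q = "(fact M :: int)\<^sup>2"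
  have Q: "0 < ?Q" by simp
  obtain t where t: "t \<in> below J M e k" "\<forall>s\<in>below J M e k. ev J s e \<le> ev J t e"
    using ex_max[OF _ False, of "\<lambda>s. ev J s e"] assms by (auto simp: below_def finite_thr)
  define d where "d = (fact M * k - ev J t e) mod ?Q"
  have le: "ev J t e \<le> fact M * k" using t by (auto simp: below_def)
  then have d: "0 \<le> d" "d < ?Q" "d \<le> fact M * k - ev J t e"
    using Q unfolding d_def by (auto intro: zmod_le_nonneg_dividend)
  show ?thesis
  proof
    show "t \<in> thr J M" using t by (auto simp: below_def)
    show "\<bar>d\<bar> \<le> ?Q" using d by simp
    show "?Q dvd fact M * k - ev J t e - d" by (simp add: d_def)
    show "ev J s e \<le> fact M * k \<longleftrightarrow> ev J s e \<le> ev J t e + d" if "s \<in> thr J M" for s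
    proof (cases "ev J s e \<le> fact M * k")
      case True
      then have "ev J s e \<le> ev J t e" using t(2) that unfolding below_def by blast
      with True d show ?thesis by linarith
    qed (use d in linarith)
  qed
next
  case True
  let ?Q = "(fact M :: int)\<^sup>2"
  have Q: "0 < ?Q" by simp
  have "form J (thr_bound M) (\<lambda>_. 0) 0" by (simp add: form_def)
  from thr_ex[OF this] have "thr J M \<noteq> {}" by blast
  then obtain t where t: "t \<in> thr J M" "\<forall>s\<in>thr J M. ev J t e \<le> ev J s e"
    using ex_min[of "thr J M" "\<lambda>s. ev J s e"] assms by (auto simp: finite_thr)
  define d where "d = (fact M * k - ev J t e) mod ?Q"
  have d: "0 \<le> d" "d < ?Q" using Q by (auto simp: d_def)
  show ?thesis
  proof
    show "t \<in> thr J M" by fact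
    show "\<bar>d - ?Q\<bar> \<le> ?Q" using d by simp
    have "?Q dvd (fact M * k - ev J t e - d) + ?Q" by (rule dvd_add) (auto simp: d_def)
    then show "?Q dvd fact M * k - ev J t e - (d - ?Q)" by (simp add: algebra_simps)
    show "ev J s e \<le> fact M * k \<longleftrightarrow> ev J s e \<le> ev J t e + (d - ?Q)" if "s \<in> thr J M" for s
    proof -
      have "ev J t e \<le> ev J s e" "\<not> ev J s e \<le> fact M * k"
        using t(2) that True unfolding below_def by blast+
      with d show ?thesis by linarith
    qed
  qed
qed

text \<open>The same threshold and offset that describe \<open>k\<close> over \<open>e\<close>
  determine \<open>M! * k'\<close> over \<open>e'\<close>. Divisibility by \<open>(M!)^2\<close>
  yields at once that \<open>k'\<close> is an integer and that it is congruent to \<open>k\<close>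
  modulo \<open>M!\<close>.\<close>

lemma eqv_extend:
  assumes I: "finite I" "i \<in> I" and e: "eqv I (next_lvl M) e e'"
    and R: "\<And>j. j \<in> I \<Longrightarrow> \<bar>e' j\<bar> \<le> int R"
  obtains k' where "\<bar>k'\<bar> \<le> int (wit_bound M (card I) R)" "eqv I M (e(i := k)) (e'(i := k'))"
proof -
  let ?J = "I - {i}" and ?D = "fact M :: int"
  have eJ: "eqv ?J (next_lvl M) e e'" by (rule eqv_subset[OF e]) (use I in auto)
  obtain t d where t: "t \<in> thr ?J M" and d: "\<bar>d\<bar> \<le> ?D\<^sup>2" "?D\<^sup>2 dvd ?D * k - ev ?J t e - d"
    and le: "\<And>s. s \<in> thr ?J M \<Longrightarrow> ev ?J s e \<le> ?D * k \<longleftrightarrow> ev ?J s e \<le> ev ?J t e + d"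
    using near_threshold[of ?J M k e] I by blast
  have "?D\<^sup>2 dvd (?D * k - ev ?J t e - d) + (ev ?J t e - ev ?J t e')"
    using d(2) eqv_thr_dvd[OF eJ] by (rule dvd_add)
  also have "(?D * k - ev ?J t e - d) + (ev ?J t e - ev ?J t e') = ?D * k - ev ?J t e' - d" by simp
  finally obtain m where m: "?D * k - ev ?J t e' - d = ?D\<^sup>2 * m" by (rule dvdE)
  define k' where "k' = k - ?D * m"
  have Dk': "?D * k' = ev ?J t e' + d"
    using m unfolding k'_def by (simp add: algebra_simps power2_eq_square)
  have "below ?J M e k = below ?J M e' k'"
    unfolding below_def Dk' using le eqv_thr_le[OF eJ _ t d(1)] by auto
  moreover have "[k = k'] (mod ?D)" by (simp add: k'_def cong_iff_dvd_diff)
  moreover have "eqv ?J M e e'" by (rule eqv_mono[OF eJ]) (use next_lvl_bounds(3)[of M] in simp)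
  ultimately have "eqv I M (e(i := k)) (e'(i := k'))" using I by (intro below_eqv)
  moreover have "\<bar>k'\<bar> \<le> int (wit_bound M (card I) R)"
  proof -
    have "1 * \<bar>k'\<bar> \<le> ?D * \<bar>k'\<bar>" by (intro mult_right_mono) auto
    then have "\<bar>k'\<bar> \<le> \<bar>ev ?J t e' + d\<bar>" unfolding Dk'[symmetric] by (simp add: abs_mult)
    also have "\<dots> \<le> \<bar>ev ?J t e'\<bar> + ?D\<^sup>2" using d(1) by linarith
    also have "\<bar>ev ?J t e'\<bar> \<le> int (thr_bound M * (card ?J * R + 1))"
      unfolding ev_def by (rule abs_lin_le[OF form_thr[OF t]]) (use R in auto)
    also have "\<dots> \<le> int (thr_bound M * (card I * R + 1))"
      using I by (intro of_nat_mono mult_left_mono add_mono mult_right_mono) (auto intro: card_mono)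
    finally show ?thesis by (simp add: wit_bound_def)
  qed
  ultimately show ?thesis by (rule that[rotated])
qed

lemma funpow_next_lvl_mono: "a \<le> b \<Longrightarrow> (next_lvl ^^ a) M \<le> (next_lvl ^^ b) M"
  by (induction rule: dec_induct) (auto intro: order_trans less_imp_le[OF next_lvl_bounds(3)])

text \<open>\<open>s\<close> witnesses are chosen one after the other, at descending levels. The
  bound uses the highest level throughout, so that it is an iterate of a single function; the
  summand \<open>r\<close> keeps the earlier witnesses within the bound.\<close>

definition wits_bound :: "nat \<Rightarrow> nat \<Rightarrow> nat \<Rightarrow> nat \<Rightarrow> nat" where
  "wits_bound M n s R = ((\<lambda>r. r + wit_bound ((next_lvl ^^ s) M) n r) ^^ s) R"

lemma funpow_add_ge: "(R::nat) \<le> ((\<lambda>r. r + f r) ^^ t) R"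
  by (induction t) auto

lemma wits_bound_ge: "R \<le> wits_bound M n s R"
  unfolding wits_bound_def by (rule funpow_add_ge)

lemma eqv_extend_many:
  assumes "finite I" "J \<subseteq> I" "eqv I ((next_lvl ^^ card J) M) e e'" "\<And>j. j \<in> I \<Longrightarrow> \<bar>e' j\<bar> \<le> int R"
  shows "\<exists>w'. (\<forall>j. \<bar>w' j\<bar> \<le> int (wits_bound M (card I) (card J) R)) \<and>
    eqv I M (\<lambda>j. if j \<in> J then w j else e j) (\<lambda>j. if j \<in> J then w' j else e' j)"
proof -
  have "finite J" using assms finite_subset by blast
  \<comment> \<open>The level \<open>m\<close> in the bound stays fixed while the induction moves
    \<open>M\<close> up to \<open>next_lvl M\<close>.\<close>
  then have "\<exists>w'. (\<forall>j. \<bar>w' j\<bar> \<le> int (((\<lambda>r. r + wit_bound m (card I) r) ^^ card J) R)) \<and>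
    eqv I M (\<lambda>j. if j \<in> J then w j else e j) (\<lambda>j. if j \<in> J then w' j else e' j)"
    if "(next_lvl ^^ card J) M \<le> m" for m using assms(2,3) that
  proof (induction J arbitrary: M)
    case empty
    then show ?case by (auto intro!: exI[of _ "\<lambda>_. 0"])
  next
    case (insert i J)
    have lev: "(next_lvl ^^ card (insert i J)) M = (next_lvl ^^ card J) (next_lvl M)"
      using insert.hyps by (simp add: funpow_swap1)
    let ?r = "((\<lambda>r. r + wit_bound m (card I) r) ^^ card J) R"
    obtain w' where w': "\<forall>j. \<bar>w' j\<bar> \<le> int ?r"
      "eqv I (next_lvl M) (\<lambda>j. if j \<in> J then w j else e j) (\<lambda>j. if j \<in> J then w' j else e' j)"
      using insert.IH[of "next_lvl M"] insert.prems lev by auto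
    have R: "R \<le> ?r" by (rule funpow_add_ge)
    have "\<bar>if j \<in> J then w' j else e' j\<bar> \<le> int ?r" if "j \<in> I" for j
      using w'(1) assms(4)[OF that] R by (auto intro: order_trans)
    then obtain k' where k': "\<bar>k'\<bar> \<le> int (wit_bound M (card I) ?r)"
      "eqv I M ((\<lambda>j. if j \<in> J then w j else e j)(i := w i)) ((\<lambda>j. if j \<in> J then w' j else e' j)(i := k'))"
      using eqv_extend[OF assms(1) _ w'(2), of i ?r "w i"] insert.prems(1) by blast
    have "M \<le> m" using funpow_next_lvl_mono[of 0 "card (insert i J)" M] insert.prems(3) by simp
    then have "wit_bound M (card I) ?r \<le> wit_bound m (card I) ?r" by (intro wit_bound_mono) auto
    then have b: "\<bar>k'\<bar> \<le> int (?r + wit_bound m (card I) ?r)" using k'(1) by linarith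
    show ?case
    proof (intro exI[of _ "w'(i := k')"] conjI allI)
      show "\<bar>(w'(i := k')) j\<bar> \<le> int (((\<lambda>r. r + wit_bound m (card I) r) ^^ card (insert i J)) R)" for j
        using b w'(1)[rule_format, of j] insert.hyps by auto
      show "eqv I M (\<lambda>j. if j \<in> insert i J then w j else e j)
        (\<lambda>j. if j \<in> insert i J then (w'(i := k')) j else e' j)"
        using k'(2) by (rule eqv_cong[THEN iffD1, rotated -1]) auto
    qed
  qed
  then show ?thesis unfolding wits_bound_def by simp
qed

text \<open>The zero valuation is equivalent to itself; answering every coordinate of
  \<open>e\<close> in turn replaces all zeros on the right by bounded witnesses.\<close>

lemma small_eqv:
  assumes "finite I"
  obtains e' where "\<And>i. \<bar>e' i\<bar> \<le> int (wits_bound M (card I) (card I) 0)" "eqv I M e e'"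
proof -
  obtain w' where w': "\<forall>j. \<bar>w' j\<bar> \<le> int (wits_bound M (card I) (card I) 0)"
    "eqv I M (\<lambda>j. if j \<in> I then e j else 0) (\<lambda>j. if j \<in> I then w' j else 0)"
    using eqv_extend_many[OF assms order_refl eqv_refl, of "\<lambda>_. 0" 0 M e] by auto
  have "eqv I M e w'" using w'(2) by (rule eqv_cong[THEN iffD1, rotated -1]) auto
  with w'(1) show ?thesis using that by blast
qed

section \<open>Counting in cells\<close>

text \<open>Writing \<open>k = r + D * t\<close> gives \<open>D * k = D * r + D^2 * t\<close>, so
  the set is counted by the multiples of \<open>D^2\<close>, shifted by \<open>D * r\<close>, in
  \<open>[lo, hi)\<close>. The two remainders are the amounts by which \<open>lo\<close> and
  \<open>hi\<close> are rounded up to such numbers.\<close>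

lemma card_arith_interval:
  fixes D lo hi r :: int
  assumes D: "0 < D" and r: "0 \<le> r" "r < D" and le: "lo \<le> hi"
  shows "D\<^sup>2 * int (card {k. lo \<le> D * k \<and> D * k < hi \<and> k mod D = r}) =
    hi - lo + ((D * r - hi) mod D\<^sup>2 - (D * r - lo) mod D\<^sup>2)"
proof -
  let ?Q = "D\<^sup>2"
  have Q: "0 < ?Q" using D by simp
  have round: "\<exists>a. x + (D * r - x) mod ?Q = D * r + ?Q * a" for x
    by (rule exI[of _ "- ((D * r - x) div ?Q)"]) (simp add: minus_div_mult_eq_mod[symmetric] mult.commute)
  obtain a where a: "lo + (D * r - lo) mod ?Q = D * r + ?Q * a" using round by blast
  obtain b where b: "hi + (D * r - hi) mod ?Q = D * r + ?Q * b" using round by blast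
  have ge: "x \<le> D * r + ?Q * t \<longleftrightarrow> c \<le> t"
    if c: "x + (D * r - x) mod ?Q = D * r + ?Q * c" for x c t
  proof
    have m: "0 \<le> (D * r - x) mod ?Q" "(D * r - x) mod ?Q < ?Q" using Q by auto
    { assume "c \<le> t"
      then have "?Q * c \<le> ?Q * t" using Q by (intro mult_left_mono) auto
      then show "x \<le> D * r + ?Q * t" using c m by linarith }
    assume x: "x \<le> D * r + ?Q * t"
    show "c \<le> t"
    proof (rule ccontr)
      assume "\<not> c \<le> t"
      then have "?Q * t \<le> ?Q * (c - 1)" using Q by (intro mult_left_mono) auto
      then have "?Q * t \<le> ?Q * c - ?Q" by (simp add: right_diff_distrib)
      then show False using x c m by linarith
    qed
  qed
  have eq: "{k. lo \<le> D * k \<and> D * k < hi \<and> k mod D = r} = (\<lambda>t. r + D * t) ` {a..<b}"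
  proof (intro set_eqI iffI)
    fix k assume k: "k \<in> {k. lo \<le> D * k \<and> D * k < hi \<and> k mod D = r}"
    then have kr: "k = r + D * (k div D)" by (metis (mono_tags) mem_Collect_eq mod_mult_div_eq)
    then have "D * k = D * r + ?Q * (k div D)" by (metis distrib_left mult.assoc power2_eq_square)
    then have "k div D \<in> {a..<b}" using k ge[OF a, of "k div D"] ge[OF b, of "k div D"] by auto
    with kr show "k \<in> (\<lambda>t. r + D * t) ` {a..<b}" by blast
  next
    fix k assume "k \<in> (\<lambda>t. r + D * t) ` {a..<b}"
    then obtain t where "t \<in> {a..<b}" "k = r + D * t" by blast
    then have t: "k = r + D * t" "a \<le> t" "t < b" by auto
    then have "D * k = D * r + ?Q * t" by (simp add: distrib_left power2_eq_square)
    then show "k \<in> {k. lo \<le> D * k \<and> D * k < hi \<and> k mod D = r}"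
      using t r ge[OF a, of t] ge[OF b, of t] by auto
  qed
  have "inj_on (\<lambda>t. r + D * t) {a..<b}" using D by (auto simp: inj_on_def)
  then have c: "card {k. lo \<le> D * k \<and> D * k < hi \<and> k mod D = r} = nat (b - a)"
    unfolding eq by (simp add: card_image)
  have "hi \<le> D * r + ?Q * b" using ge[OF b] by simp
  then have "a \<le> b" using ge[OF a, of b] le by simp
  then have "?Q * int (nat (b - a)) = ?Q * b - ?Q * a" by (simp add: right_diff_distrib)
  then show ?thesis unfolding c using a b by linarith
qed

definition cell :: "'i set \<Rightarrow> 'i \<Rightarrow> nat \<Rightarrow> ('i \<Rightarrow> int) \<Rightarrow> (('i \<Rightarrow> int) \<times> int) set \<Rightarrow> int \<Rightarrow> int set" where
  "cell J iN M e U r = {k. 0 \<le> k \<and> k < e iN \<and> below J M e k = U \<and> k mod fact M = r}"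

lemma finite_cell: "finite (cell J iN M e U r)"
  by (rule finite_subset[of _ "{0..<e iN}"]) (auto simp: cell_def)

text \<open>A cut is an initial segment of the thresholds ordered by value, so only its greatest
  element and the least threshold outside it matter.\<close>

lemma below_interval:
  assumes U: "U \<subseteq> thr J M" and s: "s \<in> thr J M - U" "\<And>u. u \<in> thr J M - U \<Longrightarrow> ev J s e \<le> ev J u e"
    and t: "t \<in> U" "\<And>u. u \<in> U \<Longrightarrow> ev J u e \<le> ev J t e"
  shows "below J M e k = U \<longleftrightarrow> ev J t e \<le> fact M * k \<and> fact M * k < ev J s e"
proof
  assume "below J M e k = U"
  then show "ev J t e \<le> fact M * k \<and> fact M * k < ev J s e" using s(1) t(1) unfolding below_def by force
next
  assume *: "ev J t e \<le> fact M * k \<and> fact M * k < ev J s e"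
  show "below J M e k = U"
  proof (intro set_eqI iffI)
    fix u assume u: "u \<in> below J M e k"
    show "u \<in> U"
    proof (rule ccontr)
      assume "u \<notin> U"
      then have "ev J s e \<le> ev J u e" using s(2) u by (simp add: below_def)
      with u * show False by (simp add: below_def)
    qed
  next
    fix u assume "u \<in> U"
    then show "u \<in> below J M e k" using * t(2)[of u] U unfolding below_def by auto
  qed
qed

text \<open>One form serves both valuations: equivalence at the next level preserves the order of
  the thresholds, so the same two delimit the cell, and it preserves their residues modulo
  \<open>(M!)^2\<close>, so the rounding term \<open>d\<close> is the same constant.\<close>

lemma card_cell:
  assumes J: "finite J" "iN \<in> J" and e: "eqv J (next_lvl M) e e'" and U: "U \<subseteq> thr J M"
    and r: "0 \<le> r" "r < fact M"
  obtains c c0 where "form J (2 * thr_bound M + (fact M)\<^sup>2) c c0"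
    "(fact M)\<^sup>2 * int (card (cell J iN M e U r)) = lin J c c0 e"
    "(fact M)\<^sup>2 * int (card (cell J iN M e' U r)) = lin J c c0 e'"
proof -
  let ?D = "fact M :: int"
  note result = that
  have Dpos: "0 < ?D" by simp
  have zero: thesis if "cell J iN M e U r = {}" "cell J iN M e' U r = {}"
  proof (rule result[of "\<lambda>_. 0" 0])
    show "form J (2 * thr_bound M + (fact M)\<^sup>2) (\<lambda>_. 0) 0" by (simp add: form_def)
  qed (simp_all add: that lin_def)
  \<comment> \<open>\<open>z\<close> is the threshold 0 and \<open>u\<close> below is the threshold
    \<open>M! * e iN\<close>. Through them the cut \<open>U\<close> already decides
    \<open>0 \<le> k < e iN\<close>; if it says no, the cell is empty for both valuations.\<close>
  obtain z where z: "z \<in> thr J M" "\<And>e. ev J z e = 0"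
    using thr_ex[of J M "\<lambda>_. 0" 0] by (auto simp: form_def lin_def)
  have DL: "?D \<le> int (thr_bound M)"
  \<comment> \<open>For \<open>M = 0\<close> the room for the coefficient \<open>fact 0 = 1\<close>
    comes from the summand 1 of \<open>thr_bound\<close>.\<close>
  proof (cases "M = 0")
    case False
    then have "?D * 1 \<le> ?D * int M" by (intro mult_left_mono) auto
    moreover have "int (thr_bound M) = ?D * int M + 1" by (simp add: thr_bound_def)
    ultimately show ?thesis by linarith
  qed (simp add: thr_bound_def)
  have "lin J (\<lambda>j. if j = iN then ?D else 0) 0 e = ?D * e iN" for e :: "_ \<Rightarrow> int"
    using J by (simp add: lin_def if_distrib[of "\<lambda>x. x * _"] sum.delta cong: if_cong)
  moreover have "form J (thr_bound M) (\<lambda>j. if j = iN then ?D else 0) 0" using DL by (auto simp: form_def)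
  ultimately obtain u where u: "u \<in> thr J M" "\<And>e. ev J u e = ?D * e iN"
    by (metis thr_ex)
  have range: "z \<in> below J M e k \<longleftrightarrow> 0 \<le> k" "u \<notin> below J M e k \<longleftrightarrow> k < e iN" for e k
    using z u Dpos by (auto simp: below_def zero_le_mult_iff not_le simp del: fact_gt_zero)
  show thesis
  proof (cases "z \<in> U \<and> u \<notin> U")
    case False
    then have "cell J iN M e U r = {}" for e unfolding cell_def using range by blast
    then show thesis by (intro zero)
  next
    case True
    have fin: "finite U" "finite (thr J M - U)" "U \<noteq> {}" "thr J M - U \<noteq> {}"
      using finite_thr[OF J(1)] finite_subset[OF U] True u(1) by auto
    obtain t where t: "t \<in> U" "\<And>v. v \<in> U \<Longrightarrow> ev J v e \<le> ev J t e"
      using ex_max[OF fin(1,3), of "\<lambda>v. ev J v e"] by blast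
    obtain s where s: "s \<in> thr J M - U" "\<And>v. v \<in> thr J M - U \<Longrightarrow> ev J s e \<le> ev J v e"
      using ex_min[OF fin(2,4), of "\<lambda>v. ev J v e"] by blast
    have le: "ev J v e \<le> ev J w e \<longleftrightarrow> ev J v e' \<le> ev J w e'" if "v \<in> thr J M" "w \<in> thr J M" for v w
      using eqv_thr_le[OF e that, of 0] by simp
    have t': "ev J v e' \<le> ev J t e'" if "v \<in> U" for v using t that le[of v t] U by auto
    have s': "ev J s e' \<le> ev J v e'" if "v \<in> thr J M - U" for v using s that le[of s v] by auto
    have cell: "cell J iN M x U r = {k. ev J t x \<le> ?D * k \<and> ?D * k < ev J s x \<and> k mod ?D = r}"
      if "\<And>v. v \<in> U \<Longrightarrow> ev J v x \<le> ev J t x" "\<And>v. v \<in> thr J M - U \<Longrightarrow> ev J s x \<le> ev J v x" for x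
    proof -
      have "(0 \<le> k \<and> k < x iN \<and> below J M x k = U) \<longleftrightarrow> (ev J t x \<le> ?D * k \<and> ?D * k < ev J s x)" for k
        using below_interval[OF U s(1) that(2) t(1) that(1), of k] range[of x k] True by auto
      then show ?thesis unfolding cell_def by auto
    qed
    have cells: "cell J iN M e U r = {k. ev J t e \<le> ?D * k \<and> ?D * k < ev J s e \<and> k mod ?D = r}"
      "cell J iN M e' U r = {k. ev J t e' \<le> ?D * k \<and> ?D * k < ev J s e' \<and> k mod ?D = r}"
      using t(2) s(2) t' s' by (intro cell; blast)+
    have ts: "t \<in> thr J M" "s \<in> thr J M" using t s U by auto
    show thesis
    proof (cases "ev J t e \<le> ev J s e")
      case False
      then have "\<not> ev J t e' \<le> ev J s e'" using le[OF ts] by simp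
      with False have "cell J iN M e U r = {}" "cell J iN M e' U r = {}" unfolding cells by auto
      then show thesis by (rule zero)
    next
      case True
      define d where "d = (?D * r - ev J s e) mod ?D\<^sup>2 - (?D * r - ev J t e) mod ?D\<^sup>2"
      have True': "ev J t e' \<le> ev J s e'" using le[OF ts] True by simp
      have Q: "0 < ?D\<^sup>2" by simp
      have d: "\<bar>d\<bar> \<le> ?D\<^sup>2"
        using pos_mod_bound[OF Q, of "?D * r - ev J s e"] pos_mod_bound[OF Q, of "?D * r - ev J t e"]
          pos_mod_sign[OF Q, of "?D * r - ev J s e"] pos_mod_sign[OF Q, of "?D * r - ev J t e"]
        unfolding d_def by linarith
      have "(?D * r - ev J v e) mod ?D\<^sup>2 = (?D * r - ev J v e') mod ?D\<^sup>2" for v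
        using eqv_thr_dvd[OF e, of v] by (simp add: mod_eq_dvd_iff dvd_diff_commute)
      then have d': "d = (?D * r - ev J s e') mod ?D\<^sup>2 - (?D * r - ev J t e') mod ?D\<^sup>2"
        unfolding d_def by simp
      show thesis
      proof (rule result)
        show "form J (2 * thr_bound M + (fact M)\<^sup>2) (\<lambda>i. fst s i - fst t i) (snd s - snd t + d)"
          using form_thr[OF ts(1)] form_thr[OF ts(2)] d unfolding form_def
          by (force simp: abs_le_iff)
        show "?D\<^sup>2 * int (card (cell J iN M e U r)) = lin J (\<lambda>i. fst s i - fst t i) (snd s - snd t + d) e"
          unfolding cells(1) lin_const lin_diff ev_def[symmetric] d_def
          by (rule card_arith_interval) (use r True in auto)
        show "?D\<^sup>2 * int (card (cell J iN M e' U r)) = lin J (\<lambda>i. fst s i - fst t i) (snd s - snd t + d) e'"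
          unfolding cells(2) lin_const lin_diff ev_def[symmetric] d'
          by (rule card_arith_interval) (use r True' in auto)
      qed
    qed
  qed
qed

text \<open>Any \<open>m s\<close> points may be set aside for the colour \<open>s\<close>; what
  remains has exactly the size that the other colours require.\<close>

lemma colouring_ex:
  assumes "finite C" "finite X" "(\<Sum>s\<in>C. m s) = card X"
  shows "\<exists>\<chi>. (\<forall>x\<in>X. \<chi> x \<in> C) \<and> (\<forall>s\<in>C. card {x \<in> X. \<chi> x = s} = m s)"
  using assms
proof (induction C arbitrary: X)
  case (insert s C)
  then have "m s \<le> card X" by simp
  then obtain Y where Y: "Y \<subseteq> X" "card Y = m s" using obtain_subset_with_card_n by blast
  then have "(\<Sum>s\<in>C. m s) = card (X - Y)" using insert by (simp add: card_Diff_subset finite_subset)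
  then obtain \<chi> where \<chi>: "\<forall>x\<in>X - Y. \<chi> x \<in> C" "\<forall>s\<in>C. card {x \<in> X - Y. \<chi> x = s} = m s"
    using insert.IH[of "X - Y"] insert.prems by blast
  show ?case
  proof (intro exI[of _ "\<lambda>x. if x \<in> Y then s else \<chi> x"] conjI ballI)
    fix s' assume "s' \<in> insert s C"
    then consider "s' = s" | "s' \<in> C" by blast
    then show "card {x \<in> X. (if x \<in> Y then s else \<chi> x) = s'} = m s'"
    proof cases
      case 1
      then have "{x \<in> X. (if x \<in> Y then s else \<chi> x) = s'} = Y"
        using Y(1) \<chi>(1) insert.hyps by auto
      with 1 Y(2) show ?thesis by simp
    next
      case 2
      then have "{x \<in> X. (if x \<in> Y then s else \<chi> x) = s'} = {x \<in> X - Y. \<chi> x = s'}"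
        using insert.hyps by auto
      with 2 \<chi>(2) show ?thesis by simp
    qed
  qed (use \<chi>(1) in auto)
qed auto

lemma card_partition:
  assumes "finite X" "finite Y" "f ` X \<subseteq> Y"
  shows "card X = (\<Sum>y\<in>Y. card {x \<in> X. f x = y})"
  using sum.group[OF assms, of "\<lambda>_. 1 :: nat"] by simp

text \<open>Counts coordinates: \<open>n\<close> original ones, and one for each triple of a set of
  thresholds in \<open>n - 1\<close> coordinates, a residue modulo \<open>M!\<close> and one of
  \<open>c\<close> colours.\<close>

definition ext_dim :: "nat \<Rightarrow> nat \<Rightarrow> nat \<Rightarrow> nat" where
  "ext_dim M n c = n + 2 ^ ((2 * thr_bound M + 1) ^ (n - 1) * (2 * thr_bound M + 1)) * (fact M * c)"

definition col_bound :: "nat \<Rightarrow> nat \<Rightarrow> nat \<Rightarrow> nat" where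
  "col_bound M n c = wits_bound (next_lvl M) (ext_dim M n c) (ext_dim M n c) 0"

text \<open>For each cell, \<open>(M!)^2\<close> times the sum of its multiplicities equals the form
  from \<open>card_cell\<close>. The coefficients of this relation are at most
  \<open>next_lvl M\<close>, so the small extended valuation satisfies it as well; since the form
  also measures the cell of \<open>e'\<close>, the new multiplicities add up to the size of the new
  cell.\<close>

lemma small_coloured:
  fixes e :: "'i \<Rightarrow> int" and \<chi> :: "int \<Rightarrow> 'c"
  assumes I: "finite I" "i \<in> I" "iN \<in> I" "i \<noteq> iN" and C: "finite C" "\<And>k. \<chi> k \<in> C"
  obtains e' \<chi>' where "\<And>j. \<bar>e' j\<bar> \<le> int (col_bound M (card I) (card C))" "eqv I M e e'"
    "\<And>k'. 0 \<le> k' \<Longrightarrow> k' < e' iN \<Longrightarrow>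
      \<exists>k. 0 \<le> k \<and> k < e iN \<and> \<chi> k = \<chi>' k' \<and> eqv I M (e(i := k)) (e'(i := k'))"
    "\<And>S j. S \<subseteq> C \<Longrightarrow> j \<in> I \<Longrightarrow> e j = int (card {k \<in> {0..<e iN}. \<chi> k \<in> S}) \<Longrightarrow>
      e' j = int (card {k \<in> {0..<e' iN}. \<chi>' k \<in> S})"
proof -
  let ?J = "I - {i}" and ?D = "fact M :: int"
  define Cells where "Cells = Pow (thr ?J M) \<times> {0..<?D} \<times> C"
  define I' where "I' = I <+> Cells"
  have J: "finite ?J" "iN \<in> ?J" using I by auto
  have finC: "finite Cells" using J C by (simp add: Cells_def finite_thr)
  then have finI': "finite I'" using I by (simp add: I'_def)
  have cardJ: "card ?J = card I - 1" using I by simp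
  have cardI': "card I' = ext_dim M (card I) (card C)"
  proof -
    have "card {0..<?D} = fact M"
      by (metis card_atLeastLessThan_int diff_zero nat_int of_nat_fact)
    then have "card Cells = 2 ^ card (thr ?J M) * (fact M * card C)"
      using J by (simp only: Cells_def card_cartesian_product card_Pow finite_thr)
    then show ?thesis
      unfolding I'_def ext_dim_def card_Plus[OF I(1) finC] card_thr[OF J(1)] cardJ by simp
  qed
  define num where "num = (\<lambda>e (\<chi>::int \<Rightarrow> 'c) (U, r, s). int (card {k \<in> cell ?J iN M e U r. \<chi> k = s}))"
  define d where "d = case_sum e (num e \<chi>)"
  obtain d' where d': "\<And>j. \<bar>d' j\<bar> \<le> int (col_bound M (card I) (card C))" "eqv I' (next_lvl M) d d'"
    using small_eqv[OF finI', of "next_lvl M" d] unfolding cardI' col_bound_def by blast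
  define e' where "e' = d' \<circ> Inl"
  define n' where "n' = d' \<circ> Inr"
  have lin': "lin I' (case_sum c g) c0 x = lin I c c0 (x \<circ> Inl) + (\<Sum>p\<in>Cells. g p * x (Inr p))"
    for c g c0 and x :: "_ \<Rightarrow> int"
    unfolding lin_def I'_def using I finC by (simp add: sum.Plus)
  have trans: "lin I c c0 e + (\<Sum>p\<in>Cells. g p * num e \<chi> p) = 0 \<Longrightarrow>
      lin I c c0 e' + (\<Sum>p\<in>Cells. g p * n' p) = 0"
    if "form I (next_lvl M) c c0" "\<forall>p\<in>Cells. \<bar>g p\<bar> \<le> int (next_lvl M)" for c c0 g
  proof -
    assume "lin I c c0 e + (\<Sum>p\<in>Cells. g p * num e \<chi> p) = 0"
    moreover have "d \<circ> Inl = e" by (auto simp: d_def)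
    ultimately have "lin I' (case_sum c g) c0 d = 0" unfolding lin' by (simp add: d_def)
    moreover have "form I' (next_lvl M) (case_sum c g) c0"
      using that by (auto simp: form_def I'_def)
    ultimately have "lin I' (case_sum c g) c0 d' = 0" using eqv_lin_eq_0[OF d'(2)] by blast
    then show ?thesis unfolding lin' by (simp add: e'_def n'_def)
  qed
  \<comment> \<open>\<open>a = 0\<close> makes the new multiplicities nonnegative.
    \<open>a = -1\<close> keeps vanishing ones at zero, so a colour used in a new cell occurs in the
    old one.\<close>
  have nonneg: "0 \<le> a + n' p \<longleftrightarrow> 0 \<le> a + num e \<chi> p" if "p \<in> Cells" "\<bar>a\<bar> \<le> 1" for p a
  proof -
    have F: "1 \<le> int (next_lvl M)" using next_lvl_bounds(3)[of M] by simp
    let ?c = "case_sum (\<lambda>_. 0) (\<lambda>q. if q = p then 1 else 0)"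
    have "form I' (next_lvl M) ?c a" using that F by (auto simp: form_def I'_def)
    moreover have "lin I' ?c a x = a + x (Inr p)" for x
      unfolding lin' using that finC by (simp add: lin_def if_distrib[of "\<lambda>x. x * _"] cong: if_cong)
    ultimately show ?thesis using eqvD[OF d'(2), of ?c a] by (simp add: d_def n'_def)
  qed
  have n'0: "0 \<le> n' p" if "p \<in> Cells" for p
    using nonneg[OF that, of 0] by (simp add: num_def split: prod.splits)
  have n'1: "n' p = 0" if "p \<in> Cells" "num e \<chi> p = 0" for p
    using nonneg[OF that(1), of "-1"] that n'0[OF that(1)] by simp
  have eF: "eqv I (next_lvl M) e e'"
    unfolding eqv_def
  proof (intro conjI allI impI ballI)
    fix c c0 assume "form I (next_lvl M) c c0"
    then have "form I' (next_lvl M) (case_sum c (\<lambda>_. 0)) c0" by (auto simp: form_def I'_def)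
    from eqvD[OF d'(2) this] show "0 \<le> lin I c c0 e \<longleftrightarrow> 0 \<le> lin I c c0 e'"
      unfolding lin' by (simp add: d_def e'_def comp_def)
  next
    fix j assume "j \<in> I"
    then have "Inl j \<in> I'" by (auto simp: I'_def)
    then have "[d (Inl j) = d' (Inl j)] (mod fact (next_lvl M))" using d'(2) by (auto simp: eqv_def)
    then show "[e j = e' j] (mod fact (next_lvl M))" by (simp add: d_def e'_def)
  qed
  have eJ: "eqv ?J (next_lvl M) e e'" by (rule eqv_subset[OF eF _ I(1)]) auto
  have sum_cell: "(\<Sum>s\<in>C. num e \<chi> (U, r, s)) = int (card (cell ?J iN M e U r))" for U r
    using card_partition[OF finite_cell C(1), of \<chi> ?J iN M e U r] C(2)
    by (simp add: num_def image_subset_iff)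
  have sum_cell': "(\<Sum>s\<in>C. n' (U, r, s)) = int (card (cell ?J iN M e' U r))"
    if U: "U \<subseteq> thr ?J M" and r: "0 \<le> r" "r < ?D" for U r
  proof -
    obtain c c0 where c: "form ?J (2 * thr_bound M + (fact M)\<^sup>2) c c0"
      "?D\<^sup>2 * int (card (cell ?J iN M e U r)) = lin ?J c c0 e"
      "?D\<^sup>2 * int (card (cell ?J iN M e' U r)) = lin ?J c c0 e'"
      using card_cell[OF J eJ U r] by blast
    let ?c = "\<lambda>j. if j \<in> ?J then c j else 0"
    \<comment> \<open>Coefficient \<open>- (M!)^2\<close> at each colour of the single cell
      \<open>(U, r)\<close>, to be balanced against the form \<open>c\<close>.\<close>
    define g where "g = (\<lambda>(U', r', s :: 'c). if U' = U \<and> r' = r then - (?D\<^sup>2) else 0)"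
    have gsum: "(\<Sum>p\<in>Cells. g p * x p) = - (?D\<^sup>2) * (\<Sum>s\<in>C. x (U, r, s))" for x
    proof -
      have "(\<Sum>p\<in>Cells. g p * x p) = (\<Sum>p\<in>(\<lambda>s. (U, r, s)) ` C. g p * x p)"
        using finC U r by (intro sum.mono_neutral_right) (auto simp: Cells_def g_def)
      also have "\<dots> = (\<Sum>s\<in>C. - (?D\<^sup>2) * x (U, r, s))"
        by (subst sum.reindex) (auto simp: inj_on_def g_def)
      finally show ?thesis by (simp add: sum_distrib_left)
    qed
    have "form I (next_lvl M) ?c c0" using form_mono[OF c(1) next_lvl_bounds(1)] by (auto simp: form_def)
    moreover have "\<forall>p\<in>Cells. \<bar>g p\<bar> \<le> int (next_lvl M)"
      using next_lvl_bounds(2)[of M, THEN of_nat_mono[where 'a = int]] by (auto simp: g_def)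
    moreover have "lin I ?c c0 e + (\<Sum>p\<in>Cells. g p * num e \<chi> p) = 0"
      unfolding gsum sum_cell lin_superset[OF I(1) Diff_subset] using c(2) by simp
    ultimately have "lin I ?c c0 e' + (\<Sum>p\<in>Cells. g p * n' p) = 0" by (rule trans)
    then have "?D\<^sup>2 * (\<Sum>s\<in>C. n' (U, r, s)) = ?D\<^sup>2 * int (card (cell ?J iN M e' U r))"
      unfolding gsum lin_superset[OF I(1) Diff_subset] using c(3) by simp
    then show ?thesis by simp
  qed
  define P where "P U r h \<longleftrightarrow> (\<forall>k\<in>cell ?J iN M e' U r. h k \<in> C) \<and>
      (\<forall>s\<in>C. card {k \<in> cell ?J iN M e' U r. h k = s} = nat (n' (U, r, s)))" for U r h
  have ex: "\<exists>h. P U r h" if "U \<subseteq> thr ?J M" "0 \<le> r" "r < ?D" for U r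
    unfolding P_def
  proof (rule colouring_ex[OF C(1) finite_cell])
    have "int (\<Sum>s\<in>C. nat (n' (U, r, s))) = (\<Sum>s\<in>C. n' (U, r, s))"
      using that n'0 by (auto simp: Cells_def intro!: sum.cong)
    then show "(\<Sum>s\<in>C. nat (n' (U, r, s))) = card (cell ?J iN M e' U r)"
      using sum_cell'[OF that] by linarith
  qed
  define h where "h U r = (SOME h. P U r h)" for U r
  have h: "P U r (h U r)" if "U \<subseteq> thr ?J M" "0 \<le> r" "r < ?D" for U r
    unfolding h_def by (rule someI_ex[OF ex[OF that]])
  \<comment> \<open>Every point lies in exactly one cell, so the colourings chosen cell by cell fit
    together: \<open>k\<close> consults the cell that contains it.\<close>
  define \<chi>' where "\<chi>' k = h (below ?J M e' k) (k mod ?D) k" for k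
  have num': "num e' \<chi>' p = n' p" if p: "p \<in> Cells" for p
  proof -
    obtain U r s where Urs: "p = (U, r, s)" by (cases p)
    have "{k \<in> cell ?J iN M e' U r. \<chi>' k = s} = {k \<in> cell ?J iN M e' U r. h U r k = s}"
      by (auto simp: cell_def \<chi>'_def)
    then show ?thesis using h[of U r] p n'0[OF p] by (auto simp: Urs num_def Cells_def P_def)
  qed
  have in_cell: "k \<in> cell ?J iN M x (below ?J M x k) (k mod ?D)" "below ?J M x k \<subseteq> thr ?J M"
    "0 \<le> k mod ?D" "k mod ?D < ?D" if "0 \<le> k" "k < x iN" for k x
    using that by (auto simp: cell_def below_def)
  \<comment> \<open>Counting by colour is linear in the multiplicities with coefficients 0 and 1, so
    an equation between a coordinate and such a count is one of the relations inherited by the small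
    valuation.\<close>
  have count: "int (card {k \<in> {0..<x iN}. y k \<in> S}) = (\<Sum>p\<in>Cells. (if snd (snd p) \<in> S then 1 else 0) * num x y p)"
    if S: "S \<subseteq> C" for x S and y :: "int \<Rightarrow> 'c"
  proof -
    let ?X = "{k \<in> {0..<x iN}. y k \<in> S}"
    let ?f = "\<lambda>k. (below ?J M x k, k mod ?D, y k)"
    have "?f ` ?X \<subseteq> Cells" using S by (auto simp: Cells_def below_def)
    moreover have "finite ?X" by (rule finite_subset[of _ "{0..<x iN}"]) auto
    ultimately have "card ?X = (\<Sum>p\<in>Cells. card {k \<in> ?X. ?f k = p})"
      using finC by (intro card_partition)
    moreover have "int (card {k \<in> ?X. ?f k = p}) = (if snd (snd p) \<in> S then 1 else 0) * num x y p" for p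
    proof -
      obtain U r s where p: "p = (U, r, s)" by (cases p)
      have "{k \<in> ?X. ?f k = p} = (if s \<in> S then {k \<in> cell ?J iN M x U r. y k = s} else {})"
        by (auto simp: p cell_def)
      then show ?thesis by (simp add: num_def p)
    qed
    ultimately show ?thesis by simp
  qed
  show thesis
  proof (rule that)
    show "\<bar>e' j\<bar> \<le> int (col_bound M (card I) (card C))" for j using d'(1) by (simp add: e'_def)
    show "eqv I M e e'" by (rule eqv_mono[OF eF]) (use next_lvl_bounds(3)[of M] in simp)
  next
    fix k' assume k': "0 \<le> k'" "k' < e' iN"
    define U where "U = below ?J M e' k'"
    define r where "r = k' mod ?D"
    have Ur: "k' \<in> cell ?J iN M e' U r" "U \<subseteq> thr ?J M" "0 \<le> r" "r < ?D"
      using in_cell[of k' e', OF k'] by (auto simp: U_def r_def)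
    then have s: "\<chi>' k' \<in> C" using h[OF Ur(2-4)] Ur(1) by (simp add: P_def \<chi>'_def U_def r_def)
    then have p: "(U, r, \<chi>' k') \<in> Cells" using Ur by (simp add: Cells_def)
    have "{k \<in> cell ?J iN M e' U r. \<chi>' k = \<chi>' k'} \<noteq> {}" using Ur(1) by blast
    then have "num e' \<chi>' (U, r, \<chi>' k') \<noteq> 0" by (simp add: num_def finite_cell)
    then have "num e \<chi> (U, r, \<chi>' k') \<noteq> 0" using n'1[OF p] num'[OF p] by metis
    then have "card {k \<in> cell ?J iN M e U r. \<chi> k = \<chi>' k'} \<noteq> 0" by (simp add: num_def)
    then obtain k where k: "k \<in> cell ?J iN M e U r" "\<chi> k = \<chi>' k'"
      by (metis (mono_tags, lifting) Collect_empty_eq card.empty)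
    have "eqv I M (e(i := k)) (e'(i := k'))"
    proof (rule below_eqv[OF I(1,2)])
      show "eqv ?J M e e'" by (rule eqv_mono[OF eJ]) (use next_lvl_bounds(3)[of M] in simp)
      show "below ?J M e k = below ?J M e' k'" using k by (simp add: cell_def U_def)
      show "[k = k'] (mod ?D)" using k by (simp add: cell_def r_def cong_def)
    qed
    then show "\<exists>k. 0 \<le> k \<and> k < e iN \<and> \<chi> k = \<chi>' k' \<and> eqv I M (e(i := k)) (e'(i := k'))"
      using k by (auto simp: cell_def)
  next
    fix S j assume S: "S \<subseteq> C" and j: "j \<in> I" and ej: "e j = int (card {k \<in> {0..<e iN}. \<chi> k \<in> S})"
    let ?c = "\<lambda>l. if l = j then - 1 else 0 :: int"
    let ?g = "\<lambda>p :: (('i \<Rightarrow> int) \<times> int) set \<times> int \<times> 'c. if snd (snd p) \<in> S then 1 else 0 :: int"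
    have lj: "lin I ?c 0 x = - x j" for x
      using I j by (simp add: lin_def if_distrib[of "\<lambda>x. x * _"] cong: if_cong)
    have F: "1 \<le> int (next_lvl M)" using next_lvl_bounds(3)[of M] by simp
    have "lin I ?c 0 e + (\<Sum>p\<in>Cells. ?g p * num e \<chi> p) = 0"
      unfolding lj count[OF S, symmetric] using ej by simp
    then have "lin I ?c 0 e' + (\<Sum>p\<in>Cells. ?g p * n' p) = 0"
      by (rule trans[rotated 2]) (use F in \<open>auto simp: form_def\<close>)
    moreover have "(\<Sum>p\<in>Cells. ?g p * n' p) = (\<Sum>p\<in>Cells. ?g p * num e' \<chi>' p)"
      by (rule sum.cong) (simp_all add: num')
    ultimately show "e' j = int (card {k \<in> {0..<e' iN}. \<chi>' k \<in> S})"
      unfolding lj count[OF S] by simp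
  qed
qed

section \<open>Basic formulae and small models\<close>

lemma add_le_pr: "a + b \<le> pr a b"
proof -
  have "n \<le> triangle n" for n by (induction n) auto
  from this[of "a + b"] show ?thesis by (simp add: prod_encode_def)
qed

section \<open>Basic formulae recognised by their shape\<close>

primrec tarray_vars :: "trm \<Rightarrow> nat set" and array_vars :: "fm \<Rightarrow> nat set" where
  "tarray_vars (Num n) = {}"
| "tarray_vars (Par c) = {}"
| "tarray_vars (Var x) = {}"
| "tarray_vars (Add s t) = tarray_vars s \<union> tarray_vars t"
| "tarray_vars (Minus t) = tarray_vars t"
| "tarray_vars (App a t) = tarray_vars t \<union> (case t of Var y \<Rightarrow> {y} | _ \<Rightarrow> {})"
| "tarray_vars (Card x \<phi>) = array_vars \<phi>"
| "array_vars (Less s t) = tarray_vars s \<union> tarray_vars t"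
| "array_vars (Equal s t) = tarray_vars s \<union> tarray_vars t"
| "array_vars (Congr n s t) = tarray_vars s \<union> tarray_vars t"
| "array_vars (Conj \<phi> \<psi>) = array_vars \<phi> \<union> array_vars \<psi>"
| "array_vars (Neg \<phi>) = array_vars \<phi>"
| "array_vars (Exi x \<phi>) = array_vars \<phi>"

lemma tarray_vars_subset_tvars: "tarray_vars t \<subseteq> tvars t" and array_vars_subset_vars: "array_vars \<phi> \<subseteq> vars \<phi>"
  by (induction t and \<phi>) (auto split: trm.splits)

text \<open>A local description of \<open>basic\<close> that mentions neither the arithmetic formula
  nor the substitution. The condition at \<open>Exi\<close> is what \<open>free_for\<close> leaves
  behind: the \<open>y\<close> of a substituted \<open>a(y)\<close> is not bound.\<close>

primrec tbas_shape :: "trm \<Rightarrow> bool" and bas_shape :: "fm \<Rightarrow> bool" where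
  "tbas_shape (Num n) \<longleftrightarrow> True"
| "tbas_shape (Par c) \<longleftrightarrow> True"
| "tbas_shape (Var x) \<longleftrightarrow> True"
| "tbas_shape (Add s t) \<longleftrightarrow> tbas_shape s \<and> tbas_shape t"
| "tbas_shape (Minus t) \<longleftrightarrow> tbas_shape t"
| "tbas_shape (App a t) \<longleftrightarrow> (\<exists>y. t = Var y)"
| "tbas_shape (Card x \<phi>) \<longleftrightarrow> False"
| "bas_shape (Less s t) \<longleftrightarrow> tbas_shape s \<and> tbas_shape t"
| "bas_shape (Equal s t) \<longleftrightarrow> tbas_shape s \<and> tbas_shape t"
| "bas_shape (Congr n s t) \<longleftrightarrow> tbas_shape s \<and> tbas_shape t"
| "bas_shape (Conj \<phi> \<psi>) \<longleftrightarrow> bas_shape \<phi> \<and> bas_shape \<psi>"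
| "bas_shape (Neg \<phi>) \<longleftrightarrow> bas_shape \<phi>"
| "bas_shape (Exi x \<phi>) \<longleftrightarrow> bas_shape \<phi> \<and> x \<notin> array_vars \<phi>"

text \<open>The inclusion strengthens the induction: at \<open>Exi x \<psi>\<close> it traces an
  array variable back to a free \<open>u\<close> whose replacement contains it, and
  \<open>free_for\<close> forbids this variable to be \<open>x\<close>.\<close>

lemma bas_shape_subst:
  "(\<And>u. \<sigma> u = Var u \<or> (\<exists>a y. \<sigma> u = App a (Var y))) \<Longrightarrow> tarith t \<Longrightarrow>
    tbas_shape (tsubst \<sigma> t) \<and> tarray_vars (tsubst \<sigma> t) \<subseteq> {y. \<exists>u\<in>tfv t. \<exists>a. \<sigma> u = App a (Var y)}"
  "(\<And>u. \<sigma> u = Var u \<or> (\<exists>a y. \<sigma> u = App a (Var y))) \<Longrightarrow> arith \<psi> \<Longrightarrow> free_for \<sigma> \<psi> \<Longrightarrow>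
    bas_shape (subst \<sigma> \<psi>) \<and> array_vars (subst \<sigma> \<psi>) \<subseteq> {y. \<exists>u\<in>fv \<psi>. \<exists>a. \<sigma> u = App a (Var y)}"
proof (induction t and \<psi> arbitrary: \<sigma> and \<sigma>)
  case (Var x)
  from Var(1)[of x] show ?case by (elim disjE exE) simp_all
next
  case (Exi x \<psi>)
  let ?\<sigma> = "\<sigma>(x := Var x)"
  have \<sigma>: "?\<sigma> u = Var u \<or> (\<exists>a y. ?\<sigma> u = App a (Var y))" for u
    using Exi.prems(1)[of u] by (cases "u = x") simp_all
  have IH: "bas_shape (subst ?\<sigma> \<psi>) \<and> array_vars (subst ?\<sigma> \<psi>) \<subseteq> {y. \<exists>u\<in>fv \<psi>. \<exists>a. ?\<sigma> u = App a (Var y)}"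
    using Exi.IH[of ?\<sigma>, OF \<sigma>] Exi.prems(2,3) by (simp only: arith.simps free_for.simps)
  have ap: "\<exists>u\<in>fv \<psi> - {x}. \<exists>a. \<sigma> u = App a (Var y)" if y: "y \<in> array_vars (subst ?\<sigma> \<psi>)" for y
  proof -
    obtain u a where "u \<in> fv \<psi>" "?\<sigma> u = App a (Var y)" using IH y by blast
    then show ?thesis by (cases "u = x") auto
  qed
  moreover have "x \<notin> array_vars (subst ?\<sigma> \<psi>)"
  proof
    assume "x \<in> array_vars (subst ?\<sigma> \<psi>)"
    then obtain u a where u: "u \<in> fv \<psi> - {x}" "\<sigma> u = App a (Var x)" using ap by blast
    have "x \<notin> tfv (\<sigma> u)" using Exi.prems(3) u(1) unfolding free_for.simps by blast
    then show False unfolding u(2) by simp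
  qed
  ultimately show ?case using IH by auto
next
  case (Add s t)
  from Add.IH(1)[OF Add.prems(1)] Add.IH(2)[OF Add.prems(1)] Add.prems(2) show ?case by fastforce
next
  case (Less s t)
  from Less.IH(1)[OF Less.prems(1)] Less.IH(2)[OF Less.prems(1)] Less.prems(2) show ?case by fastforce
next
  case (Equal s t)
  from Equal.IH(1)[OF Equal.prems(1)] Equal.IH(2)[OF Equal.prems(1)] Equal.prems(2) show ?case by fastforce
next
  case (Congr n s t)
  from Congr.IH(1)[OF Congr.prems(1)] Congr.IH(2)[OF Congr.prems(1)] Congr.prems(2) show ?case by fastforce
next
  case (Conj \<phi> \<psi>)
  from Conj.IH(1)[OF Conj.prems(1)] Conj.IH(2)[OF Conj.prems(1)] Conj.prems(2,3) show ?case by fastforce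
next
  case (Minus t)
  from Minus.IH[OF Minus.prems(1)] Minus.prems(2) show ?case by fastforce
next
  case (Neg \<psi>)
  from Neg.IH[OF Neg.prems(1)] Neg.prems(2,3) show ?case by fastforce
qed simp_all

text \<open>To undo the substitution, \<open>a(y)\<close> is replaced by the variable \<open>n + pr a y\<close>, which is fresh if \<open>n\<close>
  exceeds all variables. The values at terms that are not of basic shape are arbitrary.\<close>

primrec tabstract :: "nat \<Rightarrow> trm \<Rightarrow> trm" and abstract :: "nat \<Rightarrow> fm \<Rightarrow> fm" where
  "tabstract n (Num k) = Num k"
| "tabstract n (Par c) = Par c"
| "tabstract n (Var x) = Var x"
| "tabstract n (Add s t) = Add (tabstract n s) (tabstract n t)"
| "tabstract n (Minus t) = Minus (tabstract n t)"
| "tabstract n (App a t) = (case t of Var y \<Rightarrow> Var (n + pr a y) | _ \<Rightarrow> Num 0)"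
| "tabstract n (Card x \<phi>) = Num 0"
| "abstract n (Less s t) = Less (tabstract n s) (tabstract n t)"
| "abstract n (Equal s t) = Equal (tabstract n s) (tabstract n t)"
| "abstract n (Congr k s t) = Congr k (tabstract n s) (tabstract n t)"
| "abstract n (Conj \<phi> \<psi>) = Conj (abstract n \<phi>) (abstract n \<psi>)"
| "abstract n (Neg \<phi>) = Neg (abstract n \<phi>)"
| "abstract n (Exi x \<phi>) = Exi x (abstract n \<phi>)"

definition unabstract :: "nat \<Rightarrow> nat \<Rightarrow> trm" where
  "unabstract n u = (if u < n then Var u else App (p1 (u - n)) (Var (p2 (u - n))))"

text \<open>The inclusion for free variables handles capture at \<open>Exi x\<close>: a fresh
  variable whose term contains \<open>x\<close> would make \<open>x\<close> an array variable of the
  body, contrary to \<open>bas_shape\<close>, and the variables below \<open>n\<close> are left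
  alone.\<close>

lemma unabstract_abs:
  "tbas_shape t \<Longrightarrow> tvars t \<subseteq> {..<n} \<Longrightarrow> tsubst (unabstract n) (tabstract n t) = t \<and> tarith (tabstract n t) \<and>
    tfree_for (unabstract n) (tabstract n t) \<and> tfv (tabstract n t) \<subseteq> {..<n} \<union> {u. n \<le> u \<and> p2 (u - n) \<in> tarray_vars t}"
  "bas_shape \<phi> \<Longrightarrow> vars \<phi> \<subseteq> {..<n} \<Longrightarrow> subst (unabstract n) (abstract n \<phi>) = \<phi> \<and> arith (abstract n \<phi>) \<and>
    free_for (unabstract n) (abstract n \<phi>) \<and> fv (abstract n \<phi>) \<subseteq> {..<n} \<union> {u. n \<le> u \<and> p2 (u - n) \<in> array_vars \<phi>}"
proof (induction t and \<phi>)
  case (Exi x \<phi>)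
  then have x: "(unabstract n)(x := Var x) = unabstract n" by (auto simp: unabstract_def)
  have "x \<notin> tfv (unabstract n u)" if "u \<in> fv (abstract n \<phi>) - {x}" for u
    using that Exi by (auto simp: unabstract_def)
  then show ?case using Exi by (auto simp: x)
qed (auto simp: unabstract_def)

lemma tcode_le: "tcode s \<le> tcode (Add s t)" "tcode t \<le> tcode (Add s t)" "tcode t \<le> tcode (Minus t)"
  "tcode t \<le> tcode (App a t)" "a \<le> tcode (App a t)" "c \<le> tcode (Par c)" "x \<le> tcode (Var x)"
  "x \<le> tcode (Card x \<phi>)" "code \<phi> \<le> tcode (Card x \<phi>)"
  and code_le: "tcode s \<le> code (Less s t)" "tcode t \<le> code (Less s t)"
  "tcode s \<le> code (Equal s t)" "tcode t \<le> code (Equal s t)"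
  "tcode s \<le> code (Congr n s t)" "tcode t \<le> code (Congr n s t)" "n \<le> code (Congr n s t)"
  "code \<phi> \<le> code (Conj \<phi> \<psi>)" "code \<psi> \<le> code (Conj \<phi> \<psi>)" "code \<phi> \<le> code (Neg \<phi>)"
  "code \<phi> \<le> code (Exi x \<phi>)" "x \<le> code (Exi x \<phi>)"
  unfolding tcode.simps code.simps
  by (meson le_prod_encode_1 le_prod_encode_2 order_refl order_trans)+

lemma subset_atMost_trans: "A \<subseteq> {..a} \<Longrightarrow> a \<le> b \<Longrightarrow> A \<subseteq> {..b :: nat}"
  by auto

lemma vars_le: "tvars t \<subseteq> {..tcode t}" "vars \<phi> \<subseteq> {..code \<phi>}"
proof (induction t and \<phi>)
qed (simp only: tvars.simps vars.simps insert_subset Un_subset_iff atMost_iff empty_subsetI;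
      (intro conjI TrueI)?; (erule subset_atMost_trans)?; (rule tcode_le code_le)?)+

lemma basic_iff_bas_shape: "basic \<phi> \<longleftrightarrow> bas_shape \<phi>"
proof
  assume "basic \<phi>"
  then show "bas_shape \<phi>" unfolding basic_def using bas_shape_subst(2) by blast
next
  assume "bas_shape \<phi>"
  then have "subst (unabstract (Suc (code \<phi>))) (abstract (Suc (code \<phi>)) \<phi>) = \<phi> \<and> arith (abstract (Suc (code \<phi>)) \<phi>) \<and>
    free_for (unabstract (Suc (code \<phi>))) (abstract (Suc (code \<phi>)) \<phi>)"
    using unabstract_abs(2)[of \<phi> "Suc (code \<phi>)"] vars_le(2)[of \<phi>] by (simp only: lessThan_Suc_atMost)
  moreover have "unabstract n u = Var u \<or> (\<exists>a y. unabstract n u = App a (Var y))" for n u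
    by (auto simp: unabstract_def)
  ultimately show "basic \<phi>" unfolding basic_def by metis
qed

section \<open>Parameters, variables and array reads as coordinates\<close>

datatype loc = LP nat | LV nat | LW nat nat

definition locs :: "nat \<Rightarrow> loc set" where
  "locs n = LP ` {..n} \<union> LV ` {..n} \<union> (\<lambda>(a, y). LW a y) ` ({..n} \<times> {..n})"

lemma in_locs [simp]: "LP c \<in> locs n \<longleftrightarrow> c \<le> n" "LV y \<in> locs n \<longleftrightarrow> y \<le> n"
  "LW a y \<in> locs n \<longleftrightarrow> a \<le> n \<and> y \<le> n"
  by (auto simp: locs_def)

lemma finite_locs [simp]: "finite (locs n)"
  by (simp add: locs_def)

lemma card_locs: "card (locs n) = 2 * Suc n + Suc n * Suc n"
proof -
  have "card (LP ` {..n} \<union> LV ` {..n}) = Suc n + Suc n"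
    by (subst card_Un_disjoint) (auto simp: card_image inj_on_def)
  moreover have "card ((\<lambda>(a, y). LW a y) ` ({..n} \<times> {..n})) = Suc n * Suc n"
    by (subst card_image) (auto simp: inj_on_def card_cartesian_product)
  ultimately show ?thesis unfolding locs_def by (subst card_Un_disjoint) auto
qed

text \<open>Array reads are coordinates of their own, independent of the values of their arguments.
  Accordingly \<open>Exi x\<close> changes \<open>LV x\<close> but no \<open>LW a x\<close>, which
  is faithful for basic shapes because \<open>a(x)\<close> does not occur under a binder of
  \<open>x\<close>.\<close>

primrec ltval :: "(loc \<Rightarrow> int) \<Rightarrow> trm \<Rightarrow> int" and lholds :: "(loc \<Rightarrow> int) \<Rightarrow> fm \<Rightarrow> bool" where
  "ltval e (Num n) = n"
| "ltval e (Par c) = e (LP c)"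
| "ltval e (Var x) = e (LV x)"
| "ltval e (Add s t) = ltval e s + ltval e t"
| "ltval e (Minus t) = - ltval e t"
| "ltval e (App a t) = (case t of Var y \<Rightarrow> e (LW a y) | _ \<Rightarrow> 0)"
| "ltval e (Card x \<phi>) = 0"
| "lholds e (Less s t) \<longleftrightarrow> ltval e s < ltval e t"
| "lholds e (Equal s t) \<longleftrightarrow> ltval e s = ltval e t"
| "lholds e (Congr n s t) \<longleftrightarrow> [ltval e s = ltval e t] (mod int n)"
| "lholds e (Conj \<phi> \<psi>) \<longleftrightarrow> lholds e \<phi> \<and> lholds e \<psi>"
| "lholds e (Neg \<phi>) \<longleftrightarrow> \<not> lholds e \<phi>"
| "lholds e (Exi x \<phi>) \<longleftrightarrow> (\<exists>k. lholds (e(LV x := k)) \<phi>)"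

lemma code_Exi_less: "code \<phi> < code (Exi x \<phi>)"
  using add_le_pr[of 12 "pr x (code \<phi>)"] le_prod_encode_2[of "code \<phi>" x] by simp

text \<open>Correct reads are demanded for array variables of the expression only. This carries the
  quantifier case: the bound variable is not among them, so changing its value spoils no
  read.\<close>

lemma lholds_holds:
  "tbas_shape t \<Longrightarrow> tcode t \<le> n \<Longrightarrow> (\<And>c. c \<le> n \<Longrightarrow> e (LP c) = p c) \<Longrightarrow> (\<And>y. y \<le> n \<Longrightarrow> e (LV y) = v y) \<Longrightarrow>
    (\<And>a y. a \<le> n \<Longrightarrow> y \<le> n \<Longrightarrow> y \<in> tarray_vars t \<Longrightarrow> e (LW a y) = A a (v y)) \<Longrightarrow> ltval e t = tval p A v t"
  "bas_shape \<phi> \<Longrightarrow> code \<phi> \<le> n \<Longrightarrow> (\<And>c. c \<le> n \<Longrightarrow> e (LP c) = p c) \<Longrightarrow> (\<And>y. y \<le> n \<Longrightarrow> e (LV y) = v y) \<Longrightarrow>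
    (\<And>a y. a \<le> n \<Longrightarrow> y \<le> n \<Longrightarrow> y \<in> array_vars \<phi> \<Longrightarrow> e (LW a y) = A a (v y)) \<Longrightarrow> lholds e \<phi> \<longleftrightarrow> holds p A v \<phi>"
proof (induction t and \<phi> arbitrary: e v and e v)
  case (Par c)
  then show ?case using tcode_le(6)[of c] by simp
next
  case (Var x)
  then show ?case using tcode_le(7)[of x] by simp
next
  case (Add s t)
  have "ltval e s = tval p A v s" by (rule Add.IH(1)) (use Add.prems tcode_le(1)[of s t] in auto)
  moreover have "ltval e t = tval p A v t" by (rule Add.IH(2)) (use Add.prems tcode_le(2)[of t s] in auto)
  ultimately show ?case by simp
next
  case (Minus t)
  then show ?case using tcode_le(3)[of t] by (simp del: tcode.simps)
next
  case (App a t)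
  then obtain y where y: "t = Var y" by auto
  then have "y \<le> n" "a \<le> n" using App.prems(2) tcode_le(4)[of t a] tcode_le(5)[of a t] tcode_le(7)[of y]
    by (meson order_trans)+
  then show ?case using App.prems y by simp
next
  case (Less s t)
  have "ltval e s = tval p A v s" by (rule Less.IH(1)) (use Less.prems code_le(1)[of s t] in auto)
  moreover have "ltval e t = tval p A v t" by (rule Less.IH(2)) (use Less.prems code_le(2)[of t s] in auto)
  ultimately show ?case by simp
next
  case (Equal s t)
  have "ltval e s = tval p A v s" by (rule Equal.IH(1)) (use Equal.prems code_le(3)[of s t] in auto)
  moreover have "ltval e t = tval p A v t" by (rule Equal.IH(2)) (use Equal.prems code_le(4)[of t s] in auto)
  ultimately show ?case by simp
next
  case (Congr m s t)
  have "ltval e s = tval p A v s" by (rule Congr.IH(1)) (use Congr.prems code_le(5)[of s m t] in auto)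
  moreover have "ltval e t = tval p A v t" by (rule Congr.IH(2)) (use Congr.prems code_le(6)[of t m s] in auto)
  ultimately show ?case by simp
next
  case (Conj \<phi> \<psi>)
  have "lholds e \<phi> = holds p A v \<phi>" by (rule Conj.IH(1)) (use Conj.prems code_le(8)[of \<phi> \<psi>] in auto)
  moreover have "lholds e \<psi> = holds p A v \<psi>" by (rule Conj.IH(2)) (use Conj.prems code_le(9)[of \<psi> \<phi>] in auto)
  ultimately show ?case by simp
next
  case (Neg \<phi>)
  then show ?case using code_le(10)[of \<phi>] by (simp del: code.simps)
next
  case (Exi x \<phi>)
  have "lholds (e(LV x := k)) \<phi> = holds p A (v(x := k)) \<phi>" for k
    by (rule Exi.IH) (use Exi.prems code_le(11)[of \<phi> x] in auto)
  then show ?case by simp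
qed auto

lemma int_encode_le: "int_encode k \<le> 2 * n \<longleftrightarrow> \<bar>k\<bar> \<le> int n"
  by (auto simp: int_encode_def sum_encode_def)

lemma abs_le_int_encode: "\<bar>k\<bar> \<le> int (int_encode k)"
  by (auto simp: int_encode_def sum_encode_def)

lemma lin_single: "finite I \<Longrightarrow> l \<in> I \<Longrightarrow> lin I (\<lambda>j. if j = l then 1 else 0) 0 e = e l"
  by (simp add: lin_def if_distrib[of "\<lambda>x. x * _"] cong: if_cong)

text \<open>Pairing dominates addition, so coefficients never outgrow the code, and nonzero tags
  give the codes of atoms room for the coefficient 1. One number \<open>n\<close> can therefore
  bound symbols, coefficients and moduli together.\<close>

lemma ltval_lin:
  "tbas_shape t \<Longrightarrow> tcode t \<le> n \<Longrightarrow>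
    \<exists>c c0. form (locs n) (tcode t) c c0 \<and> (\<forall>e. ltval e t = lin (locs n) c c0 e)"
proof (induction t rule: trm.induct[where ?P2.0 = "\<lambda>_. True"])
  case (Num k)
  have "\<bar>k\<bar> \<le> int (tcode (Num k))"
    using abs_le_int_encode[of k] le_prod_encode_2[of "int_encode k" 0] by simp
  then show ?case by (intro exI[of _ "\<lambda>_. 0"] exI[of _ k]) (auto simp: form_def lin_def)
next
  case (Par c)
  then have "c \<le> n" using tcode_le(6)[of c] by simp
  moreover have "1 \<le> tcode (Par c)" using add_le_pr[of 1 c] by simp
  ultimately show ?case
    by (intro exI[of _ "\<lambda>j. if j = LP c then 1 else 0"] exI[of _ 0])
       (auto simp: form_def lin_single simp del: tcode.simps)
next
  case (Var x)
  then have "x \<le> n" using tcode_le(7)[of x] by simp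
  moreover have "1 \<le> tcode (Var x)" using add_le_pr[of 2 x] by simp
  ultimately show ?case
    by (intro exI[of _ "\<lambda>j. if j = LV x then 1 else 0"] exI[of _ 0])
       (auto simp: form_def lin_single simp del: tcode.simps)
next
  case (Add s t)
  have sum: "tcode s + tcode t \<le> tcode (Add s t)"
    using add_le_pr[of "tcode s" "tcode t"] le_prod_encode_2[of "pr (tcode s) (tcode t)" 3] by simp
  then have "tcode s \<le> n" "tcode t \<le> n" using Add.prems by linarith+
  then obtain c c0 d d0 where c: "form (locs n) (tcode s) c c0" "\<And>e. ltval e s = lin (locs n) c c0 e"
    and d: "form (locs n) (tcode t) d d0" "\<And>e. ltval e t = lin (locs n) d d0 e"
    using Add by auto
  have "form (locs n) (tcode (Add s t)) (\<lambda>j. c j + d j) (c0 + d0)"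
    using c(1) d(1) sum unfolding form_def by (force simp del: tcode.simps)
  moreover have "ltval e (Add s t) = lin (locs n) (\<lambda>j. c j + d j) (c0 + d0) e" for e
    using c(2) d(2) by (simp add: lin_def distrib_right sum.distrib)
  ultimately show ?case by blast
next
  case (Minus t)
  then obtain c c0 where c: "form (locs n) (tcode t) c c0" "\<And>e. ltval e t = lin (locs n) c c0 e"
    using tcode_le(3)[of t] order_trans by (metis tbas_shape.simps(5))
  have "form (locs n) (tcode (Minus t)) (\<lambda>j. - c j) (- c0)"
    using form_mono[OF c(1) tcode_le(3)] by (simp add: form_uminus del: tcode.simps)
  then show ?case using c(2) by (intro exI[of _ "\<lambda>j. - c j"] exI[of _ "- c0"]) (simp add: lin_uminus del: tcode.simps)
next
  case (App a t)
  then obtain y where y: "t = Var y" by auto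
  then have "y \<le> n" "a \<le> n" using App.prems(2) tcode_le(4)[of t a] tcode_le(5)[of a t] tcode_le(7)[of y]
    by (meson order_trans)+
  moreover have "1 \<le> tcode (App a t)" using add_le_pr[of 5 "pr a (tcode t)"] by simp
  ultimately show ?case
    by (intro exI[of _ "\<lambda>j. if j = LW a y then 1 else 0"] exI[of _ 0])
       (auto simp: form_def lin_single y simp del: tcode.simps)
qed auto

lemma le_funpow_next_lvl: "n \<le> (next_lvl ^^ m) n"
  using funpow_next_lvl_mono[of 0 m n] by simp

text \<open>Each quantifier consumes one level by \<open>eqv_extend\<close>, and
  \<open>code\<close>, which strictly increases at \<open>Exi\<close>, overestimates the quantifier
  depth. Atoms are settled at any of these levels, since all are at least \<open>n\<close>; a
  nonzero modulus divides the factorial of the level.\<close>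

lemma lholds_eqv:
  "bas_shape \<phi> \<Longrightarrow> code \<phi> \<le> n \<Longrightarrow> eqv (locs n) ((next_lvl ^^ code \<phi>) n) e e' \<Longrightarrow> lholds e \<phi> \<longleftrightarrow> lholds e' \<phi>"
proof (induction \<phi> arbitrary: e e' rule: fm.induct[where ?P1.0 = "\<lambda>_. True"])
  case (Less s t)
  have sum: "tcode s + tcode t + 1 \<le> code (Less s t)"
    using add_le_pr[of "tcode s" "tcode t"] add_le_pr[of 7 "pr (tcode s) (tcode t)"] by simp
  obtain c c0 d d0 where c: "form (locs n) (tcode s) c c0" "\<And>e. ltval e s = lin (locs n) c c0 e"
    and d: "form (locs n) (tcode t) d d0" "\<And>e. ltval e t = lin (locs n) d d0 e"
    using ltval_lin[of s n] ltval_lin[of t n] Less.prems(1,2) sum by auto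
  \<comment> \<open>Over the integers \<open>s < t\<close> means \<open>0 \<le> t - s - 1\<close>;
    the \<open>+ 1\<close> in \<open>sum\<close> makes room for the constant.\<close>
  have "form (locs n) (code (Less s t)) (\<lambda>j. d j - c j) (d0 - c0 + - 1)"
    using c(1) d(1) sum unfolding form_def by (force simp del: code.simps)
  then have "form (locs n) ((next_lvl ^^ code (Less s t)) n) (\<lambda>j. d j - c j) (d0 - c0 + - 1)"
    by (rule form_mono) (use Less.prems(2) le_funpow_next_lvl order_trans in blast)
  from eqvD[OF Less.prems(3) this] show ?case
    unfolding lin_const lin_diff c(2)[symmetric] d(2)[symmetric] by auto
next
  case (Equal s t)
  have sum: "tcode s + tcode t + 1 \<le> code (Equal s t)"
    using add_le_pr[of "tcode s" "tcode t"] add_le_pr[of 8 "pr (tcode s) (tcode t)"] by simp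
  obtain c c0 d d0 where c: "form (locs n) (tcode s) c c0" "\<And>e. ltval e s = lin (locs n) c c0 e"
    and d: "form (locs n) (tcode t) d d0" "\<And>e. ltval e t = lin (locs n) d d0 e"
    using ltval_lin[of s n] ltval_lin[of t n] Equal.prems(1,2) sum by auto
  have "form (locs n) (code (Equal s t)) (\<lambda>j. d j - c j) (d0 - c0)"
    using c(1) d(1) sum unfolding form_def by (force simp del: code.simps)
  then have "form (locs n) ((next_lvl ^^ code (Equal s t)) n) (\<lambda>j. d j - c j) (d0 - c0)"
    by (rule form_mono) (use Equal.prems(2) le_funpow_next_lvl order_trans in blast)
  from eqv_lin_eq_0[OF Equal.prems(3) this] eqv_lin_eq_0[OF eqv_sym[OF Equal.prems(3)] this]
  show ?case unfolding lin_const lin_diff c(2)[symmetric] d(2)[symmetric] by auto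
next
  case (Congr m s t)
  have sum: "tcode s + tcode t + 1 \<le> code (Congr m s t)"
    using add_le_pr[of "tcode s" "tcode t"] add_le_pr[of m "pr (tcode s) (tcode t)"]
      add_le_pr[of 9 "pr m (pr (tcode s) (tcode t))"] by simp
  obtain c c0 d d0 where c: "form (locs n) (tcode s) c c0" "\<And>e. ltval e s = lin (locs n) c c0 e"
    and d: "form (locs n) (tcode t) d d0" "\<And>e. ltval e t = lin (locs n) d d0 e"
    using ltval_lin[of s n] ltval_lin[of t n] Congr.prems(1,2) sum by auto
  have lev: "code (Congr m s t) \<le> (next_lvl ^^ code (Congr m s t)) n"
    using Congr.prems(2) le_funpow_next_lvl order_trans by blast
  show ?case
  proof (cases "m = 0")
    case True
    have "form (locs n) (code (Congr m s t)) (\<lambda>j. d j - c j) (d0 - c0)"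
      using c(1) d(1) sum unfolding form_def by (force simp del: code.simps)
    then have "form (locs n) ((next_lvl ^^ code (Congr m s t)) n) (\<lambda>j. d j - c j) (d0 - c0)"
      by (rule form_mono[OF _ lev])
    from eqv_lin_eq_0[OF Congr.prems(3) this] eqv_lin_eq_0[OF eqv_sym[OF Congr.prems(3)] this]
    show ?thesis unfolding lin_const lin_diff c(2)[symmetric] d(2)[symmetric] using True by auto
  next
    case False
    have "m \<le> (next_lvl ^^ code (Congr m s t)) n" using code_le(7) lev order_trans by blast
    then have "m dvd fact ((next_lvl ^^ code (Congr m s t)) n)" using False by (intro dvd_fact) auto
    then have "int m dvd int (fact ((next_lvl ^^ code (Congr m s t)) n))" by (rule of_nat_dvd_iff[THEN iffD2])
    then have "int m dvd fact ((next_lvl ^^ code (Congr m s t)) n)" by (simp del: code.simps)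
    note eqv_lin_mod[OF Congr.prems(3) this]
    then have "[ltval e s = ltval e' s] (mod int m)" "[ltval e t = ltval e' t] (mod int m)"
      unfolding c(2) d(2) by blast+
    then show ?thesis by (simp add: cong_def)
  qed
next
  case (Conj \<phi> \<psi>)
  have "lholds e \<phi> = lholds e' \<phi>"
    by (rule Conj.IH(1)) (use Conj.prems code_le(8)[of \<phi> \<psi>] in \<open>auto intro: eqv_mono funpow_next_lvl_mono simp del: code.simps\<close>)
  moreover have "lholds e \<psi> = lholds e' \<psi>"
    by (rule Conj.IH(2)) (use Conj.prems code_le(9)[of \<psi> \<phi>] in \<open>auto intro: eqv_mono funpow_next_lvl_mono simp del: code.simps\<close>)
  ultimately show ?case by simp
next
  case (Neg \<phi>)
  have "lholds e \<phi> = lholds e' \<phi>"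
    by (rule Neg.IH) (use Neg.prems code_le(10)[of \<phi>] in \<open>auto intro: eqv_mono funpow_next_lvl_mono simp del: code.simps\<close>)
  then show ?case by simp
next
  case (Exi x \<phi>)
  have x: "LV x \<in> locs n" "code \<phi> \<le> n" using Exi.prems(2) code_le(11)[of \<phi> x] code_le(12)[of x \<phi>]
    by (auto intro: order_trans)
  have step: "lholds e (Exi x \<phi>) \<Longrightarrow> lholds e' (Exi x \<phi>)"
    if "eqv (locs n) ((next_lvl ^^ code (Exi x \<phi>)) n) e e'" for e e'
  proof -
    have "(next_lvl ^^ Suc (code \<phi>)) n \<le> (next_lvl ^^ code (Exi x \<phi>)) n"
      using code_Exi_less[of \<phi> x] by (intro funpow_next_lvl_mono) simp
    then have e: "eqv (locs n) (next_lvl ((next_lvl ^^ code \<phi>) n)) e e'"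
      using eqv_mono[OF that] by simp
    obtain B where B: "\<And>j. j \<in> locs n \<Longrightarrow> \<bar>e' j\<bar> \<le> int B"
    proof
      fix j assume "j \<in> locs n"
      then have "\<bar>e' j\<bar> \<le> (\<Sum>j\<in>locs n. \<bar>e' j\<bar>)" by (intro member_le_sum) auto
      then show "\<bar>e' j\<bar> \<le> int (nat (\<Sum>j\<in>locs n. \<bar>e' j\<bar>))" by simp
    qed
    assume "lholds e (Exi x \<phi>)"
    then obtain k where k: "lholds (e(LV x := k)) \<phi>" by auto
    obtain k' where "eqv (locs n) ((next_lvl ^^ code \<phi>) n) (e(LV x := k)) (e'(LV x := k'))"
      using eqv_extend[OF finite_locs x(1) e B] by blast
    then show ?thesis using k Exi.IH x Exi.prems(1) by auto
  qed
  show ?case using step[OF Exi.prems(3)] step[OF eqv_sym[OF Exi.prems(3)]] by blast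
qed auto


section \<open>Evaluation with bounded quantifiers\<close>

text \<open>The range of a quantifier depends on the code of its body. Since codes shrink towards the
  leaves, antitone bounds \<open>r\<close> leave room for the witnesses of inner quantifiers.\<close>

primrec tbev :: "(nat \<Rightarrow> nat) \<Rightarrow> (nat \<Rightarrow> int) \<Rightarrow> (nat \<Rightarrow> int \<Rightarrow> int) \<Rightarrow> (nat \<Rightarrow> int) \<Rightarrow> trm \<Rightarrow> int"
  and bev :: "(nat \<Rightarrow> nat) \<Rightarrow> (nat \<Rightarrow> int) \<Rightarrow> (nat \<Rightarrow> int \<Rightarrow> int) \<Rightarrow> (nat \<Rightarrow> int) \<Rightarrow> fm \<Rightarrow> bool" where
  "tbev r p A v (Num n) = n"
| "tbev r p A v (Par c) = p c"
| "tbev r p A v (Var x) = v x"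
| "tbev r p A v (Add s t) = tbev r p A v s + tbev r p A v t"
| "tbev r p A v (Minus t) = - tbev r p A v t"
| "tbev r p A v (App a t) = A a (tbev r p A v t)"
| "tbev r p A v (Card x \<phi>) = int (card {k \<in> {0..<p parN}. bev r p A (v(x := k)) \<phi>})"
| "bev r p A v (Less s t) \<longleftrightarrow> tbev r p A v s < tbev r p A v t"
| "bev r p A v (Equal s t) \<longleftrightarrow> tbev r p A v s = tbev r p A v t"
| "bev r p A v (Congr n s t) \<longleftrightarrow> [tbev r p A v s = tbev r p A v t] (mod int n)"
| "bev r p A v (Conj \<phi> \<psi>) \<longleftrightarrow> bev r p A v \<phi> \<and> bev r p A v \<psi>"
| "bev r p A v (Neg \<phi>) \<longleftrightarrow> \<not> bev r p A v \<phi>"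
| "bev r p A v (Exi x \<phi>) \<longleftrightarrow> (\<exists>k. int_encode k \<le> r (code \<phi>) \<and> bev r p A (v(x := k)) \<phi>)"

definition bas_lvl :: "nat \<Rightarrow> nat" where "bas_lvl n = (next_lvl ^^ n) n"

text \<open>Starts from \<open>b\<close> at code \<open>n\<close> and makes room for one more
  witness with each unit by which the code drops. The dimension is \<open>card (locs n)\<close>
  written out as a polynomial, which makes computability evident.\<close>

definition qbound :: "nat \<Rightarrow> nat \<Rightarrow> nat \<Rightarrow> nat" where
  "qbound n b q = ((\<lambda>r. r + wit_bound (bas_lvl n) (2 * Suc n + Suc n * Suc n) r) ^^ (n - q)) b"

lemma funpow_add_mono: "a \<le> b \<Longrightarrow> ((\<lambda>r. r + f r) ^^ a) x \<le> ((\<lambda>r. r + f r) ^^ b) (x :: nat)"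
  by (induction rule: dec_induct) (auto intro: trans_le_add1)

lemma qbound_antimono: "q \<le> q' \<Longrightarrow> qbound n b q' \<le> qbound n b q"
  unfolding qbound_def by (rule funpow_add_mono) simp

lemma qbound_ge: "b \<le> qbound n b q"
  unfolding qbound_def by (rule funpow_add_ge)

lemma qbound_step: "q < q' \<Longrightarrow> q' \<le> n \<Longrightarrow> wit_bound (bas_lvl n) (card (locs n)) (qbound n b q') \<le> qbound n b q"
proof -
  assume q: "q < q'" "q' \<le> n"
  let ?f = "\<lambda>r. r + wit_bound (bas_lvl n) (2 * Suc n + Suc n * Suc n) r"
  have "(?f ^^ Suc (n - q')) b \<le> (?f ^^ (n - q)) b"
    using q by (intro funpow_add_mono) linarith
  then show ?thesis unfolding qbound_def card_locs by simp
qed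

definition bounded :: "nat \<Rightarrow> (nat \<Rightarrow> int) \<Rightarrow> (nat \<Rightarrow> int \<Rightarrow> int) \<Rightarrow> (nat \<Rightarrow> int) \<Rightarrow> bool" where
  "bounded b p A v \<longleftrightarrow> (\<forall>c. \<bar>p c\<bar> \<le> int b) \<and> (\<forall>a k. \<bar>A a k\<bar> \<le> int b) \<and> (\<forall>y. \<bar>v y\<bar> \<le> int b)"

lemma bounded_mono:
  assumes "bounded b p A v" "b \<le> b'" shows "bounded b' p A v"
proof -
  have "\<bar>k\<bar> \<le> int b \<Longrightarrow> \<bar>k\<bar> \<le> int b'" for k using assms(2) by linarith
  then show ?thesis using assms(1) unfolding bounded_def by blast
qed

lemma bounded_upd: "bounded b p A v \<Longrightarrow> \<bar>k\<bar> \<le> int b \<Longrightarrow> bounded b p A (v(x := k))"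
  by (auto simp: bounded_def)

text \<open>Back-and-forth is applied to a valuation and itself: a witness of any size is answered
  by a bounded one over the same values, and equivalence makes it a witness too.\<close>

lemma bev_holds:
  "tbas_shape t \<Longrightarrow> tbev r p A v t = tval p A v t"
  "bas_shape \<phi> \<Longrightarrow> code \<phi> \<le> n \<Longrightarrow> r = (\<lambda>q. 2 * qbound n b q) \<Longrightarrow> bounded (qbound n b (code \<phi>)) p A v \<Longrightarrow>
    bev r p A v \<phi> \<longleftrightarrow> holds p A v \<phi>"
proof (induction t and \<phi> arbitrary: v and v)
  case (App a t)
  then show ?case by auto
next
  case (Conj \<phi> \<psi>)
  have "bev r p A v \<phi> = holds p A v \<phi>"
    by (rule Conj.IH(1)) (use Conj.prems code_le(8)[of \<phi> \<psi>] qbound_antimono[OF code_le(8)] in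
        \<open>auto intro: bounded_mono simp del: code.simps\<close>)
  moreover have "bev r p A v \<psi> = holds p A v \<psi>"
    by (rule Conj.IH(2)) (use Conj.prems code_le(9)[of \<psi> \<phi>] qbound_antimono[OF code_le(9)] in
        \<open>auto intro: bounded_mono simp del: code.simps\<close>)
  ultimately show ?case by simp
next
  case (Neg \<phi>)
  have "bev r p A v \<phi> = holds p A v \<phi>"
    by (rule Neg.IH) (use Neg.prems code_le(10)[of \<phi>] qbound_antimono[OF code_le(10)] in
        \<open>auto intro: bounded_mono simp del: code.simps\<close>)
  then show ?case by simp
next
  case (Exi x \<phi>)
  have x: "LV x \<in> locs n" "code \<phi> \<le> n" "bas_shape \<phi>" "x \<notin> array_vars \<phi>"
    using Exi.prems(1,2) code_le(11)[of \<phi> x] code_le(12)[of x \<phi>] by (auto intro: order_trans)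
  let ?b = "qbound n b (code (Exi x \<phi>))"
  have b: "?b \<le> qbound n b (code \<phi>)" by (rule qbound_antimono[OF code_le(11)])
  have IH: "bev r p A (v(x := k)) \<phi> \<longleftrightarrow> holds p A (v(x := k)) \<phi>" if "\<bar>k\<bar> \<le> int (qbound n b (code \<phi>))" for k
    by (rule Exi.IH[OF x(3,2) Exi.prems(3)]) (rule bounded_upd[OF bounded_mono[OF Exi.prems(4) b] that])
  define e where "e = case_loc p v (\<lambda>a y. A a (v y))"
  have lh: "lholds (e(LV x := k)) \<phi> \<longleftrightarrow> holds p A (v(x := k)) \<phi>" for k
    by (rule lholds_holds(2)[OF x(3,2)]) (use x(4) in \<open>auto simp: e_def\<close>)
  have "\<exists>k'. \<bar>k'\<bar> \<le> int (qbound n b (code \<phi>)) \<and> holds p A (v(x := k')) \<phi>" if k: "holds p A (v(x := k)) \<phi>" for k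
  proof -
    have eb: "\<bar>e j\<bar> \<le> int ?b" for j
      using Exi.prems(4) by (cases j) (auto simp: bounded_def e_def simp del: code.simps)
    obtain k' where k': "\<bar>k'\<bar> \<le> int (wit_bound (bas_lvl n) (card (locs n)) ?b)"
      "eqv (locs n) (bas_lvl n) (e(LV x := k)) (e(LV x := k'))"
      by (rule eqv_extend[OF finite_locs x(1) eqv_refl eb])
    have "eqv (locs n) ((next_lvl ^^ code \<phi>) n) (e(LV x := k)) (e(LV x := k'))"
      using k'(2) unfolding bas_lvl_def by (rule eqv_mono) (rule funpow_next_lvl_mono[OF x(2)])
    from lholds_eqv[OF x(3,2) this] have "holds p A (v(x := k')) \<phi>" using k by (simp only: lh)
    moreover have "\<bar>k'\<bar> \<le> int (qbound n b (code \<phi>))"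
      using k'(1) qbound_step[OF code_Exi_less Exi.prems(2), of b] by linarith
    ultimately show ?thesis by blast
  qed
  then show ?case using IH Exi.prems(3) by (auto simp: int_encode_le)
qed auto

text \<open>Matching happens twice: \<open>small_coloured\<close> replaces coordinates and
  colouring, then each new point receives an old partner of its colour and a copy of the partner's
  column of array values. The columns alone define \<open>A'\<close>, and the reads in
  \<open>e'\<close> at \<open>y \<noteq> x\<close> are then shown to agree with it. Reads at
  \<open>x\<close> are treated apart: \<open>x\<close> does not occur in \<open>\<alpha>\<close>,
  and in the \<open>\<beta> j\<close> it denotes the counted point.\<close>

lemma small_model:
  fixes zs :: "nat list" and \<beta>s :: "fm list"
  assumes n: "0 < n" and bas_shape: "bas_shape \<alpha>" "\<And>j. j < K \<Longrightarrow> bas_shape (\<beta> j)"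
    and le: "code \<alpha> \<le> n" "\<And>j. j < K \<Longrightarrow> code (\<beta> j) \<le> n" "\<And>j. j < K \<Longrightarrow> z j \<le> n" "K \<le> n" "x \<le> n"
    and x: "x \<notin> vars \<alpha>"
    and A: "\<And>a k. k \<notin> {0..<p parN} \<Longrightarrow> A a k = 0"
    and \<alpha>: "holds p A v \<alpha>"
    and \<beta>: "\<And>j. j < K \<Longrightarrow> v (z j) = int (card {k \<in> {0..<p parN}. holds p A (v(x := k)) (\<beta> j)})"
  shows "\<exists>p' A' v'. bounded (wits_bound (bas_lvl n) (card (locs n)) (Suc n) (col_bound ((next_lvl ^^ Suc n) (bas_lvl n)) (card (locs n)) (2 ^ n))) p' A' v' \<and>
    (\<forall>i>n. p' i = 0 \<and> v' i = 0 \<and> (\<forall>k. A' i k = 0)) \<and> (\<forall>a k. k \<notin> {0..<p' parN} \<longrightarrow> A' a k = 0) \<and>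
    holds p' A' v' \<alpha> \<and>
    (\<forall>j<K. v' (z j) = int (card {k \<in> {0..<p' parN}. holds p' A' (v'(x := k)) (\<beta> j)}))"
proof -
  let ?I = "locs n" and ?M1 = "(next_lvl ^^ Suc n) (bas_lvl n)"
  let ?B1 = "col_bound ?M1 (card ?I) (2 ^ n)"
  let ?model_bound = "wits_bound (bas_lvl n) (card ?I) (Suc n) ?B1"
  define e where "e = case_loc p v (\<lambda>a y. A a (v y))"
  define \<chi> where "\<chi> k = {j. j < K \<and> holds p A (v(x := k)) (\<beta> j)}" for k
  have eP [simp]: "e (LP c) = p c" and eV [simp]: "e (LV y) = v y" and eW [simp]: "e (LW a y) = A a (v y)"
    for c y a by (auto simp: e_def)
  have C: "finite (Pow {..<n})" "card (Pow {..<n}) = 2 ^ n" by (auto simp: card_Pow)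
  have \<chi>C: "\<chi> k \<in> Pow {..<n}" for k using le(4) by (auto simp: \<chi>_def)
  have I: "LV x \<in> ?I" "LP parN \<in> ?I" "LV x \<noteq> LP parN" using le(5) by (auto simp: parN_def)
  obtain e' \<chi>' where e': "\<And>j. \<bar>e' j\<bar> \<le> int ?B1" "eqv ?I ?M1 e e'"
    and match: "\<And>k'. 0 \<le> k' \<Longrightarrow> k' < e' (LP parN) \<Longrightarrow>
      \<exists>k. 0 \<le> k \<and> k < e (LP parN) \<and> \<chi> k = \<chi>' k' \<and> eqv ?I ?M1 (e(LV x := k)) (e'(LV x := k'))"
    and cnt: "\<And>S j. S \<subseteq> Pow {..<n} \<Longrightarrow> j \<in> ?I \<Longrightarrow> e j = int (card {k \<in> {0..<e (LP parN)}. \<chi> k \<in> S}) \<Longrightarrow>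
      e' j = int (card {k \<in> {0..<e' (LP parN)}. \<chi>' k \<in> S})"
  proof (rule small_coloured[where M = ?M1 and e = e and \<chi> = \<chi>, OF finite_locs I C(1) \<chi>C, unfolded C(2)],
      goal_cases)
    case (1 e' \<chi>')
    show ?case by (rule 1(1)[of e' \<chi>']) (rule 1; assumption)+
  qed
  \<comment> \<open>The column at the counted point, one coordinate for each of \<open>Suc n\<close>
    arrays; this is why \<open>?M1\<close> lies \<open>Suc n\<close> levels above
    \<open>bas_lvl n\<close>.\<close>
  let ?J = "(\<lambda>a. LW a x) ` {..n}"
  have J: "?J \<subseteq> ?I" "card ?J = Suc n" using le(5) by (auto simp: card_image inj_on_def)
  have inJ [simp]: "LV y \<notin> ?J" "LP c \<notin> ?J" "LW a y \<in> ?J \<longleftrightarrow> a \<le> n \<and> y = x" for a y c by auto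
  have nlvl: "n \<le> bas_lvl n" unfolding bas_lvl_def by (rule le_funpow_next_lvl)
  have M1: "bas_lvl n \<le> ?M1" using funpow_next_lvl_mono[of 0 "Suc n" "bas_lvl n"] by simp
  have B01: "int ?B1 \<le> int ?model_bound" using wits_bound_ge by (rule of_nat_mono)
  \<comment> \<open>each \<open>k'\<close> is paired with some \<open>k\<close> of its colour, whose column of array values is matched by back-and-forth\<close>
  define Q where "Q k' k w \<longleftrightarrow> 0 \<le> k \<and> k < p parN \<and> \<chi> k = \<chi>' k' \<and> (\<forall>l. \<bar>w l\<bar> \<le> int ?model_bound) \<and>
      eqv ?I (bas_lvl n) (\<lambda>l. if l \<in> ?J then (case l of LW a _ \<Rightarrow> A a k | _ \<Rightarrow> 0) else (e(LV x := k)) l)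
        (\<lambda>l. if l \<in> ?J then w l else (e'(LV x := k')) l)" for k' k w
  have Q: "\<exists>k w. Q k' k w" if k': "0 \<le> k'" "k' < e' (LP parN)" for k'
  proof -
    obtain k where k: "0 \<le> k" "k < p parN" "\<chi> k = \<chi>' k'" "eqv ?I ?M1 (e(LV x := k)) (e'(LV x := k'))"
      using match[OF k'] by auto
    have "\<bar>(e'(LV x := k')) j\<bar> \<le> int ?B1" for j
      using e'(1)[of j] e'(1)[of "LP parN"] k' by auto
    from eqv_extend_many[OF finite_locs J(1), unfolded J(2), OF k(4) this,
        of "\<lambda>l. case l of LW a _ \<Rightarrow> A a k | _ \<Rightarrow> 0"]
    obtain w where "\<forall>l. \<bar>w l\<bar> \<le> int ?model_bound"
      "eqv ?I (bas_lvl n) (\<lambda>l. if l \<in> ?J then (case l of LW a _ \<Rightarrow> A a k | _ \<Rightarrow> 0) else (e(LV x := k)) l)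
        (\<lambda>l. if l \<in> ?J then w l else (e'(LV x := k')) l)" by (elim exE conjE)
    then have "Q k' k w" unfolding Q_def using k(1-3) by (intro conjI)
    then show ?thesis by (intro exI)
  qed
  define kk where "kk k' = (SOME k. \<exists>w. Q k' k w)" for k'
  define ww where "ww k' = (SOME w. Q k' (kk k') w)" for k'
  have Qkw: "Q k' (kk k') (ww k')" if "0 \<le> k'" "k' < e' (LP parN)" for k'
  proof -
    have "\<exists>w. Q k' (kk k') w" unfolding kk_def by (rule someI_ex[OF Q[OF that]])
    then show ?thesis unfolding ww_def by (rule someI_ex)
  qed
  have kw: "0 \<le> kk k'" "kk k' < p parN" "\<chi> (kk k') = \<chi>' k'" "\<forall>l. \<bar>ww k' l\<bar> \<le> int ?model_bound"
    if "0 \<le> k'" "k' < e' (LP parN)" for k'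
    using Qkw[OF that] unfolding Q_def by blast+
  define f where "f k' = (\<lambda>l. if l \<in> ?J then (case l of LW a _ \<Rightarrow> A a (kk k') | _ \<Rightarrow> 0) else (e(LV x := kk k')) l)" for k'
  define f' where "f' k' = (\<lambda>l. if l \<in> ?J then ww k' l else (e'(LV x := k')) l)" for k'
  have ff: "eqv ?I (bas_lvl n) (f k') (f' k')" if "0 \<le> k'" "k' < e' (LP parN)" for k'
    using Qkw[OF that] unfolding Q_def f_def f'_def by (elim conjE)
  define p' where "p' c = (if c \<le> n then e' (LP c) else 0)" for c
  define v' where "v' y = (if y \<le> n then e' (LV y) else 0)" for y
  define A' where "A' a k = (if 0 \<le> k \<and> k < e' (LP parN) \<and> a \<le> n then ww k (LW a x) else 0)" for a k
  have pN: "p' parN = e' (LP parN)" by (simp add: p'_def parN_def)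
  have ee: "eqv ?I (bas_lvl n) e e'" using e'(2) M1 by (rule eqv_mono)
  have diff: "lin ?I (\<lambda>j. of_bool (j = l) - of_bool (j = l')) 0 g = g l - g l'"
    if "l \<in> ?I" "l' \<in> ?I" for l l' and g :: "loc \<Rightarrow> int"
    using lin_diff[of ?I "\<lambda>j. of_bool (j = l)" "\<lambda>j. of_bool (j = l')" 0 0 g] lin_single[of ?I _ g] that
    by (simp add: of_bool_def)
  have diff_form: "form ?I (bas_lvl n) (\<lambda>j. of_bool (j = l) - of_bool (j = l')) 0" for l l' :: loc
    using n nlvl by (auto simp: form_def)
  have eq_transfer: "g' l = g' l'" if "eqv ?I (bas_lvl n) g g'" "g l = g l'" "l \<in> ?I" "l' \<in> ?I" for g g' l l'
    using eqv_lin_eq_0[OF that(1) diff_form, of l l'] that(2) by (simp add: diff[OF that(3,4)])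
  have le_transfer: "g l' \<le> g l \<longleftrightarrow> g' l' \<le> g' l" if "eqv ?I (bas_lvl n) g g'" "l \<in> ?I" "l' \<in> ?I" for g g' l l'
    using eqvD[OF that(1) diff_form, of l l'] by (simp add: diff[OF that(2,3)])
  have zero_transfer: "g' l = 0" if "eqv ?I (bas_lvl n) g g'" "g l = 0" "l \<in> ?I" for g g' l
  proof -
    have "form ?I (bas_lvl n) (\<lambda>j. if j = l then 1 else 0) 0" using n nlvl by (auto simp: form_def)
    from eqv_lin_eq_0[OF that(1) this] show ?thesis using that(2,3) by (simp add: lin_single)
  qed
  have nonneg_transfer: "0 \<le> g l \<longleftrightarrow> 0 \<le> g' l" if "eqv ?I (bas_lvl n) g g'" "l \<in> ?I" for g g' l
  proof -
    have "form ?I (bas_lvl n) (\<lambda>j. if j = l then 1 else 0) 0" using n nlvl by (auto simp: form_def)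
    from eqvD[OF that(1) this] show ?thesis using that(2) by (simp add: lin_single)
  qed
  \<comment> \<open>If \<open>k' = v' y\<close> lies in the new interval, \<open>LV x\<close> and
    \<open>LV y\<close> agree in \<open>f' k'\<close>, hence also in \<open>f k'\<close>, so the
    partner of \<open>k'\<close> is \<open>v y\<close>. There the column entry \<open>LW a x\<close>
    equals the read \<open>LW a y\<close>, and this equation passes back to
    \<open>f' k'\<close>.\<close>
  have W: "e' (LW a y) = A' a (v' y)" if a: "a \<le> n" and y: "y \<le> n" "y \<noteq> x" for a y
  proof (cases "0 \<le> v' y \<and> v' y < e' (LP parN)")
    case True
    define k' where "k' = v' y"
    have k': "0 \<le> k'" "k' < e' (LP parN)" using True by (auto simp: k'_def)
    have "f' k' (LV x) = f' k' (LV y)" using y by (auto simp: f'_def k'_def v'_def)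
    then have "f k' (LV x) = f k' (LV y)"
      by (rule eq_transfer[OF eqv_sym[OF ff[OF k']]]) (use le(5) y in simp_all)
    then have "kk k' = v y" using y by (auto simp: f_def)
    then have "f k' (LW a x) = f k' (LW a y)" using a y by (auto simp: f_def)
    then have "f' k' (LW a x) = f' k' (LW a y)"
      by (rule eq_transfer[OF ff[OF k']]) (use a y le(5) in simp_all)
    then have "ww k' (LW a x) = e' (LW a y)" using a y by (auto simp: f'_def)
    then show ?thesis using a k' by (simp add: A'_def k'_def[symmetric])
  next
    case False
    \<comment> \<open>Lying outside the interval is a linear condition and goes back to
      \<open>e\<close>, where the array convention forces the value 0; being 0 is preserved in
      turn.\<close>
    then have "\<not> (0 \<le> e (LV y) \<and> \<not> e (LP parN) \<le> e (LV y))"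
      using nonneg_transfer[OF ee, of "LV y"] le_transfer[OF ee, of "LV y" "LP parN"] y I
      by (auto simp: v'_def)
    then have "e (LW a y) = 0" using A[of "v y" a] by auto
    then have "e' (LW a y) = 0" by (rule zero_transfer[OF ee]) (use a y in simp)
    then show ?thesis using False by (auto simp: A'_def)
  qed
  have "lholds e \<alpha> = lholds e' \<alpha>"
    by (rule lholds_eqv[OF bas_shape(1) le(1) eqv_mono[OF ee[unfolded bas_lvl_def] funpow_next_lvl_mono[OF le(1)]]])
  moreover have "lholds e \<alpha> = holds p A v \<alpha>"
    by (rule lholds_holds(2)[OF bas_shape(1) le(1)]) auto
  moreover have "lholds e' \<alpha> = holds p' A' v' \<alpha>"
  proof (rule lholds_holds(2)[OF bas_shape(1) le(1)])
    fix a y assume "a \<le> n" "y \<le> n" "y \<in> array_vars \<alpha>"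
    moreover have "array_vars \<alpha> \<subseteq> vars \<alpha>" by (rule array_vars_subset_vars)
    ultimately show "e' (LW a y) = A' a (v' y)" using W x by blast
  qed (auto simp: p'_def v'_def)
  ultimately have \<alpha>': "holds p' A' v' \<alpha>" using \<alpha> by simp
  have \<chi>': "j \<in> \<chi>' k' \<longleftrightarrow> holds p' A' (v'(x := k')) (\<beta> j)" if k': "0 \<le> k'" "k' < e' (LP parN)" and j: "j < K" for j k'
  proof -
    have "lholds (f k') (\<beta> j) = lholds (f' k') (\<beta> j)"
      by (rule lholds_eqv[OF bas_shape(2)[OF j] le(2)[OF j]
          eqv_mono[OF ff[OF k', unfolded bas_lvl_def] funpow_next_lvl_mono[OF le(2)[OF j]]]])
    moreover have "lholds (f k') (\<beta> j) = holds p A (v(x := kk k')) (\<beta> j)"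
      by (rule lholds_holds(2)[OF bas_shape(2)[OF j] le(2)[OF j]]) (auto simp: f_def)
    moreover have "lholds (f' k') (\<beta> j) = holds p' A' (v'(x := k')) (\<beta> j)"
    proof (rule lholds_holds(2)[OF bas_shape(2)[OF j] le(2)[OF j]])
      fix a y assume "a \<le> n" "y \<le> n"
      then show "f' k' (LW a y) = A' a ((v'(x := k')) y)"
        using W[of a y] k' by (auto simp: f'_def A'_def)
    qed (auto simp: f'_def p'_def v'_def)
    moreover have "\<chi> (kk k') = \<chi>' k'" by (rule kw(3)[OF k'])
    ultimately show ?thesis using j by (auto simp: \<chi>_def)
  qed
  have \<chi>'C: "\<chi>' k' \<in> Pow {..<n}" if "0 \<le> k'" "k' < e' (LP parN)" for k'
    unfolding kw(3)[OF that, symmetric] by (rule \<chi>C)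
  have "v' (z j) = int (card {k \<in> {0..<p' parN}. holds p' A' (v'(x := k)) (\<beta> j)})" if j: "j < K" for j
  proof -
    \<comment> \<open>A colour is the set of indices of the formulae that hold at the point, so the
      \<open>j\<close>-th equation counts the points with colour in \<open>?S\<close>.\<close>
    let ?S = "{s \<in> Pow {..<n}. j \<in> s}"
    have "{k \<in> {0..<e (LP parN)}. \<chi> k \<in> ?S} = {k \<in> {0..<p parN}. holds p A (v(x := k)) (\<beta> j)}"
      using j \<chi>C by (auto simp: \<chi>_def)
    then have "e' (LV (z j)) = int (card {k \<in> {0..<e' (LP parN)}. \<chi>' k \<in> ?S})"
      using cnt[of ?S "LV (z j)"] \<beta>[OF j] le(3)[OF j] by auto
    moreover have "{k \<in> {0..<e' (LP parN)}. \<chi>' k \<in> ?S} = {k \<in> {0..<p' parN}. holds p' A' (v'(x := k)) (\<beta> j)}"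
      unfolding pN using \<chi>' j \<chi>'C by auto
    ultimately show ?thesis using le(3)[OF j] by (simp add: v'_def)
  qed
  moreover have "bounded ?model_bound p' A' v'"
    unfolding bounded_def p'_def v'_def A'_def using order_trans[OF e'(1) B01] kw by auto
  ultimately show ?thesis using \<alpha>'
    by (intro exI[of _ p'] exI[of _ A'] exI[of _ v']) (auto simp: pN A'_def, auto simp: p'_def v'_def)
qed

section \<open>Bounded satisfiability\<close>

definition model_bound :: "nat \<Rightarrow> nat" where
  "model_bound n = wits_bound (bas_lvl n) (2 * Suc n + Suc n * Suc n) (Suc n)
     (col_bound ((next_lvl ^^ Suc n) (bas_lvl n)) (2 * Suc n + Suc n * Suc n) (2 ^ n))"

text \<open>Absolute value at most \<open>R\<close> corresponds to \<open>int_encode\<close> at most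
  \<open>2 * R\<close>, hence the factor 2.\<close>

definition code_bound :: "nat \<Rightarrow> nat \<Rightarrow> nat" where "code_bound n q = 2 * qbound n (model_bound n) q"

lemma holds_foldl_Conj:
  "holds p A v (foldl Conj \<alpha> \<psi>s) \<longleftrightarrow> holds p A v \<alpha> \<and> (\<forall>\<psi>\<in>set \<psi>s. holds p A v \<psi>)"
  by (induction \<psi>s arbitrary: \<alpha>) auto

lemma bev_foldl_Conj:
  "bev r p A v (foldl Conj \<alpha> \<psi>s) \<longleftrightarrow> bev r p A v \<alpha> \<and> (\<forall>\<psi>\<in>set \<psi>s. bev r p A v \<psi>)"
  by (induction \<psi>s arbitrary: \<alpha>) auto

lemma code_foldl_Conj: "\<psi> \<in> set (\<alpha> # \<psi>s) \<Longrightarrow> code \<psi> \<le> code (foldl Conj \<alpha> \<psi>s)"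
proof (induction \<psi>s arbitrary: \<alpha> \<psi>)
  case (Cons \<theta> \<psi>s)
  have *: "code (Conj \<alpha> \<theta>) \<le> code (foldl Conj \<alpha> (\<theta> # \<psi>s))"
    using Cons.IH[of "Conj \<alpha> \<theta>" "Conj \<alpha> \<theta>"] by simp
  consider "\<psi> = \<alpha>" | "\<psi> = \<theta>" | "\<psi> \<in> set \<psi>s" using Cons.prems by auto
  then show ?case
  proof cases
    case 1
    then show ?thesis using * code_le(8)[of \<alpha> \<theta>] order_trans by blast
  next
    case 2
    then show ?thesis using * code_le(9)[of \<theta> \<alpha>] order_trans by blast
  next
    case 3
    then show ?thesis using Cons.IH[of \<psi> "Conj \<alpha> \<theta>"] by simp
  qed
qed simp

lemma code_foldr_Exi: "code \<chi> + length zs \<le> code (foldr Exi zs \<chi>)" "z \<in> set zs \<Longrightarrow> z \<le> code (foldr Exi zs \<chi>)"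
proof (induction zs)
  case (Cons y zs)
  { case 1 then show ?case using Cons.IH(1) code_Exi_less[of "foldr Exi zs \<chi>" y] by (simp del: code.simps) }
  { case 2 then show ?case using Cons.IH(2) code_le(11)[of "foldr Exi zs \<chi>" y] code_le(12)[of y "foldr Exi zs \<chi>"]
      by (auto simp del: code.simps intro: order_trans) }
qed simp_all

lemma holds_foldr_Exi: "holds p A v (foldr Exi zs \<chi>) \<Longrightarrow> \<exists>v'. holds p A v' \<chi>"
  by (induction zs arbitrary: v) auto

lemma holds_foldr_ExiI: "holds p A v \<chi> \<Longrightarrow> holds p A v (foldr Exi zs \<chi>)"
proof (induction zs)
  case (Cons z zs)
  then have "holds p A (v(z := v z)) (foldr Exi zs \<chi>)" by simp
  then show ?case by (auto simp del: fun_upd_triv)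
qed simp

text \<open>The bounds grow towards the matrix, so the values picked by the prefix still obey the
  bound under which the matrix is evaluated correctly.\<close>

lemma bev_foldr_Exi:
  assumes "bounded (qbound n (model_bound n) (code (foldr Exi zs \<chi>))) p A v" "bev (code_bound n) p A v (foldr Exi zs \<chi>)"
  shows "\<exists>v'. bounded (qbound n (model_bound n) (code \<chi>)) p A v' \<and> bev (code_bound n) p A v' \<chi>"
  using assms
proof (induction zs arbitrary: v)
  case (Cons z zs)
  then obtain k where k: "int_encode k \<le> code_bound n (code (foldr Exi zs \<chi>))"
    "bev (code_bound n) p A (v(z := k)) (foldr Exi zs \<chi>)" by auto
  have "bounded (qbound n (model_bound n) (code (foldr Exi zs \<chi>))) p A v"
    by (rule bounded_mono[OF Cons.prems(1)]) (simp add: qbound_antimono[OF code_le(11)] del: code.simps)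
  then show ?case using Cons.IH[OF bounded_upd k(2)] k(1) by (simp add: code_bound_def int_encode_le)
qed auto

lemma bev_foldr_ExiI:
  assumes "bounded (model_bound n) p A v" "bev (code_bound n) p A v \<chi>"
  shows "bev (code_bound n) p A v (foldr Exi zs \<chi>)"
proof (induction zs)
  case (Cons z zs)
  have "\<bar>v z\<bar> \<le> int (model_bound n)" using assms(1) by (simp add: bounded_def)
  also have "\<dots> \<le> int (qbound n (model_bound n) (code (foldr Exi zs \<chi>)))" by (rule of_nat_mono) (rule qbound_ge)
  finally show ?case using Cons by (auto simp: code_bound_def int_encode_le intro!: exI[of _ "v z"])
qed (use assms in simp)

definition body :: "fm \<Rightarrow> nat \<Rightarrow> fm list \<Rightarrow> nat list \<Rightarrow> fm" where
  "body \<alpha> x \<beta>s zs = foldl Conj \<alpha> (map2 (\<lambda>\<beta> z. Equal (Card x \<beta>) (Var z)) \<beta>s zs)"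

lemma code_body:
  assumes "length \<beta>s = length zs"
  shows "code \<alpha> \<le> code (body \<alpha> x \<beta>s zs)"
    "j < length zs \<Longrightarrow> code (\<beta>s ! j) \<le> code (body \<alpha> x \<beta>s zs)"
    "j < length zs \<Longrightarrow> x \<le> code (body \<alpha> x \<beta>s zs)"
proof -
  show "code \<alpha> \<le> code (body \<alpha> x \<beta>s zs)" unfolding body_def by (rule code_foldl_Conj) simp
  assume j: "j < length zs"
  have *: "code (Equal (Card x (\<beta>s ! j)) (Var (zs ! j))) \<le> code (body \<alpha> x \<beta>s zs)"
    unfolding body_def by (rule code_foldl_Conj) (use j assms in \<open>auto simp: set_zip\<close>)
  show "code (\<beta>s ! j) \<le> code (body \<alpha> x \<beta>s zs)"
    using tcode_le(9)[of "\<beta>s ! j" x] code_le(3)[of "Card x (\<beta>s ! j)" "Var (zs ! j)"] * by linarith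
  show "x \<le> code (body \<alpha> x \<beta>s zs)"
    using tcode_le(8)[of x "\<beta>s ! j"] code_le(3)[of "Card x (\<beta>s ! j)" "Var (zs ! j)"] * by linarith
qed

lemma ball_map2:
  "length xs = length ys \<Longrightarrow> (\<forall>\<psi>\<in>set (map2 f xs ys). P \<psi>) \<longleftrightarrow> (\<forall>j<length ys. P (f (xs ! j) (ys ! j)))"
  by (simp add: all_set_conv_all_nth)

lemma holds_body:
  assumes "length \<beta>s = length zs"
  shows "holds p A v (body \<alpha> x \<beta>s zs) \<longleftrightarrow> holds p A v \<alpha> \<and> (\<forall>j<length zs.
    v (zs ! j) = int (card {k \<in> {0..<p parN}. holds p A (v(x := k)) (\<beta>s ! j)}))"
  unfolding body_def holds_foldl_Conj ball_map2[OF assms] holds.simps tval.simps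
  by (simp only: eq_commute[of "int _"])

lemma bev_body:
  assumes "length \<beta>s = length zs"
  shows "bev r p A v (body \<alpha> x \<beta>s zs) \<longleftrightarrow> bev r p A v \<alpha> \<and> (\<forall>j<length zs.
    v (zs ! j) = int (card {k \<in> {0..<p parN}. bev r p A (v(x := k)) (\<beta>s ! j)}))"
  unfolding body_def bev_foldl_Conj ball_map2[OF assms] bev.simps tbev.simps
  by (simp only: eq_commute[of "int _"])

lemma bev_body_holds:
  assumes len: "length \<beta>s = length zs" and bas_shape: "bas_shape \<alpha>" "\<forall>\<beta>\<in>set \<beta>s. bas_shape \<beta>"
    and n: "code (body \<alpha> x \<beta>s zs) \<le> n"
    and b: "bounded (qbound n (model_bound n) (code (body \<alpha> x \<beta>s zs))) p A v"
  shows "bev (code_bound n) p A v (body \<alpha> x \<beta>s zs) \<longleftrightarrow> holds p A v (body \<alpha> x \<beta>s zs)"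
proof -
  note le = code_body[OF len, where \<alpha> = \<alpha> and x = x]
  have code_bound: "code_bound n = (\<lambda>q. 2 * qbound n (model_bound n) q)" by (auto simp: code_bound_def)
  have "bev (code_bound n) p A v \<alpha> = holds p A v \<alpha>"
    by (rule bev_holds(2)[OF bas_shape(1) _ code_bound]) (use le(1) n in \<open>auto intro: bounded_mono[OF b] qbound_antimono\<close>)
  moreover have "bev (code_bound n) p A (v(x := k)) (\<beta>s ! j) = holds p A (v(x := k)) (\<beta>s ! j)"
    if "j < length zs" "k \<in> {0..<p parN}" for j k
  proof (rule bev_holds(2)[OF _ _ code_bound])
    show "bas_shape (\<beta>s ! j)" using bas_shape(2) that len by simp
    show "code (\<beta>s ! j) \<le> n" using le(2)[OF that(1)] n by linarith
    \<comment> \<open>The counted points lie in \<open>[0, N)\<close> and so inherit the bound on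
      the parameter.\<close>
    have "\<bar>p parN\<bar> \<le> int (qbound n (model_bound n) (code (body \<alpha> x \<beta>s zs)))" using b unfolding bounded_def by blast
    then have "\<bar>k\<bar> \<le> int (qbound n (model_bound n) (code (body \<alpha> x \<beta>s zs)))" using that(2) by auto
    then show "bounded (qbound n (model_bound n) (code (\<beta>s ! j))) p A (v(x := k))"
      by (rule bounded_mono[OF bounded_upd[OF b] qbound_antimono[OF le(2)[OF that(1)]]])
  qed
  then have "{k \<in> {0..<p parN}. bev (code_bound n) p A (v(x := k)) (\<beta>s ! j)} =
      {k \<in> {0..<p parN}. holds p A (v(x := k)) (\<beta>s ! j)}" if "j < length zs" for j
    using that by blast
  ultimately show ?thesis unfolding bev_body[OF len] holds_body[OF len] by simp
qed

lemma eflat_body: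
  "eflat \<phi> \<longleftrightarrow> (\<exists>x zs \<alpha> \<beta>s. length \<beta>s = length zs \<and> bas_shape \<alpha> \<and> (\<forall>\<beta>\<in>set \<beta>s. bas_shape \<beta>) \<and> x \<notin> vars \<alpha> \<and>
     \<phi> = foldr Exi zs (body \<alpha> x \<beta>s zs))"
  unfolding eflat_def body_def basic_iff_bas_shape ..

text \<open>Taking one more than the code makes \<open>n\<close> a variable index that does not
  occur in \<open>\<phi>\<close>. Everything above \<open>n\<close> is 0, so that the model is a
  finite object that can be searched for.\<close>

lemma eflat_bounded_satisfiable:
  assumes "eflat \<phi>" "satisfiable \<phi>" "n = Suc (code \<phi>)"
  shows "\<exists>p A v. bounded (model_bound n) p A v \<and> (\<forall>i>n. p i = 0 \<and> v i = 0 \<and> (\<forall>k. A i k = 0)) \<and>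
    (\<forall>a k. k \<notin> {0..<p parN} \<longrightarrow> A a k = 0) \<and> bev (code_bound n) p A v \<phi>"
proof -
  obtain x zs \<alpha> \<beta>s where len: "length \<beta>s = length zs" and bas_shape: "bas_shape \<alpha>" "\<forall>\<beta>\<in>set \<beta>s. bas_shape \<beta>"
    and x: "x \<notin> vars \<alpha>" and \<phi>: "\<phi> = foldr Exi zs (body \<alpha> x \<beta>s zs)"
    using assms(1) unfolding eflat_body by blast
  obtain p A v where A: "\<forall>a k. k \<notin> {0..<p parN} \<longrightarrow> A a k = 0" and v: "holds p A v (body \<alpha> x \<beta>s zs)"
    using assms(2) holds_foldr_Exi unfolding satisfiable_def \<phi> by blast
  have n: "code (body \<alpha> x \<beta>s zs) \<le> n" "length zs \<le> n" "0 < n" "\<And>z. z \<in> set zs \<Longrightarrow> z \<le> n"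
    using code_foldr_Exi(1)[of "body \<alpha> x \<beta>s zs" zs] code_foldr_Exi(2)[of _ zs "body \<alpha> x \<beta>s zs"] unfolding assms(3) \<phi> by force+
  note le = code_body[OF len, where \<alpha> = \<alpha> and x = x]
  \<comment> \<open>if \<open>zs\<close> is empty, \<open>x\<close> does not occur in \<open>\<phi>\<close> and need not be bounded by its code\<close>
  define x' where "x' = (if zs = [] then n else x)"
  have "n \<notin> vars \<alpha>"
  proof
    assume "n \<in> vars \<alpha>"
    then have "n \<le> code \<alpha>" using vars_le(2)[of \<alpha>] by blast
    then show False
      using le(1) code_foldr_Exi(1)[of "body \<alpha> x \<beta>s zs" zs] unfolding assms(3) \<phi> by linarith
  qed
  then have x': "x' \<le> n" "x' \<notin> vars \<alpha>" using le(3)[of 0] n(1) x by (auto simp: x'_def)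
  have hb: "holds p A v \<alpha> \<and> (\<forall>j<length zs.
      v (zs ! j) = int (card {k \<in> {0..<p parN}. holds p A (v(x' := k)) (\<beta>s ! j)}))"
    if "holds p A v (body \<alpha> x \<beta>s zs)" for p A v
    using that unfolding holds_body[OF len] x'_def by auto
  have hb': "holds p A v (body \<alpha> x \<beta>s zs)"
    if "holds p A v \<alpha>" "\<forall>j<length zs.
      v (zs ! j) = int (card {k \<in> {0..<p parN}. holds p A (v(x' := k)) (\<beta>s ! j)})" for p A v
    using that unfolding holds_body[OF len] x'_def by (cases zs) auto
  have model_bound: "model_bound n = wits_bound (bas_lvl n) (card (locs n)) (Suc n) (col_bound ((next_lvl ^^ Suc n) (bas_lvl n)) (card (locs n)) (2 ^ n))"
    unfolding model_bound_def card_locs ..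
  have sm: "\<exists>p' A' v'. bounded (model_bound n) p' A' v' \<and>
    (\<forall>i>n. p' i = 0 \<and> v' i = 0 \<and> (\<forall>k. A' i k = 0)) \<and> (\<forall>a k. k \<notin> {0..<p' parN} \<longrightarrow> A' a k = 0) \<and>
    holds p' A' v' \<alpha> \<and> (\<forall>j<length zs. v' (zs ! j) =
      int (card {k \<in> {0..<p' parN}. holds p' A' (v'(x' := k)) (\<beta>s ! j)}))"
    unfolding model_bound
  proof (rule small_model[OF n(3) bas_shape(1) _ _ _ _ n(2) x'])
    show "bas_shape (\<beta>s ! j)" if "j < length zs" for j using bas_shape(2) len that by simp
    show "code \<alpha> \<le> n" using le(1) n(1) by linarith
    show "code (\<beta>s ! j) \<le> n" if "j < length zs" for j using le(2)[OF that] n(1) by linarith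
    show "zs ! j \<le> n" if "j < length zs" for j using n(4) that by simp
    show "A a k = 0" if "k \<notin> {0..<p parN}" for a k using A that by blast
    show "holds p A v \<alpha>" using hb[OF v] by blast
    show "v (zs ! j) = int (card {k \<in> {0..<p parN}. holds p A (v(x' := k)) (\<beta>s ! j)})"
      if "j < length zs" for j using hb[OF v] that by blast
  qed
  then obtain p' A' v' where p': "bounded (model_bound n) p' A' v'"
    "\<forall>i>n. p' i = 0 \<and> v' i = 0 \<and> (\<forall>k. A' i k = 0)" "\<forall>a k. k \<notin> {0..<p' parN} \<longrightarrow> A' a k = 0"
    "holds p' A' v' \<alpha>" "\<forall>j<length zs. v' (zs ! j) =
      int (card {k \<in> {0..<p' parN}. holds p' A' (v'(x' := k)) (\<beta>s ! j)})" by (elim exE conjE)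
  have "holds p' A' v' (body \<alpha> x \<beta>s zs)" by (rule hb'[OF p'(4,5)])
  then have "bev (code_bound n) p' A' v' (body \<alpha> x \<beta>s zs)"
    using bev_body_holds[OF len bas_shape n(1) bounded_mono[OF p'(1) qbound_ge]] by blast
  then have "bev (code_bound n) p' A' v' \<phi>" unfolding \<phi> by (rule bev_foldr_ExiI[OF p'(1)])
  with p'(1-3) show ?thesis by blast
qed

lemma eflat_bev_satisfiable:
  assumes "eflat \<phi>" "code \<phi> \<le> n" "bounded (model_bound n) p A v"
    "\<And>a k. k \<notin> {0..<p parN} \<Longrightarrow> A a k = 0" "bev (code_bound n) p A v \<phi>"
  shows "satisfiable \<phi>"
proof -
  obtain x zs \<alpha> \<beta>s where len: "length \<beta>s = length zs" and bas_shape: "bas_shape \<alpha>" "\<forall>\<beta>\<in>set \<beta>s. bas_shape \<beta>"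
    and \<phi>: "\<phi> = foldr Exi zs (body \<alpha> x \<beta>s zs)"
    using assms(1) unfolding eflat_body by blast
  obtain v' where v': "bounded (qbound n (model_bound n) (code (body \<alpha> x \<beta>s zs))) p A v'" "bev (code_bound n) p A v' (body \<alpha> x \<beta>s zs)"
    using bev_foldr_Exi[OF bounded_mono[OF assms(3) qbound_ge] assms(5)[unfolded \<phi>]] by blast
  have "code (body \<alpha> x \<beta>s zs) \<le> n"
    using code_foldr_Exi(1)[of "body \<alpha> x \<beta>s zs" zs] assms(2) unfolding \<phi> by linarith
  then have "holds p A v' (body \<alpha> x \<beta>s zs)" using bev_body_holds[OF len bas_shape _ v'(1)] v'(2) by blast
  then have "holds p A v' \<phi>" unfolding \<phi> by (rule holds_foldr_ExiI)
  then show ?thesis unfolding satisfiable_def using assms(4) by blast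
qed

section \<open>Evaluation on codes\<close>

definition digit :: "nat \<Rightarrow> nat \<Rightarrow> nat \<Rightarrow> nat" where "digit b w i = w div b ^ i mod b"

lemma digit_less: "0 < b \<Longrightarrow> digit b w i < b"
  by (simp add: digit_def)

lemma digit_eq_0:
  assumes "0 < b" "w < b ^ m" "m \<le> i" shows "digit b w i = 0"
proof -
  have "b ^ m \<le> b ^ i" using assms by (intro power_increasing) auto
  then show ?thesis using assms(2) by (simp add: digit_def)
qed

lemma ex_digits:
  assumes "\<And>i. f i < b" "\<And>i. m \<le> i \<Longrightarrow> f i = 0"
  shows "\<exists>w<b ^ m. \<forall>i. digit b w i = f i"
  using assms
proof (induction m arbitrary: f)
  case 0
  then show ?case by (auto simp: digit_def)
next
  case (Suc m)
  obtain w where w: "w < b ^ m" "\<forall>i. digit b w i = f (Suc i)"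
    using Suc.IH[of "\<lambda>i. f (Suc i)"] Suc.prems by auto
  have b: "0 < b" using Suc.prems(1)[of 0] by simp
  have "digit b (f 0 + b * w) i = f i" for i
  proof (cases i)
    case 0
    then show ?thesis using Suc.prems(1)[of 0] by (simp add: digit_def)
  next
    case (Suc j)
    have "(f 0 + b * w) div b = w" using Suc.prems(1)[of 0] b by simp
    then show ?thesis using w(2) unfolding Suc by (simp add: digit_def div_mult2_eq)
  qed
  moreover have "f 0 + b * w < b ^ Suc m"
  proof -
    have "b * Suc w \<le> b * b ^ m" using w(1) by (intro mult_left_mono) auto
    then show ?thesis using Suc.prems(1)[of 0] by simp
  qed
  ultimately show ?case by blast
qed

text \<open>Replacing a digit is specified by minimisation; the disjunct
  \<open>b ^ m \<le> w\<close> makes the search terminate for arbitrary arguments and is never the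
  one met when \<open>x\<close> and \<open>d\<close> are in range.\<close>

definition upd :: "nat \<Rightarrow> nat \<Rightarrow> nat \<Rightarrow> nat \<Rightarrow> nat \<Rightarrow> nat" where
  "upd b m v x d = (LEAST w. b ^ m \<le> w \<or> (\<forall>y<m. digit b w y = (if y = x then d else digit b v y)))"

lemma upd:
  assumes "v < b ^ m" "x < m" "d < b"
  shows "upd b m v x d < b ^ m" "digit b (upd b m v x d) = (digit b v)(x := d)"
proof -
  have b: "0 < b" using assms(3) by simp
  obtain w where w: "w < b ^ m" "\<forall>i. digit b w i = ((digit b v)(x := d)) i"
    using ex_digits[of "(digit b v)(x := d)" b m] assms digit_less[of b] digit_eq_0[OF b assms(1)] by force
  let ?P = "\<lambda>w. b ^ m \<le> w \<or> (\<forall>y<m. digit b w y = (if y = x then d else digit b v y))"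
  have "?P w" using w(2) by simp
  then have "upd b m v x d \<le> w" "?P (upd b m v x d)"
    unfolding upd_def by (rule Least_le, rule LeastI)
  then show lt: "upd b m v x d < b ^ m" using w(1) by linarith
  then have "\<forall>y<m. digit b (upd b m v x d) y = (if y = x then d else digit b v y)"
    using \<open>?P (upd b m v x d)\<close> not_le by blast
  then show "digit b (upd b m v x d) = (digit b v)(x := d)"
    using digit_eq_0[OF b lt] digit_eq_0[OF b assms(1)] assms(2) by (intro ext) (metis fun_upd_apply not_le)
qed

text \<open>\<open>int_encode\<close> puts nonnegative integers on even and negative ones on odd
  numbers. The two parts write the integer as a difference of naturals, which reduces integer
  arithmetic on codes to sums and comparisons of naturals.\<close>

definition pos_part :: "nat \<Rightarrow> nat" where "pos_part a = (if even a then a div 2 else 0)"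
definition neg_part :: "nat \<Rightarrow> nat" where "neg_part a = (if even a then 0 else Suc (a div 2))"
definition diff_encode :: "nat \<Rightarrow> nat \<Rightarrow> nat" where "diff_encode s u = (if u \<le> s then 2 * (s - u) else 2 * (u - s) - 1)"

lemma int_decode_pos_part_neg_part: "int_decode a = int (pos_part a) - int (neg_part a)"
  by (auto simp: int_decode_def sum_decode_def pos_part_def neg_part_def)

lemma diff_encode: "diff_encode s u = int_encode (int s - int u)"
  by (auto simp: diff_encode_def int_encode_def sum_encode_def nat_diff_distrib)

lemma int_encode_pos_part_neg_part: "k = int (pos_part (int_encode k)) - int (neg_part (int_encode k))"
  using int_decode_pos_part_neg_part[of "int_encode k"] by simp

lemma recfun_funpow [rec_intros]:
  assumes "recfun (\<lambda>w. F (p1 w) (p2 w))" "recfun k" "recfun x"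
  shows "recfun (\<lambda>z. (F z ^^ k z) (x z))"
proof -
  have "(F z ^^ j) y = rec_nat y (\<lambda>_ r. F z r) j" for z j y by (induction j) auto
  moreover have "recfun (\<lambda>z. rec_nat (x z) (\<lambda>_ r. F z r) (k z))"
    using assms(2,3) recfun_comp[OF assms(1), of "\<lambda>w. pr (p1 w) (p2 (p2 w))"]
    by (intro rec_intros) (simp_all add: recfun_pr recfun_p1 recfun_p2 recfun_id)
  ultimately show ?thesis by simp
qed

lemma recfun_thr_bound [rec_intros]: "recfun f \<Longrightarrow> recfun (\<lambda>z. thr_bound (f z))"
  unfolding thr_bound_def by (intro rec_intros)

lemma recfun_next_lvl [rec_intros]: "recfun f \<Longrightarrow> recfun (\<lambda>z. next_lvl (f z))"
  unfolding next_lvl_def by (intro rec_intros)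

lemma recfun_wit_bound [rec_intros]: "recfun f \<Longrightarrow> recfun g \<Longrightarrow> recfun h \<Longrightarrow> recfun (\<lambda>z. wit_bound (f z) (g z) (h z))"
  unfolding wit_bound_def by (intro rec_intros)

lemma recfun_wits_bound [rec_intros]:
  assumes "recfun f" "recfun g" "recfun h" "recfun k"
  shows "recfun (\<lambda>z. wits_bound (f z) (g z) (h z) (k z))"
  unfolding wits_bound_def by (intro rec_intros assms assms[THEN recfun_comp])

lemma recfun_col_bound [rec_intros]:
  assumes "recfun f" "recfun g" "recfun h"
  shows "recfun (\<lambda>z. col_bound (f z) (g z) (h z))"
  unfolding col_bound_def ext_dim_def by (intro rec_intros assms)

lemma recfun_bas_lvl [rec_intros]: "recfun f \<Longrightarrow> recfun (\<lambda>z. bas_lvl (f z))"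
  unfolding bas_lvl_def by (intro rec_intros)

lemma recfun_model_bound [rec_intros]: "recfun f \<Longrightarrow> recfun (\<lambda>z. model_bound (f z))"
  unfolding model_bound_def by (intro rec_intros)

lemma recfun_code_bound [rec_intros]:
  assumes "recfun f" "recfun g" shows "recfun (\<lambda>z. code_bound (f z) (g z))"
  unfolding code_bound_def qbound_def by (intro rec_intros assms assms[THEN recfun_comp])

definition base :: "nat \<Rightarrow> nat" where "base n = Suc (code_bound n 0)"

lemma recfun_base [rec_intros]: "recfun f \<Longrightarrow> recfun (\<lambda>z. base (f z))"
  unfolding base_def by (intro rec_intros)

lemma base_pos: "0 < base n"
  by (simp add: base_def)

lemma code_bound_less_base: "code_bound n q < base n"
  unfolding base_def code_bound_def by (simp add: less_Suc_eq_le qbound_antimono)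

lemma model_bound_less_base: "2 * model_bound n < base n"
  using qbound_ge[of "model_bound n" n 0] by (simp add: base_def code_bound_def)

lemma recfun_digit [rec_intros]:
  "recfun f \<Longrightarrow> recfun g \<Longrightarrow> recfun h \<Longrightarrow> recfun (\<lambda>z. digit (f z) (g z) (h z))"
  unfolding digit_def by (intro rec_intros)

lemma recfun_upd [rec_intros]:
  assumes "recfun f" "recfun g" "recfun h" "recfun k" "recfun l"
  shows "recfun (\<lambda>z. upd (f z) (g z) (h z) (k z) (l z))"
  unfolding upd_def
  by (intro recfun_Least rec_intros assms assms[THEN recfun_comp]) auto

lemma recfun_pos_part [rec_intros]: "recfun f \<Longrightarrow> recfun (\<lambda>z. pos_part (f z))"
  unfolding pos_part_def by (intro rec_intros)

lemma recfun_neg_part [rec_intros]: "recfun f \<Longrightarrow> recfun (\<lambda>z. neg_part (f z))"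
  unfolding neg_part_def by (intro rec_intros)

lemma recfun_diff_encode [rec_intros]: "recfun f \<Longrightarrow> recfun g \<Longrightarrow> recfun (\<lambda>z. diff_encode (f z) (g z))"
  unfolding diff_encode_def by (intro rec_intros)

definition add_code :: "nat \<Rightarrow> nat \<Rightarrow> nat" where "add_code a b = diff_encode (pos_part a + pos_part b) (neg_part a + neg_part b)"
definition minus_code :: "nat \<Rightarrow> nat" where "minus_code a = diff_encode (neg_part a) (pos_part a)"
definition less_code :: "nat \<Rightarrow> nat \<Rightarrow> bool" where "less_code a b \<longleftrightarrow> pos_part a + neg_part b < pos_part b + neg_part a"
definition cong_code :: "nat \<Rightarrow> nat \<Rightarrow> nat \<Rightarrow> bool" where
  "cong_code n a b \<longleftrightarrow> (pos_part a + neg_part b) mod n = (pos_part b + neg_part a) mod n"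

lemma add_code: "add_code (int_encode x) (int_encode y) = int_encode (x + y)"
  unfolding add_code_def diff_encode using int_encode_pos_part_neg_part[of x] int_encode_pos_part_neg_part[of y]
  by (intro arg_cong[where f = int_encode]) linarith

lemma minus_code: "minus_code (int_encode x) = int_encode (- x)"
  unfolding minus_code_def diff_encode using int_encode_pos_part_neg_part[of x]
  by (intro arg_cong[where f = int_encode]) linarith

lemma less_code: "less_code (int_encode x) (int_encode y) \<longleftrightarrow> x < y"
  unfolding less_code_def using int_encode_pos_part_neg_part[of x] int_encode_pos_part_neg_part[of y] by linarith

lemma cong_code: "cong_code n (int_encode x) (int_encode y) \<longleftrightarrow> [x = y] (mod int n)"
proof -
  let ?a = "int_encode x" and ?b = "int_encode y"
  have "cong_code n ?a ?b \<longleftrightarrow> [int (pos_part ?a + neg_part ?b) = int (pos_part ?b + neg_part ?a)] (mod int n)"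
    by (simp only: cong_code_def cong_def zmod_int[symmetric] of_nat_eq_iff)
  also have "\<dots> \<longleftrightarrow> int n dvd int (pos_part ?a + neg_part ?b) - int (pos_part ?b + neg_part ?a)"
    by (rule cong_iff_dvd_diff)
  also have "int (pos_part ?a + neg_part ?b) - int (pos_part ?b + neg_part ?a) = x - y"
    using int_encode_pos_part_neg_part[of x] int_encode_pos_part_neg_part[of y] by linarith
  finally show ?thesis by (simp add: cong_iff_dvd_diff)
qed

section \<open>Evaluation by recursion on codes\<close>

definition sub :: "nat \<Rightarrow> nat \<Rightarrow> nat \<Rightarrow> nat" where "sub t q v = table_app (table_app t q) v"

text \<open>An even code \<open>d\<close> is the index \<open>d div 2\<close>; odd codes are
  negative indices. The default 0 is the code of the integer 0, as the array convention requires
  outside \<open>[0, N)\<close>.\<close>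

definition array_value :: "nat \<Rightarrow> nat \<Rightarrow> nat \<Rightarrow> nat \<Rightarrow> nat \<Rightarrow> nat" where
  "array_value n wp wA a d =
     (if even d \<and> d div 2 < pos_part (digit (base n) wp 0) then digit (base n) wA (pr a (d div 2)) else 0)"

text \<open>The value of a term or formula is tabulated over all codes \<open>v\<close> of variable assignments, because
  quantifiers change the assignment while \<open>course_of_values\<close> keeps its parameter fixed.\<close>

definition node_value :: "nat \<Rightarrow> nat \<Rightarrow> nat \<Rightarrow> nat \<Rightarrow> nat \<Rightarrow> nat \<Rightarrow> nat" where
  "node_value n wp wA q t v =
     (if p1 q = 0 then p2 q
      else if p1 q = 1 then digit (base n) wp (p2 q)
      else if p1 q = 2 then digit (base n) v (p2 q)
      else if p1 q = 3 then add_code (sub t (p1 (p2 q)) v) (sub t (p2 (p2 q)) v)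
      else if p1 q = 4 then minus_code (sub t (p2 q) v)
      else if p1 q = 5 then array_value n wp wA (p1 (p2 q)) (sub t (p2 (p2 q)) v)
      else if p1 q = 6 then 2 * card {k. k < pos_part (digit (base n) wp 0) \<and>
        sub t (p2 (p2 q)) (upd (base n) (Suc n) v (p1 (p2 q)) (2 * k)) = 1}
      else if p1 q = 7 then of_bool (less_code (sub t (p1 (p2 q)) v) (sub t (p2 (p2 q)) v))
      else if p1 q = 8 then of_bool (sub t (p1 (p2 q)) v = sub t (p2 (p2 q)) v)
      else if p1 q = 9 then of_bool (cong_code (p1 (p2 q)) (sub t (p1 (p2 (p2 q))) v) (sub t (p2 (p2 (p2 q))) v))
      else if p1 q = 10 then of_bool (sub t (p1 (p2 q)) v = 1 \<and> sub t (p2 (p2 q)) v = 1)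
      else if p1 q = 11 then of_bool (sub t (p2 q) v \<noteq> 1)
      else of_bool (\<exists>d\<le>code_bound n (p2 (p2 q)).
        sub t (p2 (p2 q)) (upd (base n) (Suc n) v (p1 (p2 q)) d) = 1))"

lemma recfun_add_code [rec_intros]: "recfun f \<Longrightarrow> recfun g \<Longrightarrow> recfun (\<lambda>z. add_code (f z) (g z))"
  and recfun_minus_code [rec_intros]: "recfun f \<Longrightarrow> recfun (\<lambda>z. minus_code (f z))"
  and recpred_less_code [rec_intros]: "recfun f \<Longrightarrow> recfun g \<Longrightarrow> recpred (\<lambda>z. less_code (f z) (g z))"
  and recpred_cong_code [rec_intros]: "recfun h \<Longrightarrow> recfun f \<Longrightarrow> recfun g \<Longrightarrow> recpred (\<lambda>z. cong_code (h z) (f z) (g z))"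
  unfolding add_code_def minus_code_def less_code_def cong_code_def by (intro rec_intros; assumption)+

lemma recfun_sub [rec_intros]: "recfun f \<Longrightarrow> recfun g \<Longrightarrow> recfun h \<Longrightarrow> recfun (\<lambda>z. sub (f z) (g z) (h z))"
  unfolding sub_def by (intro rec_intros)

lemma recfun_array_value [rec_intros]:
  "recfun f \<Longrightarrow> recfun g \<Longrightarrow> recfun h \<Longrightarrow> recfun k \<Longrightarrow> recfun l \<Longrightarrow>
    recfun (\<lambda>z. array_value (f z) (g z) (h z) (k z) (l z))"
  unfolding array_value_def by (intro rec_intros)

text \<open>\<open>z\<close> packs \<open>n\<close>, the digits of the parameters and those of the
  arrays. The inner table runs over all assignments to the variables
  \<open>0, ..., n\<close>.\<close>

definition eval_step :: "nat \<Rightarrow> nat \<Rightarrow> nat \<Rightarrow> nat" where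
  "eval_step z q t = table (base (p1 z) ^ Suc (p1 z)) (node_value (p1 z) (p1 (p2 z)) (p2 (p2 z)) q t)"

lemma recfun_eval_step: "recfun (\<lambda>w. eval_step (p1 w) (p1 (p2 w)) (p2 (p2 w)))"
  unfolding eval_step_def node_value_def by (intro rec_intros)



lemma of_bool_eq_Suc_0 [simp]: "of_bool P = Suc 0 \<longleftrightarrow> P" "Suc 0 = of_bool P \<longleftrightarrow> P"
  by auto

lemma less_pr: "0 < k \<Longrightarrow> a \<le> b \<Longrightarrow> a < pr k b"
  using add_le_pr[of k b] by linarith

lemma less_pr_simps [simp]:
  "0 < k \<Longrightarrow> b < pr k b" "0 < k \<Longrightarrow> a < pr k (pr a b)" "0 < k \<Longrightarrow> b < pr k (pr a b)"
  "0 < k \<Longrightarrow> b < pr k (pr a (pr b c))" "0 < k \<Longrightarrow> c < pr k (pr a (pr b c))"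
  by (meson less_pr le_prod_encode_1 le_prod_encode_2 order_refl order_trans)+

lemma int_decode_even: "int_decode (2 * k) = int k"
  by (simp add: int_decode_def sum_decode_def)

lemma array_value_spec:
  fixes n wp wA
  defines "N \<equiv> int_decode (digit (base n) wp 0)"
  shows "array_value n wp wA a (int_encode k) =
    int_encode (if 0 \<le> k \<and> k < N then int_decode (digit (base n) wA (pr a (nat k))) else 0)"
proof -
  have N: "N = int (pos_part (digit (base n) wp 0)) \<or> N \<le> 0 \<and> pos_part (digit (base n) wp 0) = 0"
    unfolding N_def int_decode_pos_part_neg_part by (auto simp: pos_part_def neg_part_def)
  have "even (int_encode k) \<longleftrightarrow> 0 \<le> k" "0 \<le> k \<Longrightarrow> int_encode k div 2 = nat k" "int_encode 0 = 0"
    by (auto simp: int_encode_def sum_encode_def)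
  then show ?thesis using N unfolding array_value_def by auto
qed

text \<open>Assignments stay below \<open>base n ^ Suc n\<close>, because a binder inserts only
  indices below \<open>N\<close> or values within \<open>code_bound\<close>, whose codes are digits.
  Values of terms may exceed the base, as they are table entries and not digits.\<close>

lemma eval_step_spec:
  fixes n wp wA :: nat
  defines "p \<equiv> \<lambda>c. int_decode (digit (base n) wp c)"
    and "A \<equiv> \<lambda>a k. if 0 \<le> k \<and> k < int_decode (digit (base n) wp 0) then int_decode (digit (base n) wA (pr a (nat k))) else 0"
    and "F \<equiv> course_of_values eval_step (pr n (pr wp wA))"
  shows "tcode t \<le> n \<Longrightarrow> v < base n ^ Suc n \<Longrightarrow>
      table_app (F (tcode t)) v = int_encode (tbev (code_bound n) p A (\<lambda>i. int_decode (digit (base n) v i)) t)"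
    and "code \<phi> \<le> n \<Longrightarrow> v < base n ^ Suc n \<Longrightarrow>
      table_app (F (code \<phi>)) v = of_bool (bev (code_bound n) p A (\<lambda>i. int_decode (digit (base n) v i)) \<phi>)"
proof -
  have F: "table_app (F q) v = node_value n wp wA q (table q F) v" if "v < base n ^ Suc n" for q v
    unfolding F_def by (subst course_of_values) (simp add: eval_step_def table_app_table that del: power_Suc)
  have sub: "sub (table q F) q' v = table_app (F q') v" if "q' < q" for q q' v
    using that by (simp add: sub_def table_app_table)
  have upd: "upd (base n) (Suc n) v x d < base n ^ Suc n"
    "(\<lambda>i. int_decode (digit (base n) (upd (base n) (Suc n) v x d) i)) = (\<lambda>i. int_decode (digit (base n) v i))(x := int_decode d)"
    if "v < base n ^ Suc n" "x \<le> n" "d < base n" for v x d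
    using upd[of v "base n" "Suc n" x d] that by (auto simp: fun_eq_iff)
  have p0: "p parN = int_decode (digit (base n) wp 0)" by (simp add: p_def parN_def)
  have pos_part_less: "2 * k < base n" if "k < pos_part (digit (base n) wp 0)" for k
    using that digit_less[OF base_pos, of n wp 0] by (auto simp: pos_part_def split: if_splits)
  have N: "{0..<p parN} = int ` {..<pos_part (digit (base n) wp 0)}"
  proof (cases "even (digit (base n) wp 0)")
    case True
    then have "p parN = int (pos_part (digit (base n) wp 0))"
      unfolding p0 int_decode_pos_part_neg_part by (simp add: neg_part_def)
    then show ?thesis using image_int_atLeastLessThan[of 0 "pos_part (digit (base n) wp 0)"]
      by (simp add: lessThan_atLeast0)
  next
    case False
    then have "p parN \<le> 0" "pos_part (digit (base n) wp 0) = 0"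
      unfolding p0 int_decode_pos_part_neg_part by (simp_all add: pos_part_def)
    then show ?thesis by simp
  qed
  show "tcode t \<le> n \<Longrightarrow> v < base n ^ Suc n \<Longrightarrow>
      table_app (F (tcode t)) v = int_encode (tbev (code_bound n) p A (\<lambda>i. int_decode (digit (base n) v i)) t)"
    and "code \<phi> \<le> n \<Longrightarrow> v < base n ^ Suc n \<Longrightarrow>
      table_app (F (code \<phi>)) v = of_bool (bev (code_bound n) p A (\<lambda>i. int_decode (digit (base n) v i)) \<phi>)"
  proof (induction t and \<phi> arbitrary: v and v)
    case (Num k)
    then show ?case by (simp add: F node_value_def)
  next
    case (Par c)
    then show ?case by (simp add: F node_value_def p_def)
  next
    case (Var x)
    then show ?case by (simp add: F node_value_def)
  next
    case (Add s t)
    have "tcode s \<le> n" "tcode t \<le> n" using Add.prems tcode_le(1)[of s t] tcode_le(2)[of t s] by linarith+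
    then show ?case using Add by (simp add: F node_value_def sub add_code)
  next
    case (Minus t)
    have "tcode t \<le> n" using Minus.prems tcode_le(3)[of t] by linarith
    then show ?case using Minus by (simp add: F node_value_def sub minus_code)
  next
    case (App a t)
    have "tcode t \<le> n" using App.prems tcode_le(4)[of t a] by linarith
    then show ?case using App by (simp add: F node_value_def sub array_value_spec A_def)
  next
    case (Card x \<phi>)
    have le: "code \<phi> \<le> n" "x \<le> n"
      using Card.prems tcode_le(8)[of x \<phi>] tcode_le(9)[of \<phi> x] by linarith+
    let ?v = "\<lambda>i. int_decode (digit (base n) v i)"
    have "table_app (F (code \<phi>)) (upd (base n) (Suc n) v x (2 * k)) = of_bool (bev (code_bound n) p A (?v(x := int k)) \<phi>)"
      if "k < pos_part (digit (base n) wp 0)" for k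
      using Card.IH[OF le(1) upd(1)[OF Card.prems(2) le(2) pos_part_less[OF that]]]
      unfolding upd(2)[OF Card.prems(2) le(2) pos_part_less[OF that]] int_decode_even .
    then have 1: "{k. k < pos_part (digit (base n) wp 0) \<and> table_app (F (code \<phi>)) (upd (base n) (Suc n) v x (2 * k)) = 1} =
      {k. k < pos_part (digit (base n) wp 0) \<and> bev (code_bound n) p A (?v(x := int k)) \<phi>}" by auto
    have "{k \<in> {0..<p parN}. bev (code_bound n) p A (?v(x := k)) \<phi>} =
      int ` {k. k < pos_part (digit (base n) wp 0) \<and> bev (code_bound n) p A (?v(x := int k)) \<phi>}"
      unfolding N by auto
    then have 2: "card {k \<in> {0..<p parN}. bev (code_bound n) p A (?v(x := k)) \<phi>} =
      card {k. k < pos_part (digit (base n) wp 0) \<and> bev (code_bound n) p A (?v(x := int k)) \<phi>}"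
      by (simp only: card_image inj_on_of_nat)
    have "int_encode (int m) = 2 * m" for m by (simp add: int_encode_def sum_encode_def)
    then show ?case using Card.prems unfolding tbev.simps 2 1[symmetric] by (simp add: F node_value_def sub)
  next
    case (Less s t)
    have "tcode s \<le> n" "tcode t \<le> n" using Less.prems code_le(1)[of s t] code_le(2)[of t s] by linarith+
    then show ?case using Less by (simp add: F node_value_def sub less_code)
  next
    case (Equal s t)
    have "tcode s \<le> n" "tcode t \<le> n" using Equal.prems code_le(3)[of s t] code_le(4)[of t s] by linarith+
    then show ?case using Equal by (simp add: F node_value_def sub int_encode_eq)
  next
    case (Congr m s t)
    have "tcode s \<le> n" "tcode t \<le> n" using Congr.prems code_le(5)[of s m t] code_le(6)[of t m s] by linarith+
    then show ?case using Congr by (simp add: F node_value_def sub cong_code)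
  next
    case (Conj \<phi> \<psi>)
    have "code \<phi> \<le> n" "code \<psi> \<le> n" using Conj.prems code_le(8)[of \<phi> \<psi>] code_le(9)[of \<psi> \<phi>] by linarith+
    then show ?case using Conj by (simp add: F node_value_def sub)
  next
    case (Neg \<phi>)
    have "code \<phi> \<le> n" using Neg.prems code_le(10)[of \<phi>] by linarith
    then show ?case using Neg by (simp add: F node_value_def sub)
  next
    case (Exi x \<phi>)
    have le: "code \<phi> \<le> n" "x \<le> n"
      using Exi.prems code_le(11)[of \<phi> x] code_le(12)[of x \<phi>] by linarith+
    let ?v = "\<lambda>i. int_decode (digit (base n) v i)"
    have *: "table_app (F (code \<phi>)) (upd (base n) (Suc n) v x d) = of_bool (bev (code_bound n) p A (?v(x := int_decode d)) \<phi>)"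
      if "d \<le> code_bound n (code \<phi>)" for d
    proof -
      have d: "d < base n" using that code_bound_less_base[of n "code \<phi>"] by linarith
      show ?thesis using Exi.IH[OF le(1) upd(1)[OF Exi.prems(2) le(2) d]]
        unfolding upd(2)[OF Exi.prems(2) le(2) d] .
    qed
    have "(\<exists>k. int_encode k \<le> code_bound n (code \<phi>) \<and> bev (code_bound n) p A (?v(x := k)) \<phi>) \<longleftrightarrow>
      (\<exists>d\<le>code_bound n (code \<phi>). bev (code_bound n) p A (?v(x := int_decode d)) \<phi>)"
    proof (intro iffI; elim exE conjE)
      fix k assume "int_encode k \<le> code_bound n (code \<phi>)" "bev (code_bound n) p A (?v(x := k)) \<phi>"
      then show "\<exists>d\<le>code_bound n (code \<phi>). bev (code_bound n) p A (?v(x := int_decode d)) \<phi>"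
        by (intro exI[of _ "int_encode k"]) simp
    next
      fix d assume "d \<le> code_bound n (code \<phi>)" "bev (code_bound n) p A (?v(x := int_decode d)) \<phi>"
      then show "\<exists>k. int_encode k \<le> code_bound n (code \<phi>) \<and> bev (code_bound n) p A (?v(x := k)) \<phi>"
        by (intro exI[of _ "int_decode d"]) simp
    qed
    also have "\<dots> \<longleftrightarrow> (\<exists>d\<le>code_bound n (code \<phi>). table_app (F (code \<phi>)) (upd (base n) (Suc n) v x d) = 1)"
      using * by auto
    finally show ?case using Exi.prems by (simp add: F node_value_def sub)
  qed
qed

text \<open>The entry of array \<open>a\<close> at \<open>k\<close> is the digit at
  \<open>pr a k\<close>. For \<open>a \<le> n\<close> and \<open>k < N \<le> model_bound n\<close>
  these positions do not exceed \<open>pr n (model_bound n)\<close>, as pairing is monotone.\<close>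

definition bounded_sat_code :: "nat \<Rightarrow> nat \<Rightarrow> bool" where
  "bounded_sat_code n c \<longleftrightarrow> (\<exists>wp<base n ^ Suc n. \<exists>wA<base n ^ Suc (pr n (model_bound n)). \<exists>v<base n ^ Suc n.
     (\<forall>i\<le>n. digit (base n) wp i \<le> 2 * model_bound n \<and> digit (base n) v i \<le> 2 * model_bound n) \<and>
     (\<forall>i\<le>pr n (model_bound n). digit (base n) wA i \<le> 2 * model_bound n) \<and> table_app (course_of_values eval_step (pr n (pr wp wA)) c) v = 1)"

lemma recpred_bounded_sat_code [rec_intros]:
  assumes "recfun f" "recfun g" shows "recpred (\<lambda>z. bounded_sat_code (f z) (g z))"
  unfolding bounded_sat_code_def by (intro rec_intros recfun_course_of_values[OF recfun_eval_step] assms assms[THEN recfun_comp])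

lemma pr_mono: "a \<le> c \<Longrightarrow> b \<le> d \<Longrightarrow> pr a b \<le> pr c d"
  unfolding prod_encode_def by (simp add: add_mono triangle_mono)

lemma bounded_sat_code_iff:
  assumes "eflat \<phi>" shows "bounded_sat_code (Suc (code \<phi>)) (code \<phi>) \<longleftrightarrow> satisfiable \<phi>"
proof -
  define n where "n = Suc (code \<phi>)"
  have le: "code \<phi> \<le> n" by (simp add: n_def)
  have dec: "\<bar>int_decode d\<bar> \<le> int (model_bound n)" if "d \<le> 2 * model_bound n" for d
    using that int_encode_le[of "int_decode d" "model_bound n"] by simp
  have enc: "int_encode k \<le> 2 * model_bound n" "int_encode k < base n" if "\<bar>k\<bar> \<le> int (model_bound n)" for k
    using that int_encode_le[of k "model_bound n"] model_bound_less_base[of n] by linarith+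
  have dig0: "digit (base n) w i \<le> 2 * model_bound n" if "w < base n ^ Suc m" "\<forall>i\<le>m. digit (base n) w i \<le> 2 * model_bound n" for w i m
    using that digit_eq_0[OF base_pos that(1), of i] by (cases "i \<le> m") auto
  show ?thesis unfolding n_def[symmetric]
  proof
    assume "bounded_sat_code n (code \<phi>)"
    then obtain wp wA v where w: "wp < base n ^ Suc n" "wA < base n ^ Suc (pr n (model_bound n))" "v < base n ^ Suc n"
      "\<forall>i\<le>n. digit (base n) wp i \<le> 2 * model_bound n" "\<forall>i\<le>n. digit (base n) v i \<le> 2 * model_bound n"
      "\<forall>i\<le>pr n (model_bound n). digit (base n) wA i \<le> 2 * model_bound n" "table_app (course_of_values eval_step (pr n (pr wp wA)) (code \<phi>)) v = 1"
      unfolding bounded_sat_code_def by blast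
    define p where "p = (\<lambda>c. int_decode (digit (base n) wp c))"
    define A where "A = (\<lambda>a k. if 0 \<le> k \<and> k < int_decode (digit (base n) wp 0)
      then int_decode (digit (base n) wA (pr a (nat k))) else 0)"
    define v' where "v' = (\<lambda>i. int_decode (digit (base n) v i))"
    have "bev (code_bound n) p A v' \<phi>"
      using eval_step_spec(2)[OF le w(3), of wp wA] w(7) unfolding p_def A_def v'_def by simp
    moreover have "bounded (model_bound n) p A v'"
      unfolding bounded_def p_def A_def v'_def
      using dec[OF dig0[OF w(1,4)]] dec[OF dig0[OF w(2,6)]] dec[OF dig0[OF w(3,5)]] by simp
    moreover have "A a k = 0" if "k \<notin> {0..<p parN}" for a k
      using that by (auto simp: A_def p_def parN_def)
    ultimately show "satisfiable \<phi>" by (intro eflat_bev_satisfiable[OF assms le])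
  next
    assume "satisfiable \<phi>"
    then obtain p A v where b: "bounded (model_bound n) p A v" and z: "\<forall>i>n. p i = 0 \<and> v i = 0 \<and> (\<forall>k. A i k = 0)"
      and A: "\<forall>a k. k \<notin> {0..<p parN} \<longrightarrow> A a k = 0" and bev: "bev (code_bound n) p A v \<phi>"
      using eflat_bounded_satisfiable[OF assms _ n_def] by blast
    have e0: "int_encode 0 = 0" by (simp add: int_encode_def sum_encode_def)
    have pb: "\<bar>p i\<bar> \<le> int (model_bound n)" and vb: "\<bar>v i\<bar> \<le> int (model_bound n)" and Ab: "\<bar>A a k\<bar> \<le> int (model_bound n)" for i a k
      using b by (auto simp: bounded_def)
    obtain wp where wp: "wp < base n ^ Suc n" "\<forall>i. digit (base n) wp i = int_encode (p i)"
      using ex_digits[of "\<lambda>i. int_encode (p i)" "base n" "Suc n"] enc(2)[OF pb] z e0 by auto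
    obtain w where w: "w < base n ^ Suc n" "\<forall>i. digit (base n) w i = int_encode (v i)"
      using ex_digits[of "\<lambda>i. int_encode (v i)" "base n" "Suc n"] enc(2)[OF vb] z e0 by auto
    have "A (p1 i) (int (p2 i)) = 0" if "Suc (pr n (model_bound n)) \<le> i" for i
    proof (rule ccontr)
      assume nz: "A (p1 i) (int (p2 i)) \<noteq> 0"
      have "\<not> n < p1 i" using z nz by blast
      moreover have "int (p2 i) \<in> {0..<p parN}" using A nz by blast
      moreover have "p parN \<le> int (model_bound n)" using pb[of parN] by linarith
      ultimately have "pr (p1 i) (p2 i) \<le> pr n (model_bound n)" by (intro pr_mono) auto
      then show False using that by simp
    qed
    then obtain wA where wA: "wA < base n ^ Suc (pr n (model_bound n))"
      "\<forall>i. digit (base n) wA i = int_encode (A (p1 i) (int (p2 i)))"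
      using ex_digits[of "\<lambda>i. int_encode (A (p1 i) (int (p2 i)))" "base n" "Suc (pr n (model_bound n))"] enc(2)[OF Ab] e0 by auto
    have "(\<lambda>a k. if 0 \<le> k \<and> k < int_decode (digit (base n) wp 0)
      then int_decode (digit (base n) wA (pr a (nat k))) else 0) = A"
      using A wp(2) wA(2) by (auto simp: fun_eq_iff parN_def)
    then have "table_app (course_of_values eval_step (pr n (pr wp wA)) (code \<phi>)) w = 1"
      using eval_step_spec(2)[OF le w(1), of wp wA] bev wp(2) w(2) by simp
    then show "bounded_sat_code n (code \<phi>)"
      unfolding bounded_sat_code_def using wp(2) w(2) wA(2) enc(1)[OF pb] enc(1)[OF vb] enc(1)[OF Ab]
      by (intro exI[of _ wp] exI[of _ wA] exI[of _ w] conjI[OF wp(1)] conjI[OF wA(1)] conjI[OF w(1)]) simp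
  qed
qed

section \<open>Recognising E-flat formulae\<close>

text \<open>The parameter is a pair \<open>pr f y\<close>: for \<open>f = 0\<close> all occurrences of the variable \<open>y\<close> count, for
  \<open>f = 1\<close> only those as the argument of an array-id.\<close>

definition occ_step :: "nat \<Rightarrow> nat \<Rightarrow> nat \<Rightarrow> nat" where
  "occ_step z q t = of_bool (
     p1 q = 2 \<and> p1 z = 0 \<and> p2 q = p2 z \<or>
     p1 q = 4 \<and> table_app t (p2 q) = 1 \<or>
     p1 q = 5 \<and> (table_app t (p2 (p2 q)) = 1 \<or> p1 z = 1 \<and> p2 (p2 q) = pr 2 (p2 z)) \<or>
     p1 q = 6 \<and> (table_app t (p2 (p2 q)) = 1 \<or> p1 z = 0 \<and> p1 (p2 q) = p2 z) \<or>
     (p1 q = 3 \<or> p1 q = 7 \<or> p1 q = 8 \<or> p1 q = 10) \<and> (table_app t (p1 (p2 q)) = 1 \<or> table_app t (p2 (p2 q)) = 1) \<or>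
     p1 q = 9 \<and> (table_app t (p1 (p2 (p2 q))) = 1 \<or> table_app t (p2 (p2 (p2 q))) = 1) \<or>
     p1 q = 11 \<and> table_app t (p2 q) = 1 \<or>
     p1 q = 12 \<and> (table_app t (p2 (p2 q)) = 1 \<or> p1 z = 0 \<and> p1 (p2 q) = p2 z))"

definition occ :: "nat \<Rightarrow> nat \<Rightarrow> nat \<Rightarrow> bool" where
  "occ f y q \<longleftrightarrow> course_of_values occ_step (pr f y) q = 1"

lemma recpred_occ [rec_intros]:
  "recfun f \<Longrightarrow> recfun g \<Longrightarrow> recfun h \<Longrightarrow> recpred (\<lambda>z. occ (f z) (g z) (h z))"
proof -
  have "recfun (\<lambda>w. occ_step (p1 w) (p1 (p2 w)) (p2 (p2 w)))"
    unfolding occ_step_def by (intro rec_intros)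
  then show "recfun f \<Longrightarrow> recfun g \<Longrightarrow> recfun h \<Longrightarrow> recpred (\<lambda>z. occ (f z) (g z) (h z))"
    unfolding occ_def by (intro rec_intros recfun_course_of_values)
qed

lemma tcode_eq_Var: "tcode t = pr 2 y \<longleftrightarrow> t = Var y"
  using tcode_inject[of t "Var y"] by auto

lemma occ_rec: "occ f y q \<longleftrightarrow> occ_step (pr f y) q (table q (course_of_values occ_step (pr f y))) = 1"
  unfolding occ_def course_of_values[of occ_step "pr f y" q] ..

lemma occ_pr:
  "\<not> occ f y (pr 0 k)" "\<not> occ f y (pr 1 k)" "occ f y (pr 2 k) \<longleftrightarrow> f = 0 \<and> k = y"
  "occ f y (pr 3 (pr a b)) \<longleftrightarrow> occ f y a \<or> occ f y b"
  "occ f y (pr 4 a) \<longleftrightarrow> occ f y a"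
  "occ f y (pr 5 (pr k a)) \<longleftrightarrow> occ f y a \<or> f = 1 \<and> a = pr 2 y"
  "occ f y (pr 6 (pr k a)) \<longleftrightarrow> occ f y a \<or> f = 0 \<and> k = y"
  "occ f y (pr 7 (pr a b)) \<longleftrightarrow> occ f y a \<or> occ f y b"
  "occ f y (pr 8 (pr a b)) \<longleftrightarrow> occ f y a \<or> occ f y b"
  "occ f y (pr 9 (pr k (pr a b))) \<longleftrightarrow> occ f y a \<or> occ f y b"
  "occ f y (pr 10 (pr a b)) \<longleftrightarrow> occ f y a \<or> occ f y b"
  "occ f y (pr 11 a) \<longleftrightarrow> occ f y a"
  "occ f y (pr 12 (pr k a)) \<longleftrightarrow> occ f y a \<or> f = 0 \<and> k = y"
  unfolding occ_rec[of f y "pr _ _"]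
  by (simp_all add: occ_step_def table_app_table) (auto simp: occ_def)

lemma occ_vars:
  "occ 0 y (tcode t) \<longleftrightarrow> y \<in> tvars t" "occ 0 y (code \<phi>) \<longleftrightarrow> y \<in> vars \<phi>"
  by (induction t and \<phi>) (auto simp: occ_pr simp del: One_nat_def)

lemma occ_array_vars:
  "occ 1 y (tcode t) \<longleftrightarrow> y \<in> tarray_vars t" "occ 1 y (code \<phi>) \<longleftrightarrow> y \<in> array_vars \<phi>"
  by (induction t and \<phi>) (auto simp: occ_pr tcode_eq_Var simp del: One_nat_def split: trm.splits)

text \<open>The value 1 means well-formed as a term or as a formula; comparing tags with 7 tells
  which and keeps each kind out of the places of the other. Tags up to 2 accept any content, since
  every number codes an integer or names a symbol. Tag 6 has no clause because basic formulae
  contain no cardinality terms.\<close>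

definition bas_shape_step :: "nat \<Rightarrow> nat \<Rightarrow> nat \<Rightarrow> nat" where
  "bas_shape_step z q t = of_bool (
     p1 q \<le> 2 \<or>
     p1 q = 4 \<and> table_app t (p2 q) = 1 \<and> p1 (p2 q) < 7 \<or>
     p1 q = 5 \<and> p1 (p2 (p2 q)) = 2 \<or>
     (p1 q = 3 \<or> p1 q = 7 \<or> p1 q = 8) \<and> table_app t (p1 (p2 q)) = 1 \<and> p1 (p1 (p2 q)) < 7 \<and>
       table_app t (p2 (p2 q)) = 1 \<and> p1 (p2 (p2 q)) < 7 \<or>
     p1 q = 9 \<and> table_app t (p1 (p2 (p2 q))) = 1 \<and> p1 (p1 (p2 (p2 q))) < 7 \<and>
       table_app t (p2 (p2 (p2 q))) = 1 \<and> p1 (p2 (p2 (p2 q))) < 7 \<or>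
     p1 q = 10 \<and> table_app t (p1 (p2 q)) = 1 \<and> 7 \<le> p1 (p1 (p2 q)) \<and>
       table_app t (p2 (p2 q)) = 1 \<and> 7 \<le> p1 (p2 (p2 q)) \<or>
     p1 q = 11 \<and> table_app t (p2 q) = 1 \<and> 7 \<le> p1 (p2 q) \<or>
     p1 q = 12 \<and> table_app t (p2 (p2 q)) = 1 \<and> 7 \<le> p1 (p2 (p2 q)) \<and> \<not> occ 1 (p1 (p2 q)) (p2 (p2 q)))"

definition bas_code :: "nat \<Rightarrow> bool" where
  "bas_code q \<longleftrightarrow> 7 \<le> p1 q \<and> course_of_values bas_shape_step 0 q = 1"

lemma recpred_bas_code [rec_intros]: "recfun f \<Longrightarrow> recpred (\<lambda>z. bas_code (f z))"
proof -
  have "recfun (\<lambda>w. bas_shape_step (p1 w) (p1 (p2 w)) (p2 (p2 w)))"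
    unfolding bas_shape_step_def by (intro rec_intros)
  then show "recfun f \<Longrightarrow> recpred (\<lambda>z. bas_code (f z))"
    unfolding bas_code_def by (intro rec_intros recfun_course_of_values)
qed

lemma p1_code: "p1 (tcode t) < 7" "7 \<le> p1 (code \<phi>)"
  by (cases t; simp) (cases \<phi>; simp)

lemma course_of_values_bas_shape_step_pr:
  fixes a b k :: nat
  defines "T \<equiv> \<lambda>q. course_of_values bas_shape_step 0 q = 1 \<and> p1 q < 7" and "P \<equiv> \<lambda>q. course_of_values bas_shape_step 0 q = 1 \<and> 7 \<le> p1 q"
  shows "course_of_values bas_shape_step 0 (pr 0 k) = 1" "course_of_values bas_shape_step 0 (pr 1 k) = 1" "course_of_values bas_shape_step 0 (pr 2 k) = 1"
    "course_of_values bas_shape_step 0 (pr 3 (pr a b)) = of_bool (T a \<and> T b)"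
    "course_of_values bas_shape_step 0 (pr 4 a) = of_bool (T a)"
    "course_of_values bas_shape_step 0 (pr 5 (pr k a)) = of_bool (p1 a = 2)"
    "course_of_values bas_shape_step 0 (pr 6 (pr k a)) = 0"
    "course_of_values bas_shape_step 0 (pr 7 (pr a b)) = of_bool (T a \<and> T b)"
    "course_of_values bas_shape_step 0 (pr 8 (pr a b)) = of_bool (T a \<and> T b)"
    "course_of_values bas_shape_step 0 (pr 9 (pr k (pr a b))) = of_bool (T a \<and> T b)"
    "course_of_values bas_shape_step 0 (pr 10 (pr a b)) = of_bool (P a \<and> P b)"
    "course_of_values bas_shape_step 0 (pr 11 a) = of_bool (P a)"
    "course_of_values bas_shape_step 0 (pr 12 (pr k a)) = of_bool (P a \<and> \<not> occ 1 k a)"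
  unfolding T_def P_def course_of_values[of bas_shape_step 0 "pr _ _"]
  by (simp_all add: bas_shape_step_def table_app_table del: One_nat_def)

lemma p1_tcode_eq_2: "p1 (tcode t) = 2 \<longleftrightarrow> (\<exists>y. t = Var y)"
  by (cases t) auto

lemma course_of_values_bas_shape_step:
  "course_of_values bas_shape_step 0 (tcode t) = of_bool (tbas_shape t)" "course_of_values bas_shape_step 0 (code \<phi>) = of_bool (bas_shape \<phi>)"
  by (induction t and \<phi>) (simp_all add: course_of_values_bas_shape_step_pr p1_code p1_tcode_eq_2 occ_array_vars del: One_nat_def)

lemma bas_code_of_code: "bas_code (code \<phi>) \<longleftrightarrow> bas_shape \<phi>"
  by (simp add: bas_code_def course_of_values_bas_shape_step p1_code)

lemma p1_le: "p1 z \<le> z" and p2_le: "p2 z \<le> z"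
  using le_prod_encode_1[of "p1 z" "p2 z"] le_prod_encode_2[of "p2 z" "p1 z"] by simp_all

text \<open>The test is run on arbitrary numbers, so it must also reject those that code nothing.
  The components of a number with positive tag are smaller than the number, which drives the
  induction.\<close>

lemma decode_bas_shape:
  "course_of_values bas_shape_step 0 q = 1 \<Longrightarrow> (p1 q < 7 \<longrightarrow> (\<exists>t. q = tcode t)) \<and> (7 \<le> p1 q \<longrightarrow> (\<exists>\<phi>. q = code \<phi>))"
proof (induction q rule: less_induct)
  case (less q)
  define t where "t = table q (course_of_values bas_shape_step 0)"
  define r where "r = p2 q"
  have q: "q = pr (p1 q) r" by (simp add: r_def)
  have lt: "s < q" if "0 < p1 q" "s \<le> r" for s
    using less_pr[OF that] q by simp
  have le: "p1 r \<le> r" "p2 r \<le> r" "p1 (p2 r) \<le> r" "p2 (p2 r) \<le> r"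
    using p1_le[of r] p2_le[of r] p1_le[of "p2 r"] p2_le[of "p2 r"] by linarith+
  have T: "\<exists>t. s = tcode t" if "0 < p1 q" "s \<le> r" "table_app t s = 1" "p1 s < 7" for s
    using less.IH[OF lt[OF that(1,2)]] lt[OF that(1,2)] that(3,4) by (simp add: t_def table_app_table)
  have P: "\<exists>\<phi>. s = code \<phi>" if "0 < p1 q" "s \<le> r" "table_app t s = 1" "7 \<le> p1 s" for s
    using less.IH[OF lt[OF that(1,2)]] lt[OF that(1,2)] that(3,4) by (simp add: t_def table_app_table)
  have "bas_shape_step 0 q t = 1" using less.prems unfolding t_def course_of_values[of bas_shape_step 0 q] .
  note this[unfolded bas_shape_step_def of_bool_eq_1_iff r_def[symmetric]]
  then consider "p1 q \<le> 2"
    | "p1 q = 4" "table_app t r = 1" "p1 r < 7"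
    | "p1 q = 5" "p1 (p2 r) = 2"
    | "p1 q = 3 \<or> p1 q = 7 \<or> p1 q = 8" "table_app t (p1 r) = 1" "p1 (p1 r) < 7" "table_app t (p2 r) = 1" "p1 (p2 r) < 7"
    | "p1 q = 9" "table_app t (p1 (p2 r)) = 1" "p1 (p1 (p2 r)) < 7" "table_app t (p2 (p2 r)) = 1" "p1 (p2 (p2 r)) < 7"
    | "p1 q = 10" "table_app t (p1 r) = 1" "7 \<le> p1 (p1 r)" "table_app t (p2 r) = 1" "7 \<le> p1 (p2 r)"
    | "p1 q = 11" "table_app t r = 1" "7 \<le> p1 r"
    | "p1 q = 12" "table_app t (p2 r) = 1" "7 \<le> p1 (p2 r)"
    by (elim disjE conjE) blast+
  then show ?case
  proof cases
    case 1
    then consider "p1 q = 0" | "p1 q = 1" | "p1 q = 2" by linarith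
    then have "q = tcode (Num (int_decode r)) \<or> q = tcode (Par r) \<or> q = tcode (Var r)"
      using q by cases auto
    then have "\<exists>t. q = tcode t" by blast
    then show ?thesis using 1(1) by simp
  next
    case 2
    then obtain t where "r = tcode t" using T[of r] by auto
    then have "q = tcode (Minus t)" using q 2 by simp
    then have "\<exists>t. q = tcode t" by blast
    then show ?thesis using 2(1) by simp
  next
    case 3
    have "r = pr (p1 r) (pr (p1 (p2 r)) (p2 (p2 r)))" by simp
    then have "q = tcode (App (p1 r) (Var (p2 (p2 r))))" using q 3 by simp
    then have "\<exists>t. q = tcode t" by blast
    then show ?thesis using 3(1) by simp
  next
    case 4
    then obtain s t where st: "p1 r = tcode s" "p2 r = tcode t" using T[of "p1 r"] T[of "p2 r"] le by auto
    have "r = pr (p1 r) (p2 r)" by simp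
    then have "q = tcode (Add s t) \<or> q = code (Less s t) \<or> q = code (Equal s t)" using q 4(1) st by auto
    then show ?thesis using p1_code by fastforce
  next
    case 5
    then obtain s t where st: "p1 (p2 r) = tcode s" "p2 (p2 r) = tcode t"
      using T[of "p1 (p2 r)"] T[of "p2 (p2 r)"] le by auto
    have "r = pr (p1 r) (pr (p1 (p2 r)) (p2 (p2 r)))" by simp
    then have "q = code (Congr (p1 r) s t)" using q 5(1) st by simp
    then have "\<exists>\<phi>. q = code \<phi>" by blast
    then show ?thesis using 5(1) by simp
  next
    case 6
    then obtain \<phi> \<psi> where st: "p1 r = code \<phi>" "p2 r = code \<psi>" using P[of "p1 r"] P[of "p2 r"] le by auto
    have "r = pr (p1 r) (p2 r)" by simp
    then have "q = code (Conj \<phi> \<psi>)" using q 6(1) st by simp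
    then have "\<exists>\<phi>. q = code \<phi>" by blast
    then show ?thesis using 6(1) by simp
  next
    case 7
    then obtain \<phi> where "r = code \<phi>" using P[of r] by auto
    then have "q = code (Neg \<phi>)" using q 7 by simp
    then have "\<exists>\<phi>. q = code \<phi>" by blast
    then show ?thesis using 7(1) by simp
  next
    case 8
    then obtain \<phi> where st: "p2 r = code \<phi>" using P[of "p2 r"] le by auto
    have "r = pr (p1 r) (p2 r)" by simp
    then have "q = code (Exi (p1 r) \<phi>)" using q 8(1) st by simp
    then have "\<exists>\<phi>. q = code \<phi>" by blast
    then show ?thesis using 8(1) by simp
  qed
qed

lemma bas_code_iff: "bas_code q \<longleftrightarrow> (\<exists>\<phi>. q = code \<phi> \<and> bas_shape \<phi>)"
  using decode_bas_shape[of q] bas_code_of_code unfolding bas_code_def by metis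

text \<open>\<open>p2 (p2 q)\<close> is the body of a coded quantifier and \<open>p1 (p2 q)\<close>
  the left part of a coded conjunction. As conjunctions are bracketed to the left,
  \<open>conj_head\<close> meets the equations from the last to the first and ends at
  \<open>\<alpha>\<close>.\<close>

definition exi_tail :: "nat \<Rightarrow> nat \<Rightarrow> nat" where "exi_tail q j = ((\<lambda>q. p2 (p2 q)) ^^ j) q"
definition conj_head :: "nat \<Rightarrow> nat \<Rightarrow> nat" where "conj_head q j = ((\<lambda>q. p1 (p2 q)) ^^ j) q"

lemma recfun_exi_tail [rec_intros]: "recfun f \<Longrightarrow> recfun g \<Longrightarrow> recfun (\<lambda>z. exi_tail (f z) (g z))"
  and recfun_conj_head [rec_intros]: "recfun f \<Longrightarrow> recfun g \<Longrightarrow> recfun (\<lambda>z. conj_head (f z) (g z))"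
  unfolding exi_tail_def conj_head_def by (intro rec_intros; assumption)+

lemma exi_tail_0 [simp]: "exi_tail q 0 = q" and exi_tail_Suc: "exi_tail q (Suc j) = exi_tail (p2 (p2 q)) j"
  and conj_head_0 [simp]: "conj_head q 0 = q" and conj_head_Suc: "conj_head q (Suc j) = conj_head (p1 (p2 q)) j"
  by (simp_all add: exi_tail_def conj_head_def funpow_Suc_right del: funpow.simps(2))

definition count_eq_code :: "nat \<Rightarrow> nat \<Rightarrow> nat \<Rightarrow> nat" where
  "count_eq_code x b z = pr 8 (pr (pr 6 (pr x b)) (pr 2 z))"

lemma count_eq_code: "count_eq_code x (code \<beta>) z = code (Equal (Card x \<beta>) (Var z))"
  by (simp add: count_eq_code_def)

text \<open>The outermost quantifier binds the variable of the innermost equation, hence the index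
  \<open>K - Suc j\<close>.\<close>

definition eflat_code :: "nat \<Rightarrow> bool" where
  "eflat_code c \<longleftrightarrow> (\<exists>K\<le>c. \<exists>x\<le>Suc c. (\<forall>j<K. p1 (exi_tail c j) = 12) \<and>
     (\<forall>j<K. p1 (conj_head (exi_tail c K) j) = 10 \<and>
       (\<exists>b\<le>c. bas_code b \<and> p2 (p2 (conj_head (exi_tail c K) j)) = count_eq_code x b (p1 (p2 (exi_tail c (K - Suc j)))))) \<and>
     bas_code (conj_head (exi_tail c K) K) \<and> \<not> occ 0 x (conj_head (exi_tail c K) K))"

lemma recpred_eflat_code: "recpred eflat_code"
  unfolding eflat_code_def count_eq_code_def by (intro rec_intros)

lemma exi_tail_foldr: "j \<le> length zs \<Longrightarrow> exi_tail (code (foldr Exi zs \<chi>)) j = code (foldr Exi (drop j zs) \<chi>)"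
proof (induction zs arbitrary: j)
  case (Cons z zs)
  then show ?case by (cases j) (auto simp: exi_tail_Suc)
qed simp

lemma conj_head_foldl:
  "j \<le> length \<psi>s \<Longrightarrow> conj_head (code (foldl Conj \<alpha> \<psi>s)) j = code (foldl Conj \<alpha> (take (length \<psi>s - j) \<psi>s))"
proof (induction \<psi>s arbitrary: j rule: rev_induct)
  case (snoc \<psi> \<psi>s)
  then show ?case by (cases j) (auto simp: conj_head_Suc Suc_diff_le)
qed simp

text \<open>Pairing is surjective, so a number with tag 12 is always of the form
  \<open>pr 12 (pr x b)\<close>; checking the tags suffices to read off the prefix.\<close>

lemma foldr_exi_tail:
  assumes "\<forall>j<K. p1 (exi_tail q j) = 12" "exi_tail q K = code \<chi>"
  shows "q = code (foldr Exi (map (\<lambda>j. p1 (p2 (exi_tail q j))) [0..<K]) \<chi>)"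
  using assms
proof (induction K arbitrary: q)
  case (Suc K)
  have "\<forall>j<K. p1 (exi_tail (p2 (p2 q)) j) = 12" using Suc.prems(1) exi_tail_Suc by (metis Suc_less_eq)
  moreover have "exi_tail (p2 (p2 q)) K = code \<chi>" using Suc.prems(2) by (simp add: exi_tail_Suc)
  ultimately have "p2 (p2 q) = code (foldr Exi (map (\<lambda>j. p1 (p2 (exi_tail (p2 (p2 q)) j))) [0..<K]) \<chi>)"
    by (rule Suc.IH)
  moreover have "map (\<lambda>j. p1 (p2 (exi_tail q j))) [0..<Suc K] =
    p1 (p2 q) # map (\<lambda>j. p1 (p2 (exi_tail (p2 (p2 q)) j))) [0..<K]"
    unfolding map_upt_Suc by (simp add: exi_tail_Suc)
  moreover have "q = pr 12 (pr (p1 (p2 q)) (p2 (p2 q)))"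
    using Suc.prems(1)[rule_format, of 0] pr_p1_p2[of q] by simp
  ultimately show ?case by (metis code.simps(6) foldr.simps(2) o_apply)
qed simp

lemma foldl_conj_head:
  assumes "\<forall>j<K. p1 (conj_head q j) = 10 \<and> p2 (p2 (conj_head q j)) = code (\<psi> j)" "conj_head q K = code \<alpha>"
  shows "q = code (foldl Conj \<alpha> (rev (map \<psi> [0..<K])))"
  using assms
proof (induction K arbitrary: q \<psi>)
  case (Suc K)
  have "\<forall>j<K. p1 (conj_head (p1 (p2 q)) j) = 10 \<and> p2 (p2 (conj_head (p1 (p2 q)) j)) = code (\<psi> (Suc j))"
    using Suc.prems(1) conj_head_Suc by (metis Suc_less_eq)
  moreover have "conj_head (p1 (p2 q)) K = code \<alpha>" using Suc.prems(2) by (simp add: conj_head_Suc)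
  ultimately have "p1 (p2 q) = code (foldl Conj \<alpha> (rev (map (\<lambda>j. \<psi> (Suc j)) [0..<K])))"
    by (rule Suc.IH)
  moreover have "rev (map \<psi> [0..<Suc K]) = rev (map (\<lambda>j. \<psi> (Suc j)) [0..<K]) @ [\<psi> 0]"
    unfolding map_upt_Suc by simp
  moreover have "q = pr 10 (pr (p1 (p2 q)) (code (\<psi> 0)))"
    using Suc.prems(1)[rule_format, of 0] pr_p1_p2[of q] pr_p1_p2[of "p2 q"] by simp
  ultimately show ?case by simp
qed simp

lemma eflat_imp_eflat_code: assumes "eflat \<phi>" shows "eflat_code (code \<phi>)"
proof -
  obtain x zs \<alpha> \<beta>s where len: "length \<beta>s = length zs" and bas_shape: "bas_shape \<alpha>" "\<forall>\<beta>\<in>set \<beta>s. bas_shape \<beta>"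
    and x: "x \<notin> vars \<alpha>" and \<phi>: "\<phi> = foldr Exi zs (body \<alpha> x \<beta>s zs)"
    using assms unfolding eflat_body by blast
  let ?c = "code \<phi>" and ?K = "length zs"
  have K: "?K \<le> ?c" "code (body \<alpha> x \<beta>s zs) \<le> ?c"
    using code_foldr_Exi(1)[of "body \<alpha> x \<beta>s zs" zs] unfolding \<phi> by linarith+
  note le = code_body[OF len, where \<alpha> = \<alpha> and x = x]
  let ?\<psi>s = "map2 (\<lambda>\<beta> z. Equal (Card x \<beta>) (Var z)) \<beta>s zs"
  have l: "length ?\<psi>s = ?K" using len by simp
  have tail: "exi_tail ?c j = code (foldr Exi (drop j zs) (body \<alpha> x \<beta>s zs))" if "j \<le> ?K" for j
    unfolding \<phi> by (rule exi_tail_foldr[OF that])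
  have tailK: "exi_tail ?c ?K = code (body \<alpha> x \<beta>s zs)" using tail[of ?K] by simp
  have head: "conj_head (exi_tail ?c ?K) j = code (foldl Conj \<alpha> (take (?K - j) ?\<psi>s))" if "j \<le> ?K" for j
    unfolding tailK body_def using conj_head_foldl[of j ?\<psi>s \<alpha>] that l by simp
  have tail': "p1 (exi_tail ?c j) = 12" "p1 (p2 (exi_tail ?c j)) = zs ! j" if "j < ?K" for j
    using tail[of j] that by (simp_all add: Cons_nth_drop_Suc[symmetric])
  have head': "p1 (conj_head (exi_tail ?c ?K) j) = 10"
    "p2 (p2 (conj_head (exi_tail ?c ?K) j)) = count_eq_code x (code (\<beta>s ! (?K - Suc j))) (zs ! (?K - Suc j))" if j: "j < ?K" for j
  proof -
    have "?K - j = Suc (?K - Suc j)" using j by simp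
    then have "take (?K - j) ?\<psi>s = take (?K - Suc j) ?\<psi>s @ [?\<psi>s ! (?K - Suc j)]"
      using j l by (simp add: take_Suc_conv_app_nth)
    moreover have "?\<psi>s ! (?K - Suc j) = Equal (Card x (\<beta>s ! (?K - Suc j))) (Var (zs ! (?K - Suc j)))"
      using j len by simp
    ultimately have "conj_head (exi_tail ?c ?K) j = code (Conj (foldl Conj \<alpha> (take (?K - Suc j) ?\<psi>s))
        (Equal (Card x (\<beta>s ! (?K - Suc j))) (Var (zs ! (?K - Suc j)))))"
      using head[of j] j by simp
    then show "p1 (conj_head (exi_tail ?c ?K) j) = 10"
      "p2 (p2 (conj_head (exi_tail ?c ?K) j)) = count_eq_code x (code (\<beta>s ! (?K - Suc j))) (zs ! (?K - Suc j))"
      by (simp_all add: count_eq_code_def)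
  qed
  have last: "conj_head (exi_tail ?c ?K) ?K = code \<alpha>" using head[of ?K] by simp
  \<comment> \<open>Without equations \<open>x\<close> is constrained by \<open>\<alpha>\<close>
    alone, and \<open>Suc ?c\<close> exceeds all its variables; this is why the search for
    \<open>x\<close> extends to \<open>Suc c\<close>.\<close>
  define x' where "x' = (if zs = [] then Suc ?c else x)"
  have "Suc ?c \<notin> vars \<alpha>" using vars_le(2)[of \<alpha>] le(1) K(2) by force
  then have x': "x' \<le> Suc ?c" "x' \<notin> vars \<alpha>" using le(3)[of 0] K(2) x by (auto simp: x'_def)
  show ?thesis unfolding eflat_code_def
  proof (rule exI[of _ ?K], rule conjI[OF K(1)], rule exI[of _ x'], rule conjI[OF x'(1)], intro conjI allI impI)
    fix j assume j: "j < ?K"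
    show "p1 (exi_tail ?c j) = 12" "p1 (conj_head (exi_tail ?c ?K) j) = 10" using tail'(1) head'(1) j by blast+
    let ?i = "?K - Suc j"
    have i: "?i < ?K" using j by simp
    show "\<exists>b\<le>?c. bas_code b \<and> p2 (p2 (conj_head (exi_tail ?c ?K) j)) = count_eq_code x' b (p1 (p2 (exi_tail ?c ?i)))"
    proof (intro exI[of _ "code (\<beta>s ! ?i)"] conjI)
      show "code (\<beta>s ! ?i) \<le> ?c" using le(2)[OF i] K(2) by linarith
      show "bas_code (code (\<beta>s ! ?i))" using bas_shape(2) i len by (simp add: bas_code_of_code)
      have "x' = x" using j by (auto simp: x'_def)
      then show "p2 (p2 (conj_head (exi_tail ?c ?K) j)) = count_eq_code x' (code (\<beta>s ! ?i)) (p1 (p2 (exi_tail ?c ?i)))"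
        using head'(2)[OF j] tail'(2)[OF i] by simp
    qed
  next
    show "bas_code (conj_head (exi_tail ?c ?K) ?K)" "\<not> occ 0 x' (conj_head (exi_tail ?c ?K) ?K)"
      unfolding last using bas_shape(1) x'(2) by (simp_all add: bas_code_of_code occ_vars)
  qed
qed

lemma eflat_code_imp_eflat: assumes "eflat_code c" shows "\<exists>\<phi>. c = code \<phi> \<and> eflat \<phi>"
proof -
  obtain K x where tail: "\<forall>j<K. p1 (exi_tail c j) = 12"
    and head: "\<And>j. j < K \<Longrightarrow> p1 (conj_head (exi_tail c K) j) = 10 \<and>
      (\<exists>b. bas_code b \<and> p2 (p2 (conj_head (exi_tail c K) j)) = count_eq_code x b (p1 (p2 (exi_tail c (K - Suc j)))))"
    and last: "bas_code (conj_head (exi_tail c K) K)" "\<not> occ 0 x (conj_head (exi_tail c K) K)"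
    using assms unfolding eflat_code_def by blast
  obtain \<alpha> where \<alpha>: "conj_head (exi_tail c K) K = code \<alpha>" "bas_shape \<alpha>" using last(1) bas_code_iff by blast
  define z where "z j = p1 (p2 (exi_tail c j))" for j
  have "\<exists>\<beta>. bas_shape \<beta> \<and> p2 (p2 (conj_head (exi_tail c K) j)) = count_eq_code x (code \<beta>) (z (K - Suc j))" if "j < K" for j
    using head[OF that] unfolding bas_code_iff z_def by blast
  then obtain \<beta> where \<beta>: "\<And>j. j < K \<Longrightarrow> bas_shape (\<beta> j) \<and>
      p2 (p2 (conj_head (exi_tail c K) j)) = count_eq_code x (code (\<beta> j)) (z (K - Suc j))"
    by metis
  let ?\<psi> = "\<lambda>j. Equal (Card x (\<beta> j)) (Var (z (K - Suc j)))"
  \<comment> \<open>\<open>\<beta> j\<close> belongs to the \<open>j\<close>-th conjunct from the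
    outside, that is, counted from the last equation, while the prefix lists the variables from the
    first; hence \<open>rev\<close>.\<close>
  let ?zs = "map z [0..<K]" and ?\<beta>s = "rev (map \<beta> [0..<K])"
  have "exi_tail c K = code (foldl Conj \<alpha> (rev (map ?\<psi> [0..<K])))"
    by (rule foldl_conj_head[OF _ \<alpha>(1)]) (use head \<beta> in \<open>simp add: count_eq_code del: code.simps\<close>)
  also have "rev (map ?\<psi> [0..<K]) = map2 (\<lambda>\<beta> z. Equal (Card x \<beta>) (Var z)) ?\<beta>s ?zs"
    by (rule nth_equalityI) (auto simp: rev_nth)
  finally have "exi_tail c K = code (body \<alpha> x ?\<beta>s ?zs)" unfolding body_def .
  from foldr_exi_tail[OF tail this] have "c = code (foldr Exi ?zs (body \<alpha> x ?\<beta>s ?zs))"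
    unfolding z_def .
  moreover have "eflat (foldr Exi ?zs (body \<alpha> x ?\<beta>s ?zs))"
    unfolding eflat_body
  proof (intro exI conjI)
    show "length ?\<beta>s = length ?zs" by simp
    show "\<forall>\<beta>\<in>set ?\<beta>s. bas_shape \<beta>" using \<beta> by auto
    show "x \<notin> vars \<alpha>" using last(2) unfolding \<alpha>(1) occ_vars .
  qed (use \<alpha> in auto)
  ultimately show ?thesis by blast
qed

theorem theorem2: "decidable {code \<phi> | \<phi>. eflat \<phi> \<and> satisfiable \<phi>}"
proof -
  let ?S = "{code \<phi> | \<phi>. eflat \<phi> \<and> satisfiable \<phi>}"
  have S: "c \<in> ?S \<longleftrightarrow> eflat_code c \<and> bounded_sat_code (Suc c) c" for c
  proof
    assume "c \<in> ?S"
    then show "eflat_code c \<and> bounded_sat_code (Suc c) c" using eflat_imp_eflat_code bounded_sat_code_iff by auto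
  next
    assume c: "eflat_code c \<and> bounded_sat_code (Suc c) c"
    then obtain \<phi> where "c = code \<phi>" "eflat \<phi>" using eflat_code_imp_eflat by blast
    then show "c \<in> ?S" using c bounded_sat_code_iff by blast
  qed
  have "recpred (\<lambda>c. c \<in> ?S)"
    unfolding S by (intro rec_intros recpred_eflat_code)
  then obtain f where "recursive 1 f" "\<forall>xs. length xs = 1 \<longrightarrow> f xs = of_bool (xs ! 0 \<in> ?S)"
    unfolding recfun_def computable_def by blast
  then show ?thesis unfolding decidable_def by (intro exI[of _ f]) auto
qed

end
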